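(* Let $\eta>0$ be a (constant) parameter. There exists an algorithm that, given probe access to a $q$-spin system $\mathcal S=(G=(V,E),\boldsymbol\lambda,\boldsymbol A)$ with Gibbs distribution $\mu$ on a graph $G$ with maximum degree $\Delta\ge1$, satisfying (i) (normalized) $\sum_{c\in[q]}\lambda_v(c)=1$ for all $v\in V$ and $\max_{i,j\in[q]}A_e(i,j)=1$ for all $e\in E$, and (ii) (soft constraints) $A_e(c_1,c_2)\ge1-\frac{1-\eta}{2\Delta}$ for every edge $e\in E$ and all $c_1,c_2\in[q]$, and given a subset of vertices $\Lambda\subset V$, a partial configuration $\sigma\in[q]^\Lambda$ with $\mu_\Lambda(\sigma)>0$, a vertex $v\in V\setminus\Lambda$, and parameters $\varepsilon,\delta\in(0,1)$, outputs an estimate $\hat\mu_v^\sigma$ such that $$\Pr\left[\forall c\in[q]:\ (1-\varepsilon)\mu_v^\sigma(c)\le\hat\mu_v^\sigma(c)\le(1+\varepsilon)\mu_v^\sigma(c)\right]\ge1-\delta,$$ in expected time $O\left(\varepsilon^{-2}\delta^{-1}\Delta q^2\log q\cdot|\Lambda|\right)$.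
   Context: Let $q\ge2$ be an integer. A $q$-spin system $\mathcal S=(G=(V,E),\boldsymbol\lambda=(\lambda_v)_{v\in V},\boldsymbol A=(A_e)_{e\in E})$ is defined on a finite graph $G=(V,E)$, with an external field $\lambda_v\in\mathbb R_{\ge0}^q$ at each vertex $v$ and an interaction matrix $A_e\in\mathbb R_{\ge0}^{q\times q}$ at each edge $e$. Its Gibbs distribution on $[q]^V$ is $\mu(\sigma)=w(\sigma)/Z$, where $w(\sigma)=\prod_{v\in V}\lambda_v(\sigma(v))\prod_{e=(u,v)\in E}A_e(\sigma(u),\sigma(v))$ and $Z=\sum_{\sigma\in[q]^V}w(\sigma)$. For $\Lambda\subseteq V$, $\mu_\Lambda(\tau)=\sum_{\sigma\in[q]^V:\sigma_\Lambda=\tau}\mu(\sigma)$ for $\tau\in[q]^\Lambda$. For $\sigma\in[q]^\Lambda$ with $\mu_\Lambda(\sigma)>0$ and $v\in V\setminus\Lambda$, the conditional marginal distribution is $\mu_v^\sigma(c)=\Pr_{\tau\sim\mu}[\tau_v=c\mid\tau_\Lambda=\sigma]$ for $c\in[q]$. Probe access means: for each $v\in V$, each neighbor of $v$ can be accessed in $O(1)$ time, and each entry of every $\lambda_v$ and $A_e$ can be retrieved in $O(1)$ time.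
   Formalization: In the expected time bound the factor |Λ| is read as max(1,|Λ|), since for empty Λ the literal bound would be 0, which no algorithm can meet; for nonempty Λ the bound is as stated. *)

theory Defs
  imports "HOL-Probability.Probability"
begin

section \<open>Spin systems\<close>

text \<open>
  Vertices are named by natural numbers and the spins are \<open>0, \<dots>, q - 1\<close>.  The graph is finite and
  simple; every undirected edge occurs in \<open>edges\<close> exactly once, as a pair \<open>(u, w)\<close> in an arbitrary
  orientation, and \<open>interaction (u, w) i j\<close> is the weight for spin \<open>i\<close> at \<open>u\<close> and \<open>j\<close> at \<open>w\<close>.
  So interaction matrices need not be symmetric.
\<close>

record spin_system =
  spins :: nat
  verts :: "nat set"
  edges :: "(nat \<times> nat) set"
  vfield :: "nat \<Rightarrow> nat \<Rightarrow> real"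
  interaction :: "nat \<times> nat \<Rightarrow> nat \<Rightarrow> nat \<Rightarrow> real"

definition wf_spin_system :: "spin_system \<Rightarrow> bool" where
  "wf_spin_system S \<longleftrightarrow>
     spins S \<ge> 2 \<and> finite (verts S) \<and> edges S \<subseteq> verts S \<times> verts S \<and>
     (\<forall>u w. (u, w) \<in> edges S \<longrightarrow> u \<noteq> w \<and> (w, u) \<notin> edges S) \<and>
     (\<forall>u\<in>verts S. \<forall>c<spins S. vfield S u c \<ge> 0) \<and>
     (\<forall>e\<in>edges S. \<forall>i<spins S. \<forall>j<spins S. interaction S e i j \<ge> 0)"

definition neighbors :: "spin_system \<Rightarrow> nat \<Rightarrow> nat set" where
  "neighbors S u = {w. (u, w) \<in> edges S \<or> (w, u) \<in> edges S}"

definition max_degree :: "spin_system \<Rightarrow> nat" where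
  "max_degree S = Max ((\<lambda>u. card (neighbors S u)) ` verts S)"

definition configs :: "spin_system \<Rightarrow> nat set \<Rightarrow> (nat \<Rightarrow> nat) set" where
  "configs S \<Lambda> = \<Lambda> \<rightarrow>\<^sub>E {..<spins S}"

definition weight :: "spin_system \<Rightarrow> (nat \<Rightarrow> nat) \<Rightarrow> real" where
  "weight S \<sigma> = (\<Prod>u\<in>verts S. vfield S u (\<sigma> u)) *
     (\<Prod>e\<in>edges S. interaction S e (\<sigma> (fst e)) (\<sigma> (snd e)))"

definition partition_fun :: "spin_system \<Rightarrow> real" where
  "partition_fun S = (\<Sum>\<sigma>\<in>configs S (verts S). weight S \<sigma>)"

definition gibbs :: "spin_system \<Rightarrow> (nat \<Rightarrow> nat) \<Rightarrow> real" where
  "gibbs S \<sigma> = weight S \<sigma> / partition_fun S"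

definition gibbs_marginal :: "spin_system \<Rightarrow> nat set \<Rightarrow> (nat \<Rightarrow> nat) \<Rightarrow> real" where
  "gibbs_marginal S \<Lambda> \<tau> = (\<Sum>\<sigma> | \<sigma> \<in> configs S (verts S) \<and> restrict \<sigma> \<Lambda> = \<tau>. gibbs S \<sigma>)"

definition cond_marginal :: "spin_system \<Rightarrow> nat set \<Rightarrow> (nat \<Rightarrow> nat) \<Rightarrow> nat \<Rightarrow> nat \<Rightarrow> real" where
  "cond_marginal S \<Lambda> \<sigma> v c =
     (\<Sum>\<tau> | \<tau> \<in> configs S (verts S) \<and> restrict \<tau> \<Lambda> = \<sigma> \<and> \<tau> v = c. gibbs S \<tau>) /
     gibbs_marginal S \<Lambda> \<sigma>"

definition normalized :: "spin_system \<Rightarrow> bool" where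
  "normalized S \<longleftrightarrow>
     (\<forall>u\<in>verts S. (\<Sum>c<spins S. vfield S u c) = 1) \<and>
     (\<forall>e\<in>edges S. Max ((\<lambda>(i, j). interaction S e i j) ` ({..<spins S} \<times> {..<spins S})) = 1)"

definition soft_constraints :: "real \<Rightarrow> spin_system \<Rightarrow> bool" where
  "soft_constraints \<eta> S \<longleftrightarrow>
     (\<forall>e\<in>edges S. \<forall>c1<spins S. \<forall>c2<spins S.
        interaction S e c1 c2 \<ge> 1 - (1 - \<eta>) / (2 * real (max_degree S)))"


section \<open>Randomized real RAM with probe access\<close>

text \<open>
  A machine state consists of arrays of unbounded length, some with natural number entries and some
  with real entries (\<open>nmem s a i\<close> and \<open>rmem s a i\<close> are the \<open>i\<close>-th entries of the \<open>a\<close>-th arrays).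
  A program can only name arrays by constants, so it uses finitely many of them; indices are computed.
  The only real constants are obtained from naturals with the four arithmetic operations, and there
  is no conversion from reals to naturals.
\<close>

record mem =
  nmem :: "nat \<Rightarrow> nat \<Rightarrow> nat"
  rmem :: "nat \<Rightarrow> nat \<Rightarrow> real"

datatype nexp =
    NConst nat
  | NArr nat nexp
  | NAdd nexp nexp
  | NSub nexp nexp
  | Degree nexp
  | Neighbor nexp nexp

datatype rexp =
    RofN nexp
  | RArr nat nexp
  | RAdd rexp rexp
  | RSub rexp rexp
  | RMul rexp rexp
  | RDiv rexp rexp
  | Field nexp nexp
  | Interaction nexp nexp nexp nexp

datatype bexp =
    NLess nexp nexp
  | NEq nexp nexp
  | RLess rexp rexp
  | BNot bexp
  | BAnd bexp bexp

datatype com =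
    Skip
  | NAssign nat nexp nexp
  | RAssign nat nexp rexp
  | Flip nat nexp rexp
  | Seq com com
  | If bexp com com
  | While bexp com
  | Call nat

text \<open>
  The probed object is a spin system together with adjacency lists, whose order is arbitrary.
  The vertex set, the orientation of the edges and the maximum degree cannot be probed.
\<close>

definition adjacency_lists :: "spin_system \<Rightarrow> (nat \<Rightarrow> nat list) \<Rightarrow> bool" where
  "adjacency_lists S adj \<longleftrightarrow> (\<forall>u\<in>verts S. distinct (adj u) \<and> set (adj u) = neighbors S u)"

primrec neval :: "(nat \<Rightarrow> nat list) \<Rightarrow> mem \<Rightarrow> nexp \<Rightarrow> nat" where
  "neval adj s (NConst n) = n"
| "neval adj s (NArr a e) = nmem s a (neval adj s e)"
| "neval adj s (NAdd e f) = neval adj s e + neval adj s f"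
| "neval adj s (NSub e f) = neval adj s e - neval adj s f"
| "neval adj s (Degree e) = length (adj (neval adj s e))"
| "neval adj s (Neighbor e f) =
     (let xs = adj (neval adj s e); k = neval adj s f in if k < length xs then xs ! k else 0)"

definition interaction_at :: "spin_system \<Rightarrow> nat \<Rightarrow> nat \<Rightarrow> nat \<Rightarrow> nat \<Rightarrow> real" where
  "interaction_at S u w i j =
     (if (u, w) \<in> edges S then interaction S (u, w) i j
      else if (w, u) \<in> edges S then interaction S (w, u) j i
      else 0)"

primrec reval :: "spin_system \<Rightarrow> (nat \<Rightarrow> nat list) \<Rightarrow> mem \<Rightarrow> rexp \<Rightarrow> real" where
  "reval S adj s (RofN e) = real (neval adj s e)"
| "reval S adj s (RArr a e) = rmem s a (neval adj s e)"
| "reval S adj s (RAdd e f) = reval S adj s e + reval S adj s f"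
| "reval S adj s (RSub e f) = reval S adj s e - reval S adj s f"
| "reval S adj s (RMul e f) = reval S adj s e * reval S adj s f"
| "reval S adj s (RDiv e f) = reval S adj s e / reval S adj s f"
| "reval S adj s (Field u c) = vfield S (neval adj s u) (neval adj s c)"
| "reval S adj s (Interaction u w i j) =
     interaction_at S (neval adj s u) (neval adj s w) (neval adj s i) (neval adj s j)"

primrec beval :: "spin_system \<Rightarrow> (nat \<Rightarrow> nat list) \<Rightarrow> mem \<Rightarrow> bexp \<Rightarrow> bool" where
  "beval S adj s (NLess e f) \<longleftrightarrow> neval adj s e < neval adj s f"
| "beval S adj s (NEq e f) \<longleftrightarrow> neval adj s e = neval adj s f"
| "beval S adj s (RLess e f) \<longleftrightarrow> reval S adj s e < reval S adj s f"
| "beval S adj s (BNot b) \<longleftrightarrow> \<not> beval S adj s b"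
| "beval S adj s (BAnd b b') \<longleftrightarrow> beval S adj s b \<and> beval S adj s b'"

definition nwrite :: "nat \<Rightarrow> nat \<Rightarrow> nat \<Rightarrow> mem \<Rightarrow> mem" where
  "nwrite a i x s = s\<lparr>nmem := (nmem s)(a := (nmem s a)(i := x))\<rparr>"

definition rwrite :: "nat \<Rightarrow> nat \<Rightarrow> real \<Rightarrow> mem \<Rightarrow> mem" where
  "rwrite a i x s = s\<lparr>rmem := (rmem s)(a := (rmem s a)(i := x))\<rparr>"

text \<open>
  A program is a list of procedure bodies without parameters or local variables, the first one being
  the main procedure.  The first component of a machine configuration is the stack of
  commands still to be executed; the machine has halted when it is empty.
  \<open>Flip a e p\<close> stores a random bit that is 1 with probability \<open>p\<close> (clamped to the unit interval);
  with the usual source of uniform reals in the unit interval this is one draw and one comparison.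

  Each step costs one unit of time.  It evaluates a bounded number of expressions of the program
  text, each of which has a size independent of the instance that the program is run on.
\<close>

fun exec_step ::
  "com list \<Rightarrow> spin_system \<Rightarrow> (nat \<Rightarrow> nat list) \<Rightarrow> com list \<times> mem \<Rightarrow> (com list \<times> mem) pmf"
where
  "exec_step P S adj ([], s) = return_pmf ([], s)"
| "exec_step P S adj (Skip # K, s) = return_pmf (K, s)"
| "exec_step P S adj (NAssign a i e # K, s) =
     return_pmf (K, nwrite a (neval adj s i) (neval adj s e) s)"
| "exec_step P S adj (RAssign a i e # K, s) =
     return_pmf (K, rwrite a (neval adj s i) (reval S adj s e) s)"
| "exec_step P S adj (Flip a i p # K, s) =
     map_pmf (\<lambda>b. (K, nwrite a (neval adj s i) (of_bool b) s)) (bernoulli_pmf (reval S adj s p))"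
| "exec_step P S adj (Seq c d # K, s) = return_pmf (c # d # K, s)"
| "exec_step P S adj (If b c d # K, s) = return_pmf ((if beval S adj s b then c else d) # K, s)"
| "exec_step P S adj (While b c # K, s) =
     return_pmf (if beval S adj s b then c # While b c # K else K, s)"
| "exec_step P S adj (Call p # K, s) = return_pmf (if p < length P then P ! p # K else K, s)"

text \<open>\<open>run P S adj s n\<close> is the joint distribution of the configuration and the number of steps executed
  when the machine is started on \<open>s\<close> and stopped after \<open>n\<close> steps if it has not halted before.\<close>

primrec run ::
  "com list \<Rightarrow> spin_system \<Rightarrow> (nat \<Rightarrow> nat list) \<Rightarrow> mem \<Rightarrow> nat \<Rightarrow> ((com list \<times> mem) \<times> nat) pmf"
where
  "run P S adj s 0 = return_pmf (([Call 0], s), 0)"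
| "run P S adj s (Suc n) = bind_pmf (run P S adj s n)
     (\<lambda>(cf, t). if fst cf = [] then return_pmf (cf, t)
                else map_pmf (\<lambda>cf'. (cf', Suc t)) (exec_step P S adj cf))"

text \<open>
  With \<open>T\<close> the running time, possibly infinite, the expectations of \<open>min T n\<close> increase to the
  expectation of \<open>T\<close>, and the events of having halted within \<open>n\<close> steps increase to the event of halting.
\<close>

definition expected_time ::
  "com list \<Rightarrow> spin_system \<Rightarrow> (nat \<Rightarrow> nat list) \<Rightarrow> mem \<Rightarrow> ennreal" where
  "expected_time P S adj s = (SUP n. \<integral>\<^sup>+ x. of_nat (snd x) \<partial>measure_pmf (run P S adj s n))"

definition prob_halts_with ::
  "com list \<Rightarrow> spin_system \<Rightarrow> (nat \<Rightarrow> nat list) \<Rightarrow> mem \<Rightarrow> (mem \<Rightarrow> bool) \<Rightarrow> real" where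
  "prob_halts_with P S adj s Q =
     (SUP n. measure_pmf.prob (run P S adj s n) {((K, s'), t). K = [] \<and> Q s'})"

text \<open>
  The input consists of \<open>q\<close>, \<open>v\<close>, \<open>\<Lambda>\<close> (its size and an enumeration in arbitrary order),
  the spins of \<open>\<sigma>\<close> in the same order, \<open>\<epsilon>\<close> and \<open>\<delta>\<close>.  All other cells are initially 0.
\<close>

definition input_mem ::
  "nat \<Rightarrow> nat \<Rightarrow> nat list \<Rightarrow> (nat \<Rightarrow> nat) \<Rightarrow> real \<Rightarrow> real \<Rightarrow> mem" where
  "input_mem q v L \<sigma> \<epsilon> \<delta> =
     \<lparr>nmem = (\<lambda>a i.
        if a = 0 then (if i = 0 then q else if i = 1 then v else if i = 2 then length L else 0)
        else if a = 1 then (if i < length L then L ! i else 0)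
        else if a = 2 then (if i < length L then \<sigma> (L ! i) else 0)
        else 0),
      rmem = (\<lambda>a i.
        if a = 0 then (if i = 0 then \<epsilon> else if i = 1 then \<delta> else 0) else 0)\<rparr>"

definition output_estimate :: "mem \<Rightarrow> nat \<Rightarrow> real" where
  "output_estimate s c = rmem s 1 c"

end

theory Submission
  imports Defs
begin

text \<open>
  Given the neighbours' spins \<open>\<tau>\<close>, the spin of \<open>v\<close> can be sampled by rejection: propose
  \<open>c\<close> with law \<open>\<lambda>\<^sub>v\<close> and accept with probability \<open>\<Prod>\<^sub>u A\<^sub>v\<^sub>u(c, \<tau>\<^sub>u)\<close>, where \<open>\<tau>\<close> has the
  Gibbs law of the graph without \<open>v\<close>.  By the soft constraints each factor is at least
  \<open>1 - p\<close> with \<open>p = 1 / (2 deg v)\<close>, so it suffices to reveal each neighbour with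
  probability \<open>p\<close> and to use the factor \<open>1 - (1 - A) / p\<close> if it is revealed and 1 otherwise.
  Revealed neighbours are sampled recursively in the graph without \<open>v\<close>, conditioned on those
  revealed before.  The recursion is exact, its depth is at most the number of vertices, and a proposal
  makes at most 1/2 recursive calls on average while it is accepted with probability at least
  \<open>(1 + \<eta>) / 2\<close>; so the expected time is \<open>O(\<Delta> + q)\<close> uniformly in the depth.

  For a multiplicative estimate at all spins simultaneously, including unlikely ones, the
  acceptance probabilities are averaged instead of the samples: \<open>\<mu>\<^sub>v(c)\<close> is proportional to
  \<open>\<lambda>\<^sub>v(c) m\<^sub>c\<close> with \<open>m\<^sub>c \<ge> 1/2\<close>, and one revealed set of neighbours gives an unbiased
  estimate in \<open>[0, 1]\<close> of every \<open>m\<^sub>c\<close>.  Chebyshev's inequality and a union bound over the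
  spins ask for \<open>O(q \<epsilon>\<^sup>-\<^sup>2 \<delta>\<^sup>-\<^sup>1)\<close> repetitions.
\<close>

section \<open>Pinned spin systems\<close>

text \<open>Dividing the two averages, a call spawns at most 1 / (1 + \<eta>) < 1 further calls on
  average. This subcriticality is what the 2 in the soft constraints buys, and its margin is the
  origin of the factor 1 / \<eta> in the constant. The degree replaces \<Delta> in p because
  \<Delta> cannot be probed; p only grows thereby, so 1 - (1 - A) / p is still at least \<eta>. The
  obstacle is that rejection loops have no bound on their number of rounds, and that time and output
  are defined through truncated runs. Statements about programs are therefore upper bounds, uniform
  in the step budget, on one quantity that mixes time with a nonnegative payoff. Payoff 0 gives the
  expected time; time price 0 with the indicator of a wrong output as payoff gives the failure
  probability, so the program is analysed only once. Exactness of the sampler also becomes an upper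
  bound: arbitrary bounds \<open>g\<close> for the continuations are averaged against the
  marginal.\<close>

locale soft_spin_system =
  fixes S :: spin_system and adj :: "nat \<Rightarrow> nat list" and \<eta> :: real
  assumes wf: "wf_spin_system S"
    and adj: "adjacency_lists S adj"
    and deg: "max_degree S \<ge> 1"
    and normal: "normalized S"
    and soft: "soft_constraints \<eta> S"
    and eta: "0 < \<eta>" "\<eta> \<le> 1"
begin

abbreviation "q \<equiv> spins S"
abbreviation "V \<equiv> verts S"
abbreviation "\<Delta> \<equiv> max_degree S"
abbreviation "A \<equiv> interaction_at S"

definition wt :: "nat set \<Rightarrow> (nat \<Rightarrow> nat) \<Rightarrow> real" where
  "wt B z = (\<Prod>u\<in>B. vfield S u (z u)) *
     (\<Prod>e\<in>edges S \<inter> B \<times> B. interaction S e (z (fst e)) (z (snd e)))"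

text \<open>Configurations are total functions that copy \<open>y\<close> off \<open>F\<close>, so
  that an array of the machine can serve as \<open>y\<close>; \<open>wt B\<close> ignores their
  values outside \<open>B\<close>.\<close>

definition agree :: "nat set \<Rightarrow> (nat \<Rightarrow> nat) \<Rightarrow> (nat \<Rightarrow> nat) set" where
  "agree F y = {z. (\<forall>u\<in>F. z u < q) \<and> (\<forall>u. u \<notin> F \<longrightarrow> z u = y u)}"

text \<open>Partition function of the subgraph induced by \<open>B\<close> with the vertices of
  \<open>B - F\<close> pinned to \<open>y\<close>.\<close>

definition Z :: "nat set \<Rightarrow> nat set \<Rightarrow> (nat \<Rightarrow> nat) \<Rightarrow> real" where
  "Z F B y = (\<Sum>z\<in>agree F y. wt B z)"

lemma q_ge_2: "q \<ge> 2" and finite_V: "finite V"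
  and edges_V: "(u, w) \<in> edges S \<Longrightarrow> u \<in> V \<and> w \<in> V"
  and edges_irrefl: "(u, w) \<in> edges S \<Longrightarrow> u \<noteq> w"
  and edges_antisym: "(u, w) \<in> edges S \<Longrightarrow> (w, u) \<notin> edges S"
  and vfield_nonneg: "u \<in> V \<Longrightarrow> c < q \<Longrightarrow> vfield S u c \<ge> 0"
  and interaction_nonneg: "e \<in> edges S \<Longrightarrow> i < q \<Longrightarrow> j < q \<Longrightarrow> interaction S e i j \<ge> 0"
  using wf unfolding wf_spin_system_def by auto

lemma finite_edges: "finite (edges S)"
  using wf finite_V unfolding wf_spin_system_def by (auto intro: finite_subset)

lemma vfield_sum: "u \<in> V \<Longrightarrow> (\<Sum>c<q. vfield S u c) = 1"
  using normal unfolding normalized_def by auto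

lemma distinct_adj: "u \<in> V \<Longrightarrow> distinct (adj u)"
  and set_adj: "u \<in> V \<Longrightarrow> set (adj u) = neighbors S u"
  using adj unfolding adjacency_lists_def by auto

lemma neighbors_V: "w \<in> neighbors S u \<Longrightarrow> w \<in> V"
  unfolding neighbors_def using edges_V by auto

lemma length_adj_le: assumes "u \<in> V" shows "length (adj u) \<le> \<Delta>"
proof -
  have "length (adj u) = card (neighbors S u)"
    using distinct_card[OF distinct_adj[OF assms]] set_adj[OF assms] by simp
  also have "\<dots> \<le> \<Delta>"
    unfolding max_degree_def using finite_V assms by (intro Max_ge) auto
  finally show ?thesis .
qed

lemma interaction_bounds:
  assumes "e \<in> edges S" "i < q" "j < q"
  shows "interaction S e i j \<le> 1" "interaction S e i j \<ge> 1 - (1 - \<eta>) / (2 * real \<Delta>)"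
proof -
  have *: "Max ((\<lambda>(i, j). interaction S e i j) ` ({..<q} \<times> {..<q})) = 1"
    using normal assms(1) unfolding normalized_def by auto
  have "interaction S e i j \<in> (\<lambda>(i, j). interaction S e i j) ` ({..<q} \<times> {..<q})"
    using assms by force
  then show "interaction S e i j \<le> 1"
    unfolding *[symmetric] by (intro Max_ge) auto
  show "interaction S e i j \<ge> 1 - (1 - \<eta>) / (2 * real \<Delta>)"
    using soft assms unfolding soft_constraints_def by auto
qed

lemma A_bounds:
  assumes "w \<in> neighbors S u" "i < q" "j < q"
  shows "A u w i j \<le> 1" "A u w i j \<ge> 1 - (1 - \<eta>) / (2 * real \<Delta>)"
  using assms interaction_bounds unfolding neighbors_def interaction_at_def by auto

section \<open>Partition functions with pinned vertices\<close>

lemma agree_cong: "(\<And>u. u \<notin> F \<Longrightarrow> y u = y' u) \<Longrightarrow> agree F y = agree F y'"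
  unfolding agree_def by auto

lemma Z_cong: "(\<And>u. u \<notin> F \<Longrightarrow> y u = y' u) \<Longrightarrow> Z F B y = Z F B y'"
  unfolding Z_def using agree_cong by metis

lemma finite_agree: assumes "finite F" shows "finite (agree F y)"
proof (rule finite_subset)
  show "agree F y \<subseteq> (\<lambda>g u. if u \<in> F then g u else y u) ` (F \<rightarrow>\<^sub>E {..<q})"
  proof
    fix z assume z: "z \<in> agree F y"
    have "z = (\<lambda>u. if u \<in> F then restrict z F u else y u)"
      using z by (auto simp: agree_def)
    moreover have "restrict z F \<in> F \<rightarrow>\<^sub>E {..<q}" using z by (auto simp: agree_def)
    ultimately show "z \<in> (\<lambda>g u. if u \<in> F then g u else y u) ` (F \<rightarrow>\<^sub>E {..<q})" by blast
  qed
  show "finite ((\<lambda>g u. if u \<in> F then g u else y u) ` (F \<rightarrow>\<^sub>E {..<q}))"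
    using assms by (intro finite_imageI finite_PiE) auto
qed

lemma sum_agree:
  fixes \<phi> :: "(nat \<Rightarrow> nat) \<Rightarrow> real"
  assumes "finite F" "u \<in> F"
  shows "(\<Sum>z\<in>agree F y. \<phi> z) = (\<Sum>a<q. \<Sum>z\<in>agree (F - {u}) (y(u := a)). \<phi> z)"
proof -
  have "agree F y = (\<Union>a<q. agree (F - {u}) (y(u := a)))"
    using assms(2) by (auto simp: agree_def split: if_splits)
  moreover have "(\<Sum>z\<in>(\<Union>a<q. agree (F - {u}) (y(u := a))). \<phi> z) =
      (\<Sum>a<q. \<Sum>z\<in>agree (F - {u}) (y(u := a)). \<phi> z)"
  proof (rule sum.UNION_disjoint)
    show "\<forall>a\<in>{..<q}. finite (agree (F - {u}) (y(u := a)))"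
      using finite_agree assms(1) by simp
    show "\<forall>a\<in>{..<q}. \<forall>b\<in>{..<q}. a \<noteq> b \<longrightarrow>
        agree (F - {u}) (y(u := a)) \<inter> agree (F - {u}) (y(u := b)) = {}"
    proof (intro ballI impI)
      fix a b :: nat assume "a \<noteq> b"
      have "z u = a" if "z \<in> agree (F - {u}) (y(u := a))" for z a
        using that by (auto simp: agree_def)
      then show "agree (F - {u}) (y(u := a)) \<inter> agree (F - {u}) (y(u := b)) = {}"
        using \<open>a \<noteq> b\<close> by blast
    qed
  qed simp
  ultimately show ?thesis by simp
qed

lemma Z_split: "finite F \<Longrightarrow> u \<in> F \<Longrightarrow> Z F B y = (\<Sum>a<q. Z (F - {u}) B (y(u := a)))"
  unfolding Z_def by (rule sum_agree)

lemma wt_cong: "(\<And>u. u \<in> B \<Longrightarrow> z u = z' u) \<Longrightarrow> wt B z = wt B z'"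
  unfolding wt_def by (auto intro!: arg_cong2[where f = "(*)"] prod.cong)

text \<open>An edge at \<open>v\<close> is stored in either orientation, and
  \<open>interaction_at\<close> reads its matrix with \<open>v\<close> first. As no edge occurs in
  both orientations, the edges between \<open>v\<close> and \<open>B\<close> correspond bijectively
  to the neighbours of \<open>v\<close> in \<open>B\<close>.\<close>

lemma wt_insert:
  assumes v: "v \<in> V" "v \<notin> B" and B: "B \<subseteq> V"
  shows "wt (insert v B) z =
    wt B z * (vfield S v (z v) * (\<Prod>u\<in>neighbors S v \<inter> B. A v u (z v) (z u)))"
proof -
  define I where "I = (\<lambda>e. interaction S e (z (fst e)) (z (snd e)))"
  define E where "E = {e \<in> edges S. (fst e = v \<and> snd e \<in> B) \<or> (snd e = v \<and> fst e \<in> B)}"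
  have finB: "finite B" using B finite_V finite_subset by blast
  have 1: "edges S \<inter> insert v B \<times> insert v B = (edges S \<inter> B \<times> B) \<union> E"
    using edges_irrefl unfolding E_def by auto
  have 2: "(edges S \<inter> B \<times> B) \<inter> E = {}" using v unfolding E_def by auto
  have 3: "(\<Prod>e\<in>E. I e) = (\<Prod>u\<in>neighbors S v \<inter> B. A v u (z v) (z u))"
  proof (rule prod.reindex_bij_witness[where
        i = "\<lambda>u. if (v, u) \<in> edges S then (v, u) else (u, v)" and
        j = "\<lambda>e. if fst e = v then snd e else fst e"])
    fix e assume "e \<in> E"
    then show "(if (v, if fst e = v then snd e else fst e) \<in> edges S
        then (v, if fst e = v then snd e else fst e)
        else (if fst e = v then snd e else fst e, v)) = e"
      using edges_antisym v by (cases e) (auto simp: E_def)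
  next
    fix e assume "e \<in> E"
    then show "(if fst e = v then snd e else fst e) \<in> neighbors S v \<inter> B"
      using v by (cases e) (auto simp: E_def neighbors_def)
  next
    fix u assume "u \<in> neighbors S v \<inter> B"
    then show "(if fst (if (v, u) \<in> edges S then (v, u) else (u, v)) = v
        then snd (if (v, u) \<in> edges S then (v, u) else (u, v))
        else fst (if (v, u) \<in> edges S then (v, u) else (u, v))) = u"
      by auto
  next
    fix u assume "u \<in> neighbors S v \<inter> B"
    then show "(if (v, u) \<in> edges S then (v, u) else (u, v)) \<in> E"
      by (auto simp: E_def neighbors_def)
  next
    fix e assume e: "e \<in> E"
    obtain x y where e2: "e = (x, y)" by (cases e)
    have "(x, y) \<in> edges S" "(x = v \<and> y \<in> B) \<or> (y = v \<and> x \<in> B)" using e by (auto simp: E_def e2)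
    moreover have "(y, x) \<notin> edges S" using edges_antisym calculation(1) by blast
    ultimately show "A v (if fst e = v then snd e else fst e) (z v)
        (z (if fst e = v then snd e else fst e)) = I e"
      using v by (auto simp: e2 I_def interaction_at_def)
  qed
  have "(\<Prod>e\<in>edges S \<inter> insert v B \<times> insert v B. I e) =
      (\<Prod>e\<in>edges S \<inter> B \<times> B. I e) * (\<Prod>e\<in>E. I e)"
    unfolding 1 by (rule prod.union_disjoint) (use 2 finite_edges in \<open>auto simp: E_def\<close>)
  then show ?thesis
    unfolding wt_def 3[symmetric] I_def[symmetric] using finB v by simp
qed

lemma wt_nonneg: assumes "B \<subseteq> V" "\<And>u. u \<in> B \<Longrightarrow> z u < q" shows "wt B z \<ge> 0"
  unfolding wt_def using assms vfield_nonneg interaction_nonneg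
  by (intro mult_nonneg_nonneg prod_nonneg) auto

text \<open>At most \<Delta> factors, each at least 1 - x with x = (1 - \<eta>) / (2 \<Delta>),
  multiply to at least 1 - \<Delta> x = (1 + \<eta>) / 2 by Bernoulli's inequality.\<close>

lemma prod_A_ge:
  assumes v: "v \<in> V" and N: "N \<subseteq> neighbors S v" and "a < q" "\<And>u. u \<in> N \<Longrightarrow> z u < q"
  shows "(\<Prod>u\<in>N. A v u a (z u)) \<ge> (1 + \<eta>) / 2" "(\<Prod>u\<in>N. A v u a (z u)) \<le> 1"
proof -
  define x where "x = (1 - \<eta>) / (2 * real \<Delta>)"
  have x: "0 \<le> x" "x \<le> 1" unfolding x_def using eta deg by (auto simp: field_simps)
  have fin: "finite (set (adj v))" by simp
  have cN: "card N \<le> length (adj v)"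
    using card_mono[OF fin, of N] N set_adj[OF v] distinct_card[OF distinct_adj[OF v]] by simp
  also have "\<dots> \<le> \<Delta>" using length_adj_le[OF v] .
  finally have cD: "real (card N) \<le> real \<Delta>" by simp
  have "(1 + \<eta>) / 2 \<le> 1 - real \<Delta> * x" unfolding x_def using deg by (simp add: field_simps)
  also have "\<dots> \<le> 1 - real (card N) * x" using cD x by (simp add: mult_right_mono)
  also have "\<dots> \<le> (1 - x) ^ card N"
    using Bernoulli_inequality[of "- x" "card N"] x by simp
  also have "\<dots> = (\<Prod>u\<in>N. 1 - x)" by simp
  also have "\<dots> \<le> (\<Prod>u\<in>N. A v u a (z u))"
    using x A_bounds(2)[of _ v a] assms unfolding x_def by (intro prod_mono) auto
  finally show "(\<Prod>u\<in>N. A v u a (z u)) \<ge> (1 + \<eta>) / 2" .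
  have "0 \<le> A v u a (z u)" if "u \<in> N" for u
    using that A_bounds(2)[of u v a "z u"] assms x unfolding x_def by fastforce
  then show "(\<Prod>u\<in>N. A v u a (z u)) \<le> 1"
    using A_bounds(1)[of _ v a] assms by (intro prod_le_1) auto
qed

text \<open>A status is 0 for a free vertex, 1 for a deleted one (whose spin is being sampled), 2 for
  \<open>u \<in> \<Lambda>\<close>, and \<open>w + 3\<close> for a vertex pinned while the spin of \<open>w\<close> is being sampled.\<close>

definition free :: "(nat \<Rightarrow> nat) \<Rightarrow> nat set" where "free st = {u \<in> V. st u = 0}"
definition present :: "(nat \<Rightarrow> nat) \<Rightarrow> nat set" where "present st = {u \<in> V. st u \<noteq> 1}"

definition ZZ :: "(nat \<Rightarrow> nat) \<Rightarrow> (nat \<Rightarrow> nat) \<Rightarrow> real" where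
  "ZZ st y = Z (free st) (present st) y"

text \<open>Conditional law of the spin of the free vertex \<open>u\<close> given the pins, in the
  graph without the deleted vertices: a quotient of two partition functions that differ by one more
  pin.\<close>

definition marg :: "(nat \<Rightarrow> nat) \<Rightarrow> (nat \<Rightarrow> nat) \<Rightarrow> nat \<Rightarrow> nat \<Rightarrow> real" where
  "marg st y u a = Z (free st - {u}) (present st) (y(u := a)) / ZZ st y"

definition pinned_ok :: "(nat \<Rightarrow> nat) \<Rightarrow> (nat \<Rightarrow> nat) \<Rightarrow> bool" where
  "pinned_ok st y \<longleftrightarrow> (\<forall>u\<in>V. st u \<ge> 2 \<longrightarrow> y u < q)"

definition valid :: "(nat \<Rightarrow> nat) \<Rightarrow> (nat \<Rightarrow> nat) \<Rightarrow> bool" where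
  "valid st y \<longleftrightarrow> pinned_ok st y \<and> ZZ st y > 0"

section \<open>Conditioning on pins of positive probability\<close>

lemma finite_free: "finite (free st)" unfolding free_def using finite_V by simp

lemma present_V: "present st \<subseteq> V" unfolding present_def by auto

lemma agree_lt:
  assumes "pinned_ok st y" "z \<in> agree (free st) y" "u \<in> present st"
  shows "z u < q"
  using assms unfolding pinned_ok_def agree_def present_def free_def
  by (cases "st u = 0") (auto simp: Suc_le_eq numeral_2_eq_2)

lemma ZZ_nonneg: "pinned_ok st y \<Longrightarrow> ZZ st y \<ge> 0"
  unfolding ZZ_def Z_def using wt_nonneg[OF present_V] agree_lt by (intro sum_nonneg) blast

lemma pinned_ok_pin: "pinned_ok st y \<Longrightarrow> a < q \<Longrightarrow> pinned_ok (st(u := k)) (y(u := a))"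
  unfolding pinned_ok_def by auto

lemma free_upd: "k \<noteq> 0 \<Longrightarrow> free (st(u := k)) = free st - {u}"
  unfolding free_def by auto

lemma present_upd: "k \<ge> 2 \<Longrightarrow> st u = 0 \<Longrightarrow> present (st(u := k)) = present st"
  unfolding present_def by auto

lemma ZZ_pin:
  "k \<ge> 2 \<Longrightarrow> st u = 0 \<Longrightarrow> ZZ (st(u := k)) (y(u := a)) = Z (free st - {u}) (present st) (y(u := a))"
  unfolding ZZ_def using free_upd[of k st u] present_upd[of k st u] by simp

lemma marg_pin: "k \<ge> 2 \<Longrightarrow> st u = 0 \<Longrightarrow> marg st y u a = ZZ (st(u := k)) (y(u := a)) / ZZ st y"
  unfolding marg_def by (simp add: ZZ_pin)

text \<open>A spin of positive marginal keeps the partition function positive, so a recursion that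
  follows only such spins never conditions on a null event.\<close>

lemma valid_pin:
  assumes "valid st y" "k \<ge> 2" "st u = 0" "a < q" "marg st y u a > 0"
  shows "valid (st(u := k)) (y(u := a))"
  using assms marg_pin[of k st u y a] pinned_ok_pin[of st y a u k] unfolding valid_def
  by (auto simp: zero_less_divide_iff)

lemma marg_nonneg:
  assumes "valid st y" "st u = 0" "a < q"
  shows "marg st y u a \<ge> 0"
  using assms marg_pin[of 2 st u y a] ZZ_nonneg pinned_ok_pin[of st y a u 2] unfolding valid_def
  by auto

lemma sum_marg:
  assumes "valid st y" "st u = 0" "u \<in> V"
  shows "(\<Sum>a<q. marg st y u a) = 1"
proof -
  have "(\<Sum>a<q. Z (free st - {u}) (present st) (y(u := a))) = ZZ st y"
    unfolding ZZ_def using assms by (intro Z_split[symmetric] finite_free) (auto simp: free_def)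
  then show ?thesis
    using assms(1) unfolding marg_def valid_def by (simp add: sum_divide_distrib[symmetric])
qed

text \<open>Array 4 still holds old spins at vertices whose pins were released; marginals must not
  depend on them.\<close>

lemma marg_cong:
  assumes "\<And>w. w \<notin> free st \<Longrightarrow> y w = y' w"
  shows "marg st y u a = marg st y' u a"
proof -
  have "Z (free st - {u}) (present st) (y(u := a)) = Z (free st - {u}) (present st) (y'(u := a))"
    using assms by (intro Z_cong) auto
  moreover have "ZZ st y = ZZ st y'" unfolding ZZ_def using assms by (intro Z_cong) auto
  ultimately show ?thesis unfolding marg_def by simp
qed

lemma valid_cong:
  assumes "\<And>w. w \<notin> free st \<Longrightarrow> y w = y' w"
  shows "valid st y = valid st y'"
proof -
  have "ZZ st y = ZZ st y'" unfolding ZZ_def using assms by (intro Z_cong) auto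
  moreover have "pinned_ok st y = pinned_ok st y'"
    unfolding pinned_ok_def using assms by (auto simp: free_def)
  ultimately show ?thesis unfolding valid_def by simp
qed

text \<open>Expectation of \<open>\<phi>\<close> at the pinning that results from visiting the neighbours \<open>us\<close> of \<open>v\<close> and
  revealing each free one with probability \<open>1 / (2 deg v)\<close>.\<close>

primrec revE :: "nat \<Rightarrow> nat list \<Rightarrow> (nat \<Rightarrow> nat) \<Rightarrow> (nat \<Rightarrow> nat) \<Rightarrow>
    ((nat \<Rightarrow> nat) \<Rightarrow> (nat \<Rightarrow> nat) \<Rightarrow> real) \<Rightarrow> real" where
  "revE v [] st y \<phi> = \<phi> st y"
| "revE v (u # us) st y \<phi> =
     (if st u = 0
      then (1 - 1 / (2 * real (length (adj v)))) * revE v us st y \<phi> +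
           1 / (2 * real (length (adj v))) *
             (\<Sum>a<q. marg st y u a * revE v us (st(u := v + 3)) (y(u := a)) \<phi>)
      else revE v us st y \<phi>)"

section \<open>Revealing as an expectation operator\<close>

lemma revE_add: "revE v us st y (\<lambda>st y. \<phi> st y + \<psi> st y) = revE v us st y \<phi> + revE v us st y \<psi>"
  by (induction us arbitrary: st y) (auto simp: algebra_simps sum.distrib)

lemma revE_cmult: "revE v us st y (\<lambda>st y. x * \<phi> st y) = x * revE v us st y \<phi>"
  by (induction us arbitrary: st y) (auto simp: algebra_simps sum_distrib_left)

lemma revE_zero: "revE v us st y (\<lambda>st y. 0) = 0"
  using revE_cmult[of v us st y 0] by simp

lemma revE_sum: "finite I \<Longrightarrow>
  revE v us st y (\<lambda>st y. \<Sum>i\<in>I. \<phi> i st y) = (\<Sum>i\<in>I. revE v us st y (\<phi> i))"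
  by (induction I rule: finite_induct) (auto simp: revE_add revE_zero)

text \<open>Branches of marginal 0 may carry an invalid pinning and an arbitrary value, but they are
  multiplied by 0; the weights sum to 1 by \<open>sum_marg\<close>.\<close>

lemma revE_const:
  assumes "valid st y" "set us \<subseteq> V" "distinct us"
  shows "revE v us st y (\<lambda>st y. x) = x"
  using assms
proof (induction us arbitrary: st y)
  case (Cons u us)
  show ?case
  proof (cases "st u = 0")
    case True
    have "marg st y u a * revE v us (st(u := v + 3)) (y(u := a)) (\<lambda>st y. x) = marg st y u a * x"
      if "a < q" for a
    proof (cases "marg st y u a > 0")
      case pos: True
      have "revE v us (st(u := v + 3)) (y(u := a)) (\<lambda>st y. x) = x"
      proof (rule Cons.IH)
        show "valid (st(u := v + 3)) (y(u := a))"
          using valid_pin[OF Cons.prems(1) _ True that pos, of "v + 3"] by simp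
      qed (use Cons.prems in auto)
      then show ?thesis by simp
    next
      case False
      then show ?thesis using marg_nonneg[OF Cons.prems(1) True that] by simp
    qed
    then have "(\<Sum>a<q. marg st y u a * revE v us (st(u := v + 3)) (y(u := a)) (\<lambda>st y. x)) =
        (\<Sum>a<q. marg st y u a * x)"
      by (intro sum.cong) auto
    also have "\<dots> = x"
      using sum_marg[OF Cons.prems(1) True] Cons.prems by (simp add: sum_distrib_right[symmetric])
    finally have "(\<Sum>a<q. marg st y u a * revE v us (st(u := v + 3)) (y(u := a)) (\<lambda>st y. x)) = x" .
    then show ?thesis using True Cons by (simp add: algebra_simps)
  next
    case False
    then show ?thesis using Cons by simp
  qed
qed simp

text \<open>At \<open>n = 0\<close> the quotient is 0 by the convention for division, so a vertex
  without neighbours needs no case of its own.\<close>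

lemma half_inverse_le_1: "1 / (2 * real n) \<le> 1"
  by (cases n) auto

text \<open>The comparison is asked for only at pinnings that revealing can reach, because bounds
  such as acceptance probabilities in the unit interval may fail at invalid ones.\<close>

lemma revE_mono:
  assumes "valid st y" "set us \<subseteq> V" "distinct us"
    and "\<And>st' y'. valid st' y' \<Longrightarrow> (\<And>u. u \<notin> set us \<Longrightarrow> st' u = st u \<and> y' u = y u) \<Longrightarrow>
      (\<And>u. st' u = st u \<or> (st u = 0 \<and> u \<in> set us \<and> st' u = v + 3)) \<Longrightarrow>
       \<phi> st' y' \<le> \<psi> st' y'"
  shows "revE v us st y \<phi> \<le> revE v us st y \<psi>"
  using assms
proof (induction us arbitrary: st y)
  case (Cons u us)
  have step0: "revE v us st y \<phi> \<le> revE v us st y \<psi>"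
  proof (rule Cons.IH)
    fix st' y'
    assume *: "valid st' y'" "\<And>w. w \<notin> set us \<Longrightarrow> st' w = st w \<and> y' w = y w"
      "\<And>w. st' w = st w \<or> (st w = 0 \<and> w \<in> set us \<and> st' w = v + 3)"
    show "\<phi> st' y' \<le> \<psi> st' y'"
      by (rule Cons.prems(4)) (use * in auto)
  qed (use Cons.prems in auto)
  show ?case
  proof (cases "st u = 0")
    case True
    have "marg st y u a * revE v us (st(u := v + 3)) (y(u := a)) \<phi> \<le>
          marg st y u a * revE v us (st(u := v + 3)) (y(u := a)) \<psi>" if "a < q" for a
    proof (cases "marg st y u a > 0")
      case pos: True
      have "revE v us (st(u := v + 3)) (y(u := a)) \<phi> \<le> revE v us (st(u := v + 3)) (y(u := a)) \<psi>"
      proof (rule Cons.IH)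
        show "valid (st(u := v + 3)) (y(u := a))"
          using valid_pin[OF Cons.prems(1) _ True that pos, of "v + 3"] by simp
        fix st' y'
        assume *: "valid st' y'"
          "\<And>w. w \<notin> set us \<Longrightarrow> st' w = (st(u := v + 3)) w \<and> y' w = (y(u := a)) w"
          "\<And>w. st' w = (st(u := v + 3)) w \<or>
            ((st(u := v + 3)) w = 0 \<and> w \<in> set us \<and> st' w = v + 3)"
        show "\<phi> st' y' \<le> \<psi> st' y'"
        proof (rule Cons.prems(4)[OF *(1)])
          fix w
          show "w \<notin> set (u # us) \<Longrightarrow> st' w = st w \<and> y' w = y w" using *(2)[of w] by auto
          show "st' w = st w \<or> (st w = 0 \<and> w \<in> set (u # us) \<and> st' w = v + 3)"
            using *(3)[of w] True by (auto split: if_splits)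
        qed
      qed (use Cons.prems in auto)
      then show ?thesis using pos by (simp add: mult_left_mono)
    next
      case False
      then show ?thesis using marg_nonneg[OF Cons.prems(1) True that] by simp
    qed
    then have "(\<Sum>a<q. marg st y u a * revE v us (st(u := v + 3)) (y(u := a)) \<phi>) \<le>
       (\<Sum>a<q. marg st y u a * revE v us (st(u := v + 3)) (y(u := a)) \<psi>)"
      by (intro sum_mono) auto
    then show ?thesis
      using True step0 half_inverse_le_1[of "length (adj v)"]
      by (simp only: revE.simps if_True simp_thms) (intro add_mono mult_left_mono, auto)
  next
    case False
    then show ?thesis using step0 by simp
  qed
qed simp

text \<open>With p = 1 / (2 deg v), the middle case is 1 - (1 - A) / p, for a neighbour revealed on
  behalf of \<open>v\<close>. A neighbour pinned earlier, in \<Lambda> or for another vertex, is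
  known at no cost and enters with its plain factor A; a status below 2 means unrevealed or
  deleted.\<close>

definition factor :: "nat \<Rightarrow> nat \<Rightarrow> (nat \<Rightarrow> nat) \<Rightarrow> (nat \<Rightarrow> nat) \<Rightarrow> nat \<Rightarrow> real" where
  "factor v c st y u =
     (if st u < 2 then 1
      else if st u = v + 3 then 1 - 2 * real (length (adj v)) * (1 - A v u c (y u))
      else A v u c (y u))"

definition acc :: "nat \<Rightarrow> nat \<Rightarrow> (nat \<Rightarrow> nat) \<Rightarrow> (nat \<Rightarrow> nat) \<Rightarrow> real" where
  "acc v c st y = (\<Prod>u\<in>set (adj v). factor v c st y u)"

text \<open>Each induction step averages over one neighbour by \<open>(1 - p) + p (1 - (1 - A) / p) = A\<close>.\<close>

lemma revE_prod:
  assumes "valid st y" "set us \<subseteq> set (adj v)" "distinct us" "v \<in> V"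
  shows "revE v us st y (acc v c) =
    (\<Sum>z\<in>agree (free st) y. wt (present st) z *
       (\<Prod>u\<in>set (adj v). if u \<in> set us \<and> st u = 0 then A v u c (z u) else factor v c st y u)) / ZZ st y"
  using assms
proof (induction us arbitrary: st y)
  case Nil
  then show ?case
    by (simp add: acc_def sum_distrib_right[symmetric] ZZ_def Z_def valid_def)
next
  case (Cons u us)
  define N where "N = set (adj v)"
  have uV: "u \<in> V" using Cons.prems set_adj[of v] neighbors_V by auto
  have uN: "u \<in> N" "finite N" using Cons.prems by (auto simp: N_def)
  show ?case
  proof (cases "st u = 0")
    case False
    have "(if w \<in> set us \<and> st w = 0 then A v w c (z w) else factor v c st y w) =
          (if w \<in> set (u # us) \<and> st w = 0 then A v w c (z w) else factor v c st y w)" for w z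
      using False by auto
    then show ?thesis using False Cons by simp
  next
    case True
    define d where "d = real (length (adj v))"
    have d: "d > 0" using Cons.prems by (auto simp: d_def)
    define p where "p = 1 / (2 * d)"
    define R where "R = (\<lambda>z. \<Prod>w\<in>N - {u}. if w \<in> set us \<and> st w = 0 then A v w c (z w) else factor v c st y w)"
    define Y where "Y = (\<lambda>a. agree (free st - {u}) (y(u := a)))"
    have split: "(\<Sum>z\<in>agree (free st) y. h z) = (\<Sum>a<q. \<Sum>z\<in>Y a. h z)" for h :: "(nat \<Rightarrow> nat) \<Rightarrow> real"
      unfolding Y_def using True uV by (intro sum_agree finite_free) (auto simp: free_def)
    have ZP: "ZZ st y > 0" using Cons.prems by (simp add: valid_def)
    have A1: "revE v us st y (acc v c) * ZZ st y = (\<Sum>a<q. \<Sum>z\<in>Y a. wt (present st) z * R z)"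
    proof -
      have "(\<Prod>w\<in>N. if w \<in> set us \<and> st w = 0 then A v w c (z w) else factor v c st y w) = R z" for z
        unfolding R_def using uN True Cons.prems
        by (subst prod.remove[OF uN(2) uN(1)]) (simp add: factor_def)
      then show ?thesis
        using Cons.IH[OF Cons.prems(1)] Cons.prems ZP unfolding split N_def[symmetric] by simp
    qed
    have A2: "marg st y u a * revE v us (st(u := v + 3)) (y(u := a)) (acc v c) * ZZ st y =
      (\<Sum>z\<in>Y a. wt (present st) z * (R z * (1 - (1 - A v u c (z u)) / p)))" if "a < q" for a
    proof (cases "marg st y u a > 0")
      case True2: True
      let ?st = "st(u := v + 3)" and ?y = "y(u := a)"
      have val: "valid ?st ?y"
        using valid_pin[OF Cons.prems(1) _ True that True2, of "v + 3"] by simp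
      have mg: "marg st y u a * ZZ st y = ZZ ?st ?y"
        using marg_pin[of "v + 3" st u y a] True ZP by simp
      have pr: "(\<Prod>w\<in>N. if w \<in> set us \<and> ?st w = 0 then A v w c (z w) else factor v c ?st ?y w) =
          R z * (1 - (1 - A v u c (z u)) / p)" if "z \<in> Y a" for z
      proof -
        have zu: "z u = a" using that by (auto simp: Y_def agree_def)
        have "(\<Prod>w\<in>N - {u}. if w \<in> set us \<and> ?st w = 0 then A v w c (z w) else factor v c ?st ?y w) = R z"
          unfolding R_def by (rule prod.cong) (auto simp: factor_def)
        moreover have "(if u \<in> set us \<and> ?st u = 0 then A v u c (z u) else factor v c ?st ?y u) =
            1 - (1 - A v u c (z u)) / p"
          using zu by (simp add: factor_def p_def d_def)
        ultimately show ?thesis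
          by (subst prod.remove[OF uN(2) uN(1)]) simp
      qed
      have fr: "agree (free ?st) ?y = Y a" unfolding Y_def by (simp add: free_upd)
      have ps: "present ?st = present st" using present_upd[of "v + 3" st u] True by simp
      have "revE v us ?st ?y (acc v c) =
         (\<Sum>z\<in>agree (free ?st) ?y. wt (present ?st) z *
         (\<Prod>u\<in>set (adj v). if u \<in> set us \<and> ?st u = 0 then A v u c (z u) else factor v c ?st ?y u)) / ZZ ?st ?y"
        by (rule Cons.IH, rule val) (use Cons.prems in auto)
      then have "revE v us ?st ?y (acc v c) * ZZ ?st ?y =
         (\<Sum>z\<in>Y a. wt (present st) z * (R z * (1 - (1 - A v u c (z u)) / p)))"
        using val pr
        unfolding fr ps N_def[symmetric] by (simp add: valid_def)
      then show ?thesis using mg by (metis (no_types, lifting) mult.assoc mult.commute)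
    next
      case False
      \<comment> \<open>In a branch of marginal 0 the nonnegative weights sum to 0 and so vanish one
        by one; both sides are then 0, whatever value \<open>revE\<close> has there.\<close>
      then have m0: "marg st y u a = 0" using marg_nonneg[OF Cons.prems(1) True that] by simp
      then have sum0: "(\<Sum>z\<in>Y a. wt (present st) z) = 0"
        using ZP unfolding marg_def Y_def Z_def by simp
      have wt0: "wt (present st) z \<ge> 0" if z: "z \<in> Y a" for z
      proof (rule wt_nonneg[OF present_V])
        fix w assume "w \<in> present st"
        moreover have "z \<in> agree (free st) y"
          using z True uV \<open>a < q\<close> unfolding Y_def agree_def free_def by (auto split: if_splits)
        ultimately show "z w < q" using agree_lt Cons.prems(1) unfolding valid_def by blast
      qed
      have "finite (Y a)" unfolding Y_def by (intro finite_agree) (simp add: finite_free)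
      then have "(sum (wt (present st)) (Y a) = 0) = (\<forall>z\<in>Y a. wt (present st) z = 0)"
        by (rule sum_nonneg_eq_0_iff) (rule wt0)
      then have "\<forall>z\<in>Y a. wt (present st) z = 0" using sum0 by (simp only: simp_thms)
      then have "(\<Sum>z\<in>Y a. wt (present st) z * (R z * (1 - (1 - A v u c (z u)) / p))) = 0"
        by (intro sum.neutral) (metis mult_zero_left)
      then show ?thesis unfolding m0 by (simp only: mult_zero_left)
    qed
    have A3: "(\<Prod>w\<in>N. if w \<in> set (u # us) \<and> st w = 0 then A v w c (z w) else factor v c st y w) =
        R z * A v u c (z u)" for z
    proof -
      have "(\<Prod>w\<in>N - {u}. if w \<in> set (u # us) \<and> st w = 0 then A v w c (z w) else factor v c st y w) = R z"
        unfolding R_def by (rule prod.cong) auto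
      then show ?thesis using True by (subst prod.remove[OF uN(2) uN(1)]) simp
    qed
    have "revE v (u # us) st y (acc v c) * ZZ st y =
       (1 - p) * (revE v us st y (acc v c) * ZZ st y) +
       p * (\<Sum>a<q. marg st y u a * revE v us (st(u := v + 3)) (y(u := a)) (acc v c) * ZZ st y)"
      using True by (simp add: p_def d_def sum_distrib_right distrib_right mult.assoc)
    also have "\<dots> = (1 - p) * (\<Sum>a<q. \<Sum>z\<in>Y a. wt (present st) z * R z) +
       p * (\<Sum>a<q. \<Sum>z\<in>Y a. wt (present st) z * (R z * (1 - (1 - A v u c (z u)) / p)))"
      using A1 A2 by simp
    also have "\<dots> = (\<Sum>a<q. \<Sum>z\<in>Y a. (1 - p) * (wt (present st) z * R z) +
       p * (wt (present st) z * (R z * (1 - (1 - A v u c (z u)) / p))))"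
      by (simp add: sum_distrib_left sum.distrib)
    also have "\<dots> = (\<Sum>a<q. \<Sum>z\<in>Y a. wt (present st) z * (R z * A v u c (z u)))"
    proof (intro sum.cong refl)
      fix a z
      have "p \<noteq> 0" using d by (simp add: p_def)
      then show "(1 - p) * (wt (present st) z * R z) +
         p * (wt (present st) z * (R z * (1 - (1 - A v u c (z u)) / p))) =
         wt (present st) z * (R z * A v u c (z u))"
        by (simp add: field_simps)
    qed
    also have "\<dots> = (\<Sum>z\<in>agree (free st) y. wt (present st) z *
       (\<Prod>w\<in>N. if w \<in> set (u # us) \<and> st w = 0 then A v w c (z w) else factor v c st y w))"
      unfolding A3 split ..
    finally show ?thesis using ZP unfolding N_def by (simp add: nonzero_eq_divide_eq)
  qed
qed

section \<open>Mean acceptance probabilities as quotients of partition functions\<close>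

definition acc_mean :: "nat \<Rightarrow> (nat \<Rightarrow> nat) \<Rightarrow> (nat \<Rightarrow> nat) \<Rightarrow> nat \<Rightarrow> real" where
  "acc_mean v st y c = revE v (adj v) st y (acc v c)"

text \<open>The vertex \<open>v\<close> is being sampled and has not pinned any vertex yet.\<close>

definition active :: "nat \<Rightarrow> (nat \<Rightarrow> nat) \<Rightarrow> bool" where
  "active v st \<longleftrightarrow> v \<in> V \<and> st v = 1 \<and> (\<forall>u. st u \<noteq> v + 3)"

text \<open>\<open>active\<close> excludes pins held by \<open>v\<close> beforehand, so every
  present neighbour ends up with its plain factor A: the free ones by averaging over the revealing,
  the pinned ones by definition of \<open>factor\<close>. Deleted neighbours give 1.\<close>

lemma acc_mean_eq:
  assumes "valid st y" "active v st"
  shows "acc_mean v st y c = (\<Sum>z\<in>agree (free st) y. wt (present st) z *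
       (\<Prod>u\<in>neighbors S v \<inter> present st. A v u c (z u))) / ZZ st y"
proof -
  have v: "v \<in> V" "st v = 1" "\<And>u. st u \<noteq> v + 3" using assms(2) by (auto simp: active_def)
  have "(\<Prod>u\<in>set (adj v). if u \<in> set (adj v) \<and> st u = 0 then A v u c (z u) else factor v c st y u) =
        (\<Prod>u\<in>neighbors S v \<inter> present st. A v u c (z u))" if "z \<in> agree (free st) y" for z
  proof -
    have "(\<Prod>u\<in>set (adj v). if u \<in> set (adj v) \<and> st u = 0 then A v u c (z u) else factor v c st y u) =
          (\<Prod>u\<in>set (adj v). if u \<in> present st then A v u c (z u) else 1)"
    proof (rule prod.cong)
      fix u assume u: "u \<in> set (adj v)"
      have "u \<in> V" using u set_adj[OF v(1)] neighbors_V by auto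
      then show "(if u \<in> set (adj v) \<and> st u = 0 then A v u c (z u) else factor v c st y u) =
         (if u \<in> present st then A v u c (z u) else 1)"
        using u v that by (auto simp: factor_def present_def agree_def free_def)
    qed simp
    also have "\<dots> = (\<Prod>u\<in>set (adj v) \<inter> present st. A v u c (z u))"
      by (simp add: prod.inter_restrict)
    finally show ?thesis using set_adj[OF v(1)] by simp
  qed
  then show ?thesis
    unfolding acc_mean_def using revE_prod[OF assms(1) subset_refl distinct_adj[OF v(1)] v(1)]
    by simp
qed

text \<open>By \<open>wt_insert\<close>, restoring \<open>v\<close> with spin \<open>c\<close>
  multiplies each weight by the field and by the product of interactions, whose average over the
  graph without \<open>v\<close> is the mean acceptance probability.\<close>

lemma field_acc_mean:
  assumes "valid st y" "active v st"
  shows "vfield S v c * acc_mean v st y c * ZZ st y =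
    Z (free st) (insert v (present st)) (y(v := c))"
proof -
  have v: "v \<in> V" "v \<notin> present st" "v \<notin> free st"
    using assms(2) by (auto simp: active_def present_def free_def)
  define T where "T = (\<lambda>z. wt (present st) z * (\<Prod>u\<in>neighbors S v \<inter> present st. A v u c (z u)))"
  have "ZZ st y > 0" using assms by (simp add: valid_def)
  then have "vfield S v c * acc_mean v st y c * ZZ st y = vfield S v c * (\<Sum>z\<in>agree (free st) y. T z)"
    unfolding acc_mean_eq[OF assms] T_def by simp
  \<comment> \<open>\<open>T\<close> does not see the spin of the deleted vertex \<open>v\<close>,
    so that spin may be set to \<open>c\<close> throughout.\<close>
  also have "(\<Sum>z\<in>agree (free st) y. T z) = (\<Sum>z\<in>agree (free st) (y(v := c)). T z)"
  proof (rule sum.reindex_bij_witness[where i = "\<lambda>z. z(v := y v)" and j = "\<lambda>z. z(v := c)"])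
    fix z
    have "wt (present st) (z(v := c)) = wt (present st) z" using v by (intro wt_cong) auto
    moreover have "(\<Prod>u\<in>neighbors S v \<inter> present st. A v u c ((z(v := c)) u)) =
        (\<Prod>u\<in>neighbors S v \<inter> present st. A v u c (z u))"
      using v by (intro prod.cong) auto
    ultimately show "T (z(v := c)) = T z" unfolding T_def by simp
  qed (use v in \<open>auto simp: agree_def\<close>)
  also have "vfield S v c * \<dots> = Z (free st) (insert v (present st)) (y(v := c))"
    unfolding Z_def sum_distrib_left
  proof (rule sum.cong)
    fix z assume "z \<in> agree (free st) (y(v := c))"
    then have "z v = c" using v by (auto simp: agree_def)
    then show "vfield S v c * T z = wt (insert v (present st)) z"
      unfolding wt_insert[OF v(1,2) present_V] T_def by simp
  qed simp
  finally show ?thesis .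
qed

lemma acc_mean_bounds:
  assumes "valid st y" "active v st" "c < q"
  shows "acc_mean v st y c \<ge> (1 + \<eta>) / 2" "acc_mean v st y c \<le> 1"
proof -
  have v: "v \<in> V" using assms by (auto simp: active_def)
  have P: "ZZ st y > 0" "pinned_ok st y" using assms by (auto simp: valid_def)
  have lt: "z u < q" if "z \<in> agree (free st) y" "u \<in> present st" for z u
    using agree_lt[OF P(2) that] .
  define Pr where "Pr = (\<lambda>z. \<Prod>u\<in>neighbors S v \<inter> present st. A v u c (z u))"
  have Pr: "(1 + \<eta>) / 2 \<le> Pr z" "Pr z \<le> 1" if "z \<in> agree (free st) y" for z
    using prod_A_ge[OF v, of "neighbors S v \<inter> present st" c z] lt[OF that] assms unfolding Pr_def by auto
  have wn: "wt (present st) z \<ge> 0" if "z \<in> agree (free st) y" for z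
    using wt_nonneg[OF present_V] lt[OF that] by auto
  have "(1 + \<eta>) / 2 * ZZ st y = (\<Sum>z\<in>agree (free st) y. wt (present st) z * ((1 + \<eta>) / 2))"
    unfolding ZZ_def Z_def by (simp add: sum_distrib_left mult.commute)
  also have "\<dots> \<le> (\<Sum>z\<in>agree (free st) y. wt (present st) z * Pr z)"
    using Pr wn by (intro sum_mono mult_left_mono) auto
  finally show "acc_mean v st y c \<ge> (1 + \<eta>) / 2"
    unfolding acc_mean_eq[OF assms(1,2)] Pr_def using P(1) by (simp add: pos_le_divide_eq)
  have "(\<Sum>z\<in>agree (free st) y. wt (present st) z * Pr z) \<le> (\<Sum>z\<in>agree (free st) y. wt (present st) z * 1)"
    using Pr wn by (intro sum_mono mult_left_mono) auto
  then show "acc_mean v st y c \<le> 1"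
    unfolding acc_mean_eq[OF assms(1,2)] Pr_def using P(1)
    by (simp add: ZZ_def Z_def)
qed

text \<open>With x = 1 - A and d = deg v \<le> \<Delta>, the soft constraints give 2 d x \<le> 1 -
  \<eta>. So the corrected factor is a probability although p is built from the degree instead of
  \<Delta>.\<close>

lemma factor_bounds:
  assumes "v \<in> V" "u \<in> set (adj v)" "c < q" "pinned_ok st y"
  shows "0 \<le> factor v c st y u" "factor v c st y u \<le> 1"
proof -
  have u: "u \<in> neighbors S v" "u \<in> V" using assms set_adj neighbors_V by auto
  have "0 \<le> factor v c st y u \<and> factor v c st y u \<le> 1"
  proof (cases "st u < 2")
    case False
    then have yu: "y u < q" using assms u unfolding pinned_ok_def by auto
    define d where "d = real (length (adj v))"
    define x where "x = 1 - A v u c (y u)"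
    have d: "d \<le> real \<Delta>" "d \<ge> 0" unfolding d_def using length_adj_le[OF assms(1)] by auto
    have x: "0 \<le> x" "x \<le> (1 - \<eta>) / (2 * real \<Delta>)"
      unfolding x_def using A_bounds[OF u(1) assms(3) yu] by auto
    have "2 * d * x \<le> 2 * real \<Delta> * ((1 - \<eta>) / (2 * real \<Delta>))"
      using d x by (intro mult_mono) auto
    also have "\<dots> = 1 - \<eta>" using deg by simp
    finally have 1: "2 * d * x \<le> 1" "2 * d * x \<ge> 0" using eta d x by auto
    have "x \<le> (1 - \<eta>) / 1"
    proof -
      have "(1 - \<eta>) / (2 * real \<Delta>) \<le> (1 - \<eta>) / 1"
        using eta deg by (intro divide_left_mono) auto
      then show ?thesis using x by linarith
    qed
    then have 2: "x \<le> 1" using eta by auto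
    show ?thesis using 1 2 x unfolding factor_def d_def[symmetric] x_def by auto
  qed (auto simp: factor_def)
  then show "0 \<le> factor v c st y u" "factor v c st y u \<le> 1" by auto
qed

lemma acc_bounds:
  assumes "v \<in> V" "c < q" "pinned_ok st y"
  shows "0 \<le> acc v c st y" "acc v c st y \<le> 1"
  unfolding acc_def using factor_bounds[OF assms(1) _ assms(2,3)]
  by (auto intro!: prod_nonneg prod_le_1)

lemma present_active: assumes "active v st"
  shows "present (st(v := 0)) = insert v (present st)" "free (st(v := 0)) = insert v (free st)"
    "insert v (free st) - {v} = free st" "v \<notin> free st"
  using assms by (auto simp: present_def free_def active_def)

text \<open>Restoring \<open>v\<close> multiplies each weight by a factor; if all weights without
  \<open>v\<close> vanished, all weights with \<open>v\<close> would vanish too.\<close>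

lemma valid_active:
  assumes "valid (st(v := 0)) y" "active v st"
  shows "valid st y"
proof -
  have v: "v \<in> V" "v \<notin> present st" "v \<notin> free st"
    using assms(2) by (auto simp: active_def present_def free_def)
  have ok: "pinned_ok st y" using assms by (auto simp: valid_def pinned_ok_def active_def split: if_splits)
  have "ZZ st y \<noteq> 0"
  proof
    assume "ZZ st y = 0"
    have *: "wt (present st) z \<ge> 0" if "z \<in> agree (free st) y" for z
      using wt_nonneg[OF present_V] agree_lt[OF ok that] by auto
    then have 0: "wt (present st) z = 0" if "z \<in> agree (free st) y" for z
      using \<open>ZZ st y = 0\<close> that sum_nonneg_eq_0_iff[OF finite_agree[OF finite_free]]
      unfolding ZZ_def Z_def by blast
    have "wt (insert v (present st)) z = 0" if "z \<in> agree (insert v (free st)) y" for z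
    proof -
      have "z(v := y v) \<in> agree (free st) y" using that v by (auto simp: agree_def)
      moreover have "wt (present st) (z(v := y v)) = wt (present st) z" using v by (intro wt_cong) auto
      ultimately show ?thesis unfolding wt_insert[OF v(1,2) present_V] using 0 by simp
    qed
    then have "ZZ (st(v := 0)) y = 0"
      unfolding ZZ_def Z_def present_active[OF assms(2)] by simp
    then show False using assms(1) by (simp add: valid_def)
  qed
  then show ?thesis using ok ZZ_nonneg[OF ok] unfolding valid_def by simp
qed

text \<open>The marginal is the law of the first accepted proposal, as the sum is the acceptance
  probability of a proposal.\<close>

lemma marg_active:
  assumes "valid (st(v := 0)) y" "active v st"
  shows "marg (st(v := 0)) y v c * (\<Sum>a<q. vfield S v a * acc_mean v st y a) =
    vfield S v c * acc_mean v st y c"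
proof -
  have val: "valid st y" using valid_active assms by auto
  have P: "ZZ st y > 0" "ZZ (st(v := 0)) y > 0" using val assms by (auto simp: valid_def)
  have "ZZ (st(v := 0)) y = (\<Sum>a<q. Z (free st) (insert v (present st)) (y(v := a)))"
    unfolding ZZ_def present_active[OF assms(2)]
    using Z_split[of "insert v (free st)" v] finite_free[of st] present_active(3)[OF assms(2)] by simp
  also have "\<dots> = (\<Sum>a<q. vfield S v a * acc_mean v st y a) * ZZ st y"
    unfolding field_acc_mean[OF val assms(2), symmetric] by (simp add: sum_distrib_right)
  finally have 1: "ZZ (st(v := 0)) y = (\<Sum>a<q. vfield S v a * acc_mean v st y a) * ZZ st y" .
  have "marg (st(v := 0)) y v c = vfield S v c * acc_mean v st y c * ZZ st y / ZZ (st(v := 0)) y"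
    unfolding marg_def present_active(1,2)[OF assms(2)] present_active(3)[OF assms(2)]
    by (simp add: field_acc_mean[OF val assms(2)])
  then show ?thesis unfolding 1 using P 1 by auto
qed

section \<open>The conditional marginals of the Gibbs distribution in terms of pinned
  systems\<close>

lemma sum_weight_eq_Z:
  assumes "M \<subseteq> V" "\<And>u. u \<in> M \<Longrightarrow> y u < q"
  shows "(\<Sum>\<tau> | \<tau> \<in> configs S V \<and> (\<forall>u\<in>M. \<tau> u = y u). weight S \<tau>) = Z (V - M) V y"
  unfolding Z_def
proof (rule sum.reindex_bij_witness[where i = "\<lambda>z. restrict z V" and
      j = "\<lambda>\<tau> u. if u \<in> V then \<tau> u else y u"])
  fix \<tau> assume \<tau>: "\<tau> \<in> {\<tau>. \<tau> \<in> configs S V \<and> (\<forall>u\<in>M. \<tau> u = y u)}"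
  then show "restrict (\<lambda>u. if u \<in> V then \<tau> u else y u) V = \<tau>"
    by (auto simp: configs_def fun_eq_iff PiE_def extensional_def)
  show "(\<lambda>u. if u \<in> V then \<tau> u else y u) \<in> agree (V - M) y"
    using \<tau> by (auto simp: agree_def configs_def PiE_def)
  have "edges S \<inter> V \<times> V = edges S" using edges_V by auto
  then show "wt V (\<lambda>u. if u \<in> V then \<tau> u else y u) = weight S \<tau>"
    unfolding wt_def weight_def using edges_V
    by (auto intro!: arg_cong2[where f = "(*)"] prod.cong)
next
  fix z assume z: "z \<in> agree (V - M) y"
  then show "(\<lambda>u. if u \<in> V then restrict z V u else y u) = z"
    by (auto simp: agree_def)
  have "z u < q" if "u \<in> V" for u
    using z assms(2)[of u] that by (cases "u \<in> M") (auto simp: agree_def)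
  then show "restrict z V \<in> {\<tau>. \<tau> \<in> configs S V \<and> (\<forall>u\<in>M. \<tau> u = y u)}"
    using z assms(1) by (auto simp: configs_def agree_def)
qed

text \<open>This is the situation before \<open>v\<close> is deleted: \<Lambda> has status 2 and
  \<open>v\<close> is still free. The numerator pins \<open>v\<close> as well, and
  \<open>partition_fun S\<close> cancels.\<close>

lemma cond_marginal_eq_marg:
  assumes \<Lambda>: "\<Lambda> \<subseteq> V" and \<sigma>: "\<sigma> \<in> configs S \<Lambda>" and pos: "gibbs_marginal S \<Lambda> \<sigma> > 0"
    and v: "v \<in> V - \<Lambda>"
    and st: "\<And>u. st u = (if u \<in> \<Lambda> then 2 else 0)" and y: "\<And>u. u \<in> \<Lambda> \<Longrightarrow> y u = \<sigma> u"
  shows "valid st y" "c < q \<Longrightarrow> cond_marginal S \<Lambda> \<sigma> v c = marg st y v c"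
proof -
  have yq: "y u < q" if "u \<in> \<Lambda>" for u using \<sigma> y that by (auto simp: configs_def)
  have fr: "free st = V - \<Lambda>" "present st = V" using st by (auto simp: free_def present_def)
  have ext: "restrict \<tau> \<Lambda> = \<sigma> \<longleftrightarrow> (\<forall>u\<in>\<Lambda>. \<tau> u = y u)" for \<tau>
    using \<sigma> y by (auto simp: configs_def fun_eq_iff PiE_def extensional_def)
  have gm: "gibbs_marginal S \<Lambda> \<sigma> = ZZ st y / partition_fun S"
    unfolding gibbs_marginal_def gibbs_def ZZ_def fr ext sum_divide_distrib[symmetric]
    by (subst sum_weight_eq_Z[OF \<Lambda>]) (use yq in auto)
  have ok: "pinned_ok st y" using st yq by (auto simp: pinned_ok_def)
  show "valid st y"
    using pos ZZ_nonneg[OF ok] ok unfolding gm valid_def by (auto simp: zero_less_divide_iff)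
  assume c: "c < q"
  have "(\<Sum>\<tau> | \<tau> \<in> configs S V \<and> restrict \<tau> \<Lambda> = \<sigma> \<and> \<tau> v = c. gibbs S \<tau>) =
      (\<Sum>\<tau> | \<tau> \<in> configs S V \<and> (\<forall>u\<in>insert v \<Lambda>. \<tau> u = (y(v := c)) u). weight S \<tau>) / partition_fun S"
    unfolding gibbs_def sum_divide_distrib ext using v by (intro sum.cong) auto
  also have "\<dots> = Z (V - insert v \<Lambda>) V (y(v := c)) / partition_fun S"
    using \<Lambda> v yq c by (subst sum_weight_eq_Z) auto
  also have "V - insert v \<Lambda> = free st - {v}" unfolding fr by auto
  finally have num: "(\<Sum>\<tau> | \<tau> \<in> configs S V \<and> restrict \<tau> \<Lambda> = \<sigma> \<and> \<tau> v = c. gibbs S \<tau>) =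
      Z (free st - {v}) V (y(v := c)) / partition_fun S" .
  \<comment> \<open>Division by 0 yields 0, so a vanishing partition function would contradict
    \<open>pos\<close>.\<close>
  have "partition_fun S \<noteq> 0" using pos gm by auto
  then show "cond_marginal S \<Lambda> \<sigma> v c = marg st y v c"
    unfolding cond_marginal_def marg_def gm fr(2) num by simp
qed

end

section \<open>Expected values of programs\<close>

locale machine =
  fixes P :: "com list" and S :: spin_system and adj :: "nat \<Rightarrow> nat list"
    and \<kappa> :: real and f :: "mem \<Rightarrow> real"
  assumes \<kappa>_nonneg: "0 \<le> \<kappa>" and f_nonneg: "0 \<le> f s"
begin

text \<open>\<open>\<kappa>\<close> times the expected time spent within \<open>n\<close> steps, plus the expectation of \<open>f\<close> at the final
  memory on the event of halting within \<open>n\<close> steps.\<close>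

primrec W :: "nat \<Rightarrow> com list \<times> mem \<Rightarrow> real" where
  "W 0 cf = (if fst cf = [] then f (snd cf) else 0)"
| "W (Suc n) cf = (if fst cf = [] then f (snd cf)
     else \<kappa> + measure_pmf.expectation (exec_step P S adj cf) (W n))"

lemma finite_exec_step: "finite (set_pmf (exec_step P S adj cf))"
  by (cases "(P, S, adj, cf)" rule: exec_step.cases) auto

lemma integrable_exec_step: "integrable (measure_pmf (exec_step P S adj cf)) (h :: _ \<Rightarrow> real)"
  by (rule integrable_measure_pmf_finite) (rule finite_exec_step)

lemma W_nonneg: "0 \<le> W n cf"
  by (induction n arbitrary: cf) (auto simp: f_nonneg \<kappa>_nonneg intro!: add_nonneg_nonneg integral_nonneg)

text \<open>A larger step budget only adds nonnegative terms. Hence the command rules keep the same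
  \<open>n\<close> on both sides, and no budget has to be split between consecutive
  commands.\<close>

lemma W_Suc: "W n cf \<le> W (Suc n) cf"
proof (induction n arbitrary: cf)
  case 0
  show ?case
  proof (cases "fst cf = []")
    case False
    then have "W 0 cf = 0" by simp
    then show ?thesis using W_nonneg by metis
  qed simp
next
  case (Suc n)
  show ?case
    by (subst (1 2) W.simps(2)) (auto intro!: integral_mono integrable_exec_step simp del: W.simps(2) intro: Suc)
qed

lemma W_Nil [simp]: "W n ([], s) = f s"
  by (cases n) auto

lemma W_det_step:
  assumes "K \<noteq> []" "exec_step P S adj (K, s) = return_pmf cf"
  shows "W n (K, s) \<le> \<kappa> + W n cf"
proof (cases n)
  case 0
  then show ?thesis using assms W_nonneg[of 0 cf] \<kappa>_nonneg by simp
next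
  case (Suc m)
  then show ?thesis using assms W_Suc[of m cf] by simp
qed

section \<open>Rules for single commands\<close>

lemma W_NAssign: "W n (NAssign a i e # K, s) \<le> \<kappa> + W n (K, nwrite a (neval adj s i) (neval adj s e) s)"
  and W_RAssign: "W n (RAssign a i r # K, s) \<le> \<kappa> + W n (K, rwrite a (neval adj s i) (reval S adj s r) s)"
  and W_Seq: "W n (Seq c d # K, s) \<le> \<kappa> + W n (c # d # K, s)"
  and W_If: "W n (If b c d # K, s) \<le> \<kappa> + W n ((if beval S adj s b then c else d) # K, s)"
  and W_Skip: "W n (Skip # K, s) \<le> \<kappa> + W n (K, s)"
  and W_Call: "p < length P \<Longrightarrow> W n (Call p # K, s) \<le> \<kappa> + W n (P ! p # K, s)"
  by (rule W_det_step; simp)+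

text \<open>Unlike the inequality below, this equation lowers the budget; the rejection loop, whose
  number of rounds has no bound, is handled by induction on it.\<close>

lemma W_While: "W (Suc n) (While b c # K, s) =
    \<kappa> + (if beval S adj s b then W n (c # While b c # K, s) else W n (K, s))"
  by simp

lemma W_While_le: "W n (While b c # K, s) \<le>
    \<kappa> + (if beval S adj s b then W n (c # While b c # K, s) else W n (K, s))"
  using W_det_step[of "While b c # K" s "if beval S adj s b then (c # While b c # K, s) else (K, s)" n]
  by (cases "beval S adj s b") simp_all

text \<open>\<open>Flip\<close> clamps its bias, so the convex combination requires a genuine
  probability; each use has to place its bias in the unit interval.\<close>

lemma W_Flip:
  assumes "0 \<le> reval S adj s p" "reval S adj s p \<le> 1"
  shows "W n (Flip a i p # K, s) \<le> \<kappa> + (reval S adj s p * W n (K, nwrite a (neval adj s i) 1 s) +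
    (1 - reval S adj s p) * W n (K, nwrite a (neval adj s i) 0 s))"
proof (cases n)
  case 0
  then show ?thesis using assms W_nonneg \<kappa>_nonneg
    by (auto intro!: add_nonneg_nonneg mult_nonneg_nonneg W_nonneg f_nonneg)
next
  case (Suc m)
  have "W n (Flip a i p # K, s) = \<kappa> + (reval S adj s p * W m (K, nwrite a (neval adj s i) 1 s) +
    (1 - reval S adj s p) * W m (K, nwrite a (neval adj s i) 0 s))"
    using assms by (simp add: Suc mult.commute)
  also have "\<dots> \<le> \<kappa> + (reval S adj s p * W n (K, nwrite a (neval adj s i) 1 s) +
    (1 - reval S adj s p) * W n (K, nwrite a (neval adj s i) 0 s))"
    unfolding Suc using assms W_Suc[of m]
    by (intro add_mono mult_left_mono) (auto simp del: W.simps)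
  finally show ?thesis .
qed

text \<open>The total correctness triple \<open>{s} c {Q}\<close> with running time \<open>k\<close>, for commands without random
  choices.  The postcondition is a predicate so that the contents of scratch cells can be left open.\<close>

definition det :: "com \<Rightarrow> mem \<Rightarrow> nat \<Rightarrow> (mem \<Rightarrow> bool) \<Rightarrow> bool" where
  "det c s k Q \<longleftrightarrow> (\<forall>n K G. (\<forall>s'. Q s' \<longrightarrow> W n (K, s') \<le> G) \<longrightarrow> W n (c # K, s) \<le> \<kappa> * real k + G)"

lemma detD: "det c s k Q \<Longrightarrow> (\<And>s'. Q s' \<Longrightarrow> W n (K, s') \<le> G) \<Longrightarrow> W n (c # K, s) \<le> \<kappa> * real k + G"
  unfolding det_def by blast

lemma det_mono:
  assumes "det c s k Q" "k \<le> k'" "\<And>s'. Q s' \<Longrightarrow> Q' s'"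
  shows "det c s k' Q'"
  unfolding det_def
proof (intro allI impI)
  fix n K G assume "\<forall>s'. Q' s' \<longrightarrow> W n (K, s') \<le> G"
  then have "W n (c # K, s) \<le> \<kappa> * real k + G" using assms by (intro detD[OF assms(1)]) auto
  also have "\<dots> \<le> \<kappa> * real k' + G" using assms(2) \<kappa>_nonneg by (simp add: mult_left_mono)
  finally show "W n (c # K, s) \<le> \<kappa> * real k' + G" .
qed

lemma det_NAssign: "Q (nwrite a (neval adj s i) (neval adj s e) s) \<Longrightarrow> det (NAssign a i e) s 1 Q"
  unfolding det_def using W_NAssign by (fastforce intro: order_trans)

lemma det_RAssign: "Q (rwrite a (neval adj s i) (reval S adj s r) s) \<Longrightarrow> det (RAssign a i r) s 1 Q"
  unfolding det_def using W_RAssign by (fastforce intro: order_trans)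

lemma det_Skip: "Q s \<Longrightarrow> det Skip s 1 Q"
  unfolding det_def using W_Skip by (fastforce intro: order_trans)

lemma det_Seq:
  assumes "det c s k Q" "\<And>s'. Q s' \<Longrightarrow> det d s' l R"
  shows "det (Seq c d) s (1 + k + l) R"
  unfolding det_def
proof (intro allI impI)
  fix n K G assume "\<forall>s'. R s' \<longrightarrow> W n (K, s') \<le> G"
  then have "W n (d # K, s') \<le> \<kappa> * real l + G" if "Q s'" for s'
    using detD[OF assms(2)[OF that]] by blast
  then have "W n (c # d # K, s) \<le> \<kappa> * real k + (\<kappa> * real l + G)" using detD[OF assms(1)] by blast
  then show "W n (Seq c d # K, s) \<le> \<kappa> * real (1 + k + l) + G"
    using W_Seq[of n c d K s] by (simp add: algebra_simps)
qed

lemma det_If: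
  assumes "beval S adj s b \<Longrightarrow> det c s k Q" "\<not> beval S adj s b \<Longrightarrow> det d s k Q"
  shows "det (If b c d) s (1 + k) Q"
  unfolding det_def
proof (intro allI impI)
  fix n K G assume *: "\<forall>s'. Q s' \<longrightarrow> W n (K, s') \<le> G"
  have "W n ((if beval S adj s b then c else d) # K, s) \<le> \<kappa> * real k + G"
    using detD[OF assms(1)] detD[OF assms(2)] * by auto
  then show "W n (If b c d # K, s) \<le> \<kappa> * real (1 + k) + G"
    using W_If[of n b c d K s] by (simp add: algebra_simps)
qed

text \<open>\<open>I i\<close> is the invariant after \<open>i\<close> rounds. Each round pays
  \<open>k\<close> and one test of the guard; the last 1 is the test that fails.\<close>

lemma det_for:
  assumes step: "\<And>i s. i < m \<Longrightarrow> I i s \<Longrightarrow> beval S adj s b \<and> det c s k (I (Suc i))"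
    and stop: "\<And>s. I m s \<Longrightarrow> \<not> beval S adj s b"
    and "I 0 s"
  shows "det (While b c) s (m * (k + 1) + 1) (I m)"
proof -
  have "det (While b c) s ((m - i) * (k + 1) + 1) (I m)" if "i \<le> m" "I i s" for i s
    using that
  proof (induction i arbitrary: s rule: inc_induct)
    case base
    then show ?case
      using stop[OF base(1)] W_While_le[of _ b c _ s] unfolding det_def by (fastforce intro: order_trans)
  next
    case (step i)
    have b: "beval S adj s b" and d: "det c s k (I (Suc i))"
      using assms(1)[OF step(2) step(4)] by auto
    show ?case unfolding det_def
    proof (intro allI impI)
      fix n K G assume *: "\<forall>s'. I m s' \<longrightarrow> W n (K, s') \<le> G"
      have "W n (While b c # K, s') \<le> \<kappa> * real ((m - Suc i) * (k + 1) + 1) + G" if "I (Suc i) s'" for s'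
        using detD[OF step.IH[OF that]] * by blast
      then have "W n (c # While b c # K, s) \<le> \<kappa> * real k + (\<kappa> * real ((m - Suc i) * (k + 1) + 1) + G)"
        using detD[OF d] by blast
      then have "W n (While b c # K, s) \<le> \<kappa> * (1 + real k + real ((m - Suc i) * (k + 1) + 1)) + G"
        using W_While_le[of n b c K s] b by (simp add: algebra_simps)
      also have "1 + real k + real ((m - Suc i) * (k + 1) + 1) = real ((m - i) * (k + 1) + 1)"
      proof -
        have "m - i = Suc (m - Suc i)" using step(2) by simp
        then show ?thesis by simp
      qed
      finally show "W n (While b c # K, s) \<le> \<kappa> * real ((m - i) * (k + 1) + 1) + G" .
    qed
  qed
  from this[of 0 s] assms(3) show ?thesis by simp
qed

section \<open>From the backward recursion to the law of truncated runs\<close>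

definition run_step :: "(com list \<times> mem) \<times> nat \<Rightarrow> ((com list \<times> mem) \<times> nat) pmf" where
  "run_step = (\<lambda>(cf, t). if fst cf = [] then return_pmf (cf, t)
                else map_pmf (\<lambda>cf'. (cf', Suc t)) (exec_step P S adj cf))"

definition reward :: "(com list \<times> mem) \<times> nat \<Rightarrow> real" where
  "reward = (\<lambda>(cf, t). \<kappa> * real t + (if fst cf = [] then f (snd cf) else 0))"

lemma run_step_W:
  "(\<integral>\<^sup>+ x. ennreal (\<kappa> * real (snd x) + W n (fst x)) \<partial>measure_pmf (run_step (cf, t))) =
   ennreal (\<kappa> * real t + W (Suc n) cf)"
proof (cases "fst cf = []")
  case True
  then show ?thesis by (cases cf) (simp add: run_step_def)
next
  case False
  have "(\<integral>\<^sup>+ x. ennreal (\<kappa> * real (snd x) + W n (fst x)) \<partial>measure_pmf (run_step (cf, t))) =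
      (\<integral>\<^sup>+ cf'. ennreal (\<kappa> * real (Suc t) + W n cf') \<partial>measure_pmf (exec_step P S adj cf))"
    using False by (simp add: run_step_def)
  also have "\<dots> = ennreal (measure_pmf.expectation (exec_step P S adj cf)
      (\<lambda>cf'. \<kappa> * real (Suc t) + W n cf'))"
    by (rule nn_integral_eq_integral[OF integrable_exec_step]) (simp add: \<kappa>_nonneg W_nonneg)
  also have "measure_pmf.expectation (exec_step P S adj cf) (\<lambda>cf'. \<kappa> * real (Suc t) + W n cf') =
      \<kappa> * real t + W (Suc n) cf"
    using False by (subst Bochner_Integration.integral_add[OF integrable_exec_step integrable_exec_step])
      (simp add: algebra_simps)
  finally show ?thesis .
qed

text \<open>\<open>run\<close> appends the last step while \<open>W\<close> peels off the first.
  Valuing \<open>m\<close> further steps by \<open>W\<close> after a run of \<open>n\<close> steps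
  lets the induction move one step at a time from the run into \<open>W\<close>.\<close>

lemma nn_integral_run_W:
  "(\<integral>\<^sup>+ x. ennreal (\<kappa> * real (snd x) + W m (fst x)) \<partial>measure_pmf (run P S adj s n)) =
   ennreal (W (n + m) ([Call 0], s))"
proof (induction n arbitrary: m)
  case (Suc n)
  have "run P S adj s (Suc n) = bind_pmf (run P S adj s n) run_step"
    by (simp add: run_step_def)
  then have "(\<integral>\<^sup>+ x. ennreal (\<kappa> * real (snd x) + W m (fst x)) \<partial>measure_pmf (run P S adj s (Suc n))) =
    (\<integral>\<^sup>+ y. \<integral>\<^sup>+ x. ennreal (\<kappa> * real (snd x) + W m (fst x)) \<partial>measure_pmf (run_step y)
       \<partial>measure_pmf (run P S adj s n))"
    by simp
  also have "\<dots> = (\<integral>\<^sup>+ y. ennreal (\<kappa> * real (snd y) + W (Suc m) (fst y)) \<partial>measure_pmf (run P S adj s n))"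
  proof (rule nn_integral_cong)
    fix y
    show "(\<integral>\<^sup>+ x. ennreal (\<kappa> * real (snd x) + W m (fst x)) \<partial>measure_pmf (run_step y)) =
        ennreal (\<kappa> * real (snd y) + W (Suc m) (fst y))"
      by (cases y) (simp only: run_step_W fst_conv snd_conv)
  qed
  also have "\<dots> = ennreal (W (Suc n + m) ([Call 0], s))" using Suc[of "Suc m"] by simp
  finally show ?case .
qed simp

lemma nn_integral_run:
  "(\<integral>\<^sup>+ x. ennreal (reward x) \<partial>measure_pmf (run P S adj s n)) = ennreal (W n ([Call 0], s))"
  using nn_integral_run_W[where m = 0 and s = s and n = n] by (simp add: reward_def case_prod_beta)

end

lemma run_not_halted:
  "x \<in> set_pmf (run P S adj s n) \<Longrightarrow> fst (fst x) \<noteq> [] \<Longrightarrow> snd x = n"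
proof (induction n arbitrary: x)
  case (Suc n)
  then obtain y where y: "y \<in> set_pmf (run P S adj s n)"
    and x: "x \<in> set_pmf (if fst (fst y) = [] then return_pmf (fst y, snd y)
                else map_pmf (\<lambda>cf'. (cf', Suc (snd y))) (exec_step P S adj (fst y)))"
    by (auto simp: case_prod_beta)
  show ?case
    using x Suc.IH[OF y] Suc.prems(2) by (auto split: if_splits)
qed simp

text \<open>Upper bounds suffice for the lower bound on the probability of success: a run that has not
  halted after \<open>n\<close> steps has running time at least \<open>n\<close>.\<close>

lemma halting_bounds:
  assumes T: "\<And>n. machine.W P S adj 1 (\<lambda>_. 0) n ([Call 0], s) \<le> T"
    and D: "\<And>n. machine.W P S adj 0 (\<lambda>s. of_bool (\<not> Q s)) n ([Call 0], s) \<le> \<delta>"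
  shows "prob_halts_with P S adj s Q \<ge> 1 - \<delta>" "expected_time P S adj s \<le> ennreal T"
proof -
  interpret M1: machine P S adj 1 "\<lambda>_. 0" by standard auto
  interpret M0: machine P S adj 0 "\<lambda>s. of_bool (\<not> Q s)" by standard auto
  have time: "(\<integral>\<^sup>+ x. of_nat (snd x) \<partial>measure_pmf (run P S adj s n)) \<le> ennreal T" for n
  proof -
    have "(\<integral>\<^sup>+ x. of_nat (snd x) \<partial>measure_pmf (run P S adj s n)) =
        (\<integral>\<^sup>+ x. ennreal (M1.reward x) \<partial>measure_pmf (run P S adj s n))"
      by (rule nn_integral_cong) (simp add: M1.reward_def case_prod_beta ennreal_of_nat_eq_real_of_nat)
    also have "\<dots> \<le> ennreal T"
      unfolding M1.nn_integral_run using T by (rule ennreal_leI)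
    finally show ?thesis .
  qed
  then show "expected_time P S adj s \<le> ennreal T"
    unfolding expected_time_def by (intro SUP_least)
  have T0: "T \<ge> 0" using T[of 0] by simp
  define H where "H = {x :: (com list \<times> mem) \<times> nat. fst (fst x) = [] \<and> Q (snd (fst x))}"
  define N where "N = {x :: (com list \<times> mem) \<times> nat. fst (fst x) \<noteq> []}"
  define B where "B = {x :: (com list \<times> mem) \<times> nat. fst (fst x) = [] \<and> \<not> Q (snd (fst x))}"
  have H: "{((K, s'), t). K = [] \<and> Q s'} = H" unfolding H_def by auto
  have lower: "measure_pmf.prob (run P S adj s n) H \<ge> 1 - \<delta> - T / real n" if "n > 0" for n
  proof -
    let ?M = "measure_pmf (run P S adj s n)"
    have B: "measure ?M B \<le> \<delta>"
    proof -
      have "(\<lambda>x. ennreal (M0.reward x)) = indicator B"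
        by (auto simp: fun_eq_iff M0.reward_def B_def indicator_def)
      then have "emeasure ?M B = (\<integral>\<^sup>+ x. ennreal (M0.reward x) \<partial>?M)" by simp
      also have "\<dots> \<le> ennreal \<delta>"
        unfolding M0.nn_integral_run using D by (rule ennreal_leI)
      finally have "ennreal (measure ?M B) \<le> ennreal \<delta>"
        by (simp add: measure_pmf.emeasure_eq_measure)
      moreover have "\<delta> \<ge> 0" using D[of 0] M0.W_nonneg[of 0 "([Call 0], s)"] by linarith
      ultimately show ?thesis by (simp add: ennreal_le_iff)
    qed
    \<comment> \<open>Markov's inequality: on \<open>N\<close> the step counter equals
      \<open>n\<close>.\<close>
    have N: "measure ?M N \<le> T / real n"
    proof -
      have "ennreal (real n) * emeasure ?M N = (\<integral>\<^sup>+ x. ennreal (real n) * indicator N x \<partial>?M)"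
        by (subst nn_integral_cmult_indicator) auto
      also have "\<dots> \<le> (\<integral>\<^sup>+ x. of_nat (snd x) \<partial>?M)"
        using run_not_halted[of _ P S adj s n]
        by (intro nn_integral_mono_AE)
          (auto simp: AE_measure_pmf_iff N_def indicator_def ennreal_of_nat_eq_real_of_nat)
      also have "\<dots> \<le> ennreal T" by (rule time)
      finally have "ennreal (real n * measure ?M N) \<le> ennreal T"
        by (simp add: measure_pmf.emeasure_eq_measure ennreal_mult)
      then have "real n * measure ?M N \<le> T" using T0 by (simp add: ennreal_le_iff)
      then show ?thesis using that by (simp add: field_simps)
    qed
    have "1 = measure ?M (H \<union> (N \<union> B))"
    proof -
      have "H \<union> (N \<union> B) = UNIV" by (auto simp: H_def N_def B_def)
      then show ?thesis using measure_pmf.prob_space[of "run P S adj s n"] by simp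
    qed
    also have "\<dots> \<le> measure ?M H + (measure ?M N + measure ?M B)"
      by (intro order_trans[OF measure_subadditive] add_left_mono)
        (auto simp: measure_pmf.emeasure_eq_measure)
    finally show ?thesis using B N by linarith
  qed
  have bdd: "bdd_above (range (\<lambda>n. measure_pmf.prob (run P S adj s n) H))"
    by (intro bdd_aboveI[of _ 1]) auto
  \<comment> \<open>The supremum dominates the lower bound for every \<open>n\<close>, and the
    Markov term vanishes in the limit.\<close>
  have "(\<lambda>n. 1 - \<delta> - T / real n) \<longlonglongrightarrow> 1 - \<delta> - 0"
    by (intro tendsto_intros real_tendsto_divide_at_top filterlim_real_sequentially)
  then show "prob_halts_with P S adj s Q \<ge> 1 - \<delta>"
    unfolding prob_halts_with_def H
    by (intro tendsto_upperbound[of "\<lambda>n. 1 - \<delta> - T / real n" "1 - \<delta>" sequentially])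
      (auto intro!: eventually_sequentiallyI[of 1] order_trans[OF lower] cSUP_upper bdd)
qed

section \<open>The program\<close>

text \<open>
  For a vertex \<open>u\<close>, entry \<open>u\<close> of array 3 is its status, of array 4 its spin if it is pinned, of
  array 5 the vertex to return to once the spin of \<open>u\<close> is found, and of array 6 the next neighbour of
  \<open>u\<close> to visit.  As a vertex is on the recursion stack at most once, these arrays also serve as the stack.
  The real array 1 holds the sums of the acceptance probabilities, and the first cells of the real
  arrays 2 and 3 the current acceptance probability and the probability mass of the proposals not yet rejected.
\<close>

abbreviation cur :: nexp where "cur \<equiv> NArr 7 (NConst 0)"
abbreviation spin :: nexp where "spin \<equiv> NArr 8 (NConst 0)"
abbreviation bit :: nexp where "bit \<equiv> NArr 9 (NConst 0)"
abbreviation pos :: nexp where "pos \<equiv> NArr 10 (NConst 0)"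
abbreviation count :: nexp where "count \<equiv> NArr 11 (NConst 0)"

text \<open>With biased bits only, spins are tried in increasing order, each with its probability
  given that the smaller ones were refused. There is no test against \<open>q\<close>: at the last
  spin of positive field the remaining mass equals the field, so the bit is surely 1.\<close>

definition draw_loop :: com where
  "draw_loop = While (NEq bit (NConst 0))
     (Seq (RAssign 3 (NConst 0) (RSub (RArr 3 (NConst 0)) (Field cur spin)))
     (Seq (NAssign 8 (NConst 0) (NAdd spin (NConst 1)))
       (Flip 9 (NConst 0) (RDiv (Field cur spin) (RArr 3 (NConst 0))))))"

definition draw :: com where
  "draw = Seq (NAssign 8 (NConst 0) (NConst 0))
     (Seq (RAssign 3 (NConst 0) (RofN (NConst 1)))
     (Seq (Flip 9 (NConst 0) (RDiv (Field cur spin) (RArr 3 (NConst 0)))) draw_loop))"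

definition mult_factor :: com where
  "mult_factor =
     (let u = Neighbor cur pos;
          a = Interaction cur u spin (NArr 4 u)
      in If (NLess (NArr 3 u) (NConst 2)) Skip
           (If (NEq (NArr 3 u) (NAdd cur (NConst 3)))
              (RAssign 2 (NConst 0) (RMul (RArr 2 (NConst 0))
                (RSub (RofN (NConst 1)) (RMul (RMul (RofN (NConst 2)) (RofN (Degree cur)))
                  (RSub (RofN (NConst 1)) a)))))
              (RAssign 2 (NConst 0) (RMul (RArr 2 (NConst 0)) a))))"

definition mult_factors :: com where
  "mult_factors =
     Seq (RAssign 2 (NConst 0) (RofN (NConst 1)))
     (Seq (NAssign 10 (NConst 0) (NConst 0))
     (While (NLess pos (Degree cur))
       (Seq mult_factor (NAssign 10 (NConst 0) (NAdd pos (NConst 1))))))"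

text \<open>The owner encoded in a status lets a vertex release its own pins and leave those of the
  vertices waiting on the stack, at a cost bounded by its degree.\<close>

definition unpin :: com where
  "unpin =
     Seq (NAssign 10 (NConst 0) (NConst 0))
     (While (NLess pos (Degree cur))
       (Seq (If (NEq (NArr 3 (Neighbor cur pos)) (NAdd cur (NConst 3)))
              (NAssign 3 (Neighbor cur pos) (NConst 0)) Skip)
         (NAssign 10 (NConst 0) (NAdd pos (NConst 1)))))"

text \<open>During the call the neighbour has status 1 like all vertices waiting on the stack, so
  its marginal is taken in the graph without them. On return \<open>cur\<close> is still the
  neighbour, whose entry in array 5 leads back.\<close>

definition reveal_neighbor :: com where
  "reveal_neighbor =
     (let u = Neighbor cur (NArr 6 cur) in
      Seq (NAssign 5 u cur)
      (Seq (NAssign 7 (NConst 0) u)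
      (Seq (NAssign 3 cur (NConst 1))
      (Seq (Call 1)
      (Seq (NAssign 4 cur spin)
      (Seq (NAssign 3 cur (NAdd (NArr 5 cur) (NConst 3)))
        (NAssign 7 (NConst 0) (NArr 5 cur))))))))"

definition reveal_loop :: com where
  "reveal_loop = While (NLess (NArr 6 cur) (Degree cur))
     (Seq (If (NEq (NArr 3 (Neighbor cur (NArr 6 cur))) (NConst 0))
        (Seq (Flip 9 (NConst 0) (RDiv (RofN (NConst 1)) (RMul (RofN (NConst 2)) (RofN (Degree cur)))))
          (If (NEq bit (NConst 1)) reveal_neighbor Skip))
        Skip)
      (NAssign 6 cur (NAdd (NArr 6 cur) (NConst 1))))"

definition reveal :: com where
  "reveal = Seq (NAssign 6 cur (NConst 0)) reveal_loop"

text \<open>Revealing precedes the proposal. As the revealed set does not depend on the proposed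
  spin, the same \<open>reveal\<close> serves the estimator, which evaluates all spins on one
  revealed set.\<close>

definition resolve_loop :: com where
  "resolve_loop = While (NEq bit (NConst 0))
     (Seq reveal (Seq draw (Seq mult_factors
       (Seq (Flip 9 (NConst 0) (RArr 2 (NConst 0))) unpin))))"

definition resolve :: com where
  "resolve = Seq (NAssign 9 (NConst 0) (NConst 0)) resolve_loop"

definition read_pinning :: com where
  "read_pinning =
     Seq (NAssign 11 (NConst 0) (NConst 0))
     (While (NLess count (NArr 0 (NConst 2)))
       (Seq (NAssign 3 (NArr 1 count) (NConst 2))
       (Seq (NAssign 4 (NArr 1 count) (NArr 2 count))
         (NAssign 11 (NConst 0) (NAdd count (NConst 1))))))"

definition add_factors :: com where
  "add_factors =
     Seq (NAssign 8 (NConst 0) (NConst 0))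
     (While (NLess spin (NArr 0 (NConst 0)))
       (Seq mult_factors
       (Seq (RAssign 1 spin (RAdd (RArr 1 spin) (RArr 2 (NConst 0))))
         (NAssign 8 (NConst 0) (NAdd spin (NConst 1))))))"

text \<open>Reals cannot be rounded to naturals, so the number of repetitions is implicit: the loop
  stops at the first \<open>count\<close> with count * \<epsilon>^2 * \<delta> at least 36 q. The 36
  is 9 * 4, from relative accuracy \<epsilon> / 3 and means at least 1 / 2, both squared in
  Chebyshev's inequality.\<close>

definition sample_loop :: com where
  "sample_loop =
     While (RLess (RMul (RofN count) (RMul (RMul (RArr 0 (NConst 0)) (RArr 0 (NConst 0)))
         (RArr 0 (NConst 1)))) (RMul (RofN (NConst 36)) (RofN (NArr 0 (NConst 0)))))
       (Seq reveal (Seq add_factors (Seq unpin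
         (NAssign 11 (NConst 0) (NAdd count (NConst 1))))))"

text \<open>The sums are not divided by the number of repetitions, which cancels in the
  quotient.\<close>

definition normalize_sums :: com where
  "normalize_sums =
     Seq (RAssign 4 (NConst 0) (RofN (NConst 0)))
     (Seq (NAssign 8 (NConst 0) (NConst 0))
     (Seq (While (NLess spin (NArr 0 (NConst 0)))
       (Seq (RAssign 4 (NConst 0) (RAdd (RArr 4 (NConst 0)) (RMul (Field cur spin) (RArr 1 spin))))
         (NAssign 8 (NConst 0) (NAdd spin (NConst 1)))))
     (Seq (NAssign 8 (NConst 0) (NConst 0))
     (While (NLess spin (NArr 0 (NConst 0)))
       (Seq (RAssign 1 spin (RDiv (RMul (Field cur spin) (RArr 1 spin)) (RArr 4 (NConst 0))))
         (NAssign 8 (NConst 0) (NAdd spin (NConst 1))))))))"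

definition main :: com where
  "main = Seq read_pinning
     (Seq (NAssign 7 (NConst 0) (NArr 0 (NConst 1)))
     (Seq (NAssign 3 cur (NConst 1))
     (Seq (NAssign 11 (NConst 0) (NConst 0))
     (Seq sample_loop normalize_sums))))"

lemma nmem_nwrite [simp]: "nmem (nwrite a i x s) = (nmem s)(a := (nmem s a)(i := x))"
  and rmem_nwrite [simp]: "rmem (nwrite a i x s) = rmem s"
  and nmem_rwrite [simp]: "nmem (rwrite a i r s) = nmem s"
  and rmem_rwrite [simp]: "rmem (rwrite a i r s) = (rmem s)(a := (rmem s a)(i := r))"
  by (simp_all add: nwrite_def rwrite_def)

section \<open>The sampler\<close>

locale sampler = soft_spin_system S adj \<eta> + machine "[main, resolve]" S adj \<kappa> f
  for S adj \<eta> \<kappa> f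
begin

section \<open>Subroutines without random choices\<close>

lemma det_le: "det c s k Q \<Longrightarrow> k \<le> k' \<Longrightarrow> det c s k' Q"
  by (rule det_mono)

lemmas det_NAssign_le = det_le[OF det_NAssign] and det_RAssign_le = det_le[OF det_RAssign]
  and det_Skip_le = det_le[OF det_Skip]

lemma det_Seq_NAssign:
  "det d (nwrite a (neval adj s i) (neval adj s e) s) l R \<Longrightarrow> det (Seq (NAssign a i e) d) s (2 + l) R"
  using det_Seq[OF det_NAssign[of "\<lambda>s'. s' = nwrite a (neval adj s i) (neval adj s e) s"]] by simp

lemma det_Seq_RAssign:
  "det d (rwrite a (neval adj s i) (reval S adj s e) s) l R \<Longrightarrow> det (Seq (RAssign a i e) d) s (2 + l) R"
  using det_Seq[OF det_RAssign[of "\<lambda>s'. s' = rwrite a (neval adj s i) (reval S adj s e) s"]] by simp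

lemma det_mult_factors:
  assumes "nmem s 7 0 = v" "v \<in> V"
  shows "det mult_factors s (7 * length (adj v) + 5)
    (\<lambda>s'. rmem s' 2 0 = acc v (nmem s 8 0) (nmem s 3) (nmem s 4) \<and>
       (\<forall>a. a \<noteq> 10 \<longrightarrow> nmem s' a = nmem s a) \<and> (\<forall>a. a \<noteq> 2 \<longrightarrow> rmem s' a = rmem s a))"
proof -
  define d where "d = length (adj v)"
  define g where "g = (\<lambda>k. factor v (nmem s 8 0) (nmem s 3) (nmem s 4) (adj v ! k))"
  define I :: "nat \<Rightarrow> mem \<Rightarrow> bool" where "I = (\<lambda>i s'. nmem s' 10 0 = i \<and> (\<forall>a. a \<noteq> 10 \<longrightarrow> nmem s' a = nmem s a) \<and>
     (\<forall>a. a \<noteq> 2 \<longrightarrow> rmem s' a = rmem s a) \<and> rmem s' 2 0 = (\<Prod>k<i. g k))"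
  have I: "I i s' \<Longrightarrow> nmem s' 10 0 = i" "I i s' \<Longrightarrow> a \<noteq> 10 \<Longrightarrow> nmem s' a = nmem s a"
    "I i s' \<Longrightarrow> a \<noteq> 2 \<Longrightarrow> rmem s' a = rmem s a" "I i s' \<Longrightarrow> rmem s' 2 0 = (\<Prod>k<i. g k)" for i s' a
    by (auto simp: I_def)
  have acc: "acc v (nmem s 8 0) (nmem s 3) (nmem s 4) = (\<Prod>k<d. g k)"
    unfolding acc_def g_def d_def
    by (simp add: prod.distinct_set_conv_list[OF distinct_adj[OF assms(2)]]
        prod.list_conv_set_nth atLeast0LessThan)
  show ?thesis
    unfolding mult_factors_def acc
  proof (rule det_le, rule det_Seq_RAssign, rule det_Seq_NAssign,
      rule det_mono[OF det_for[where m = d and I = I and k = 6]])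
    fix i s' assume i: "i < d" "I i s'"
    note s' = I[OF i(2)]
    have J: "det mult_factor s' (1 + (1 + 1)) (\<lambda>t. rmem t 2 0 = (\<Prod>k<Suc i. g k) \<and> nmem t 10 0 = i \<and>
         (\<forall>a. a \<noteq> 10 \<longrightarrow> nmem t a = nmem s a) \<and> (\<forall>a. a \<noteq> 2 \<longrightarrow> rmem t a = rmem s a))"
      unfolding mult_factor_def Let_def
      by (intro det_If det_Skip_le det_RAssign_le) (use i(1) in \<open>auto simp: s' assms g_def factor_def d_def\<close>)
    show "beval S adj s' (NLess pos (Degree cur)) \<and>
       det (Seq mult_factor (NAssign 10 (NConst 0) (NAdd pos (NConst 1)))) s' 6 (I (Suc i))"
      by (rule conjI, use i(1) in \<open>simp add: s' assms d_def\<close>, rule det_le[OF det_Seq[OF J det_NAssign]])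
        (auto simp: I_def)
  qed (auto simp: I assms d_def, auto simp: I_def assms)
qed

lemma det_unpin:
  assumes "nmem s 7 0 = v" "v \<in> V"
  shows "det unpin s (6 * length (adj v) + 3)
    (\<lambda>s'. nmem s' 3 = (\<lambda>u. if u \<in> set (adj v) \<and> nmem s 3 u = v + 3 then 0 else nmem s 3 u) \<and>
       (\<forall>a. a \<noteq> 10 \<longrightarrow> a \<noteq> 3 \<longrightarrow> nmem s' a = nmem s a) \<and> rmem s' = rmem s)"
proof -
  define d where "d = length (adj v)"
  define I :: "nat \<Rightarrow> mem \<Rightarrow> bool" where "I = (\<lambda>i s'. nmem s' 10 0 = i \<and>
     nmem s' 3 = (\<lambda>u. if u \<in> set (take i (adj v)) \<and> nmem s 3 u = v + 3 then 0 else nmem s 3 u) \<and>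
     (\<forall>a. a \<noteq> 10 \<longrightarrow> a \<noteq> 3 \<longrightarrow> nmem s' a = nmem s a) \<and> rmem s' = rmem s)"
  have I: "I i s' \<Longrightarrow> nmem s' 10 0 = i" "I i s' \<Longrightarrow> a \<noteq> 10 \<Longrightarrow> a \<noteq> 3 \<Longrightarrow> nmem s' a = nmem s a"
    "I i s' \<Longrightarrow> nmem s' 3 = (\<lambda>u. if u \<in> set (take i (adj v)) \<and> nmem s 3 u = v + 3 then 0 else nmem s 3 u)"
    "I i s' \<Longrightarrow> rmem s' = rmem s" for i s' a
    by (auto simp: I_def)
  show ?thesis
    unfolding unpin_def
  proof (rule det_le, rule det_Seq_NAssign, rule det_mono[OF det_for[where m = d and I = I and k = 5]])
    fix i s' assume i: "i < d" "I i s'"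
    note s' = I[OF i(2)]
    have tk: "set (take (Suc i) (adj v)) = insert (adj v ! i) (set (take i (adj v)))"
      using i by (simp add: take_Suc_conv_app_nth d_def)
    have J: "det (If (NEq (NArr 3 (Neighbor cur pos)) (NAdd cur (NConst 3)))
              (NAssign 3 (Neighbor cur pos) (NConst 0)) Skip) s' (1 + 1)
        (\<lambda>t. nmem t 10 0 = i \<and> nmem t 3 = (\<lambda>u. if u \<in> set (take (Suc i) (adj v)) \<and> nmem s 3 u = v + 3 then 0 else nmem s 3 u) \<and>
     (\<forall>a. a \<noteq> 10 \<longrightarrow> a \<noteq> 3 \<longrightarrow> nmem t a = nmem s a) \<and> rmem t = rmem s)"
      by (intro det_If det_Skip_le det_NAssign_le)
        (use i(1) in \<open>auto simp: s' assms d_def tk split: if_splits\<close>)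
    show "beval S adj s' (NLess pos (Degree cur)) \<and>
       det (Seq (If (NEq (NArr 3 (Neighbor cur pos)) (NAdd cur (NConst 3)))
              (NAssign 3 (Neighbor cur pos) (NConst 0)) Skip)
         (NAssign 10 (NConst 0) (NAdd pos (NConst 1)))) s' 5 (I (Suc i))"
      by (rule conjI, use i(1) in \<open>simp add: s' assms d_def\<close>, rule det_le[OF det_Seq[OF J det_NAssign]])
        (auto simp: I_def)
  qed (auto simp: I assms d_def, auto simp: I_def assms)
qed

text \<open>The real cell holds the mass of the spins not yet refused. After a refusal with
  remaining mass R, the identity 1 - p = R / mass turns probabilities relative to R into
  probabilities relative to the mass. \<open>g\<close> is assumed only for spins of positive field,
  hence the case p = 0.\<close>

lemma W_draw_loop:
  assumes v: "nmem s 7 0 = v" "v \<in> V" and c: "nmem s 8 0 = c" "c < q"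
    and r: "rmem s 3 0 = (\<Sum>j=c..<q. vfield S v j)" "rmem s 3 0 > 0"
    and g: "\<And>a s'. a < q \<Longrightarrow> vfield S v a > 0 \<Longrightarrow> nmem s' 8 0 = a \<Longrightarrow>
      (\<And>x. x \<noteq> 8 \<Longrightarrow> x \<noteq> 9 \<Longrightarrow> nmem s' x = nmem s x) \<Longrightarrow> (\<And>x. x \<noteq> 3 \<Longrightarrow> rmem s' x = rmem s x) \<Longrightarrow>
      W n (K, s') \<le> g a"
  shows "W n (Flip 9 (NConst 0) (RDiv (Field cur spin) (RArr 3 (NConst 0))) # draw_loop # K, s) \<le>
    \<kappa> * real (7 * (q - c)) + (\<Sum>j=c..<q. vfield S v j / rmem s 3 0 * g j)"
  using c r g v(1)
proof (induction "q - c" arbitrary: c s rule: less_induct)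
  case less
  define p where "p = vfield S v c / rmem s 3 0"
  define R where "R = (\<Sum>j=Suc c..<q. vfield S v j)"
  have rR: "rmem s 3 0 = vfield S v c + R"
    unfolding less.prems(3) R_def using less.prems(2) by (rule sum.atLeast_Suc_lessThan)
  have nn: "vfield S v j \<ge> 0" if "j < q" for j using vfield_nonneg[OF v(2) that] .
  have R0: "R \<ge> 0" unfolding R_def using nn by (intro sum_nonneg) auto
  have p: "0 \<le> p" "p \<le> 1"
    unfolding p_def using nn[OF less.prems(2)] R0 less.prems(4) rR by (auto simp: pos_divide_le_eq)
  let ?s1 = "nwrite 9 0 1 s" and ?s0 = "nwrite 9 0 0 s"
  let ?F = "Flip 9 (NConst 0) (RDiv (Field cur spin) (RArr 3 (NConst 0)))"
  have one: "p * W n (draw_loop # K, ?s1) \<le> p * (\<kappa> + g c)"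
  proof (cases "p = 0")
    case False
    then have "vfield S v c > 0" using nn[OF less.prems(2)] by (auto simp: p_def less_le)
    then have "W n (K, ?s1) \<le> g c" using less.prems by (intro less.prems(5)) auto
    moreover have "W n (draw_loop # K, ?s1) \<le> \<kappa> + W n (K, ?s1)"
      unfolding draw_loop_def by (rule order_trans[OF W_While_le]) simp
    ultimately show ?thesis using p by (intro mult_left_mono) auto
  qed simp
  have zero: "(1 - p) * W n (draw_loop # K, ?s0) \<le>
      (1 - p) * (\<kappa> * real (5 + 7 * (q - Suc c))) + (\<Sum>j=Suc c..<q. vfield S v j / rmem s 3 0 * g j)"
  \<comment> \<open>For p = 1 no mass remains after a refusal; that branch would divide by 0 but has
    probability 0.\<close>
  proof (cases "p = 1")
    case True
    then have "R = 0" using rR less.prems(4) by (auto simp: p_def)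
    then have "vfield S v j = 0" if "j \<in> {Suc c..<q}" for j
      using that nn sum_nonneg_eq_0_iff[of "{Suc c..<q}" "vfield S v"] unfolding R_def by auto
    then show ?thesis using True by simp
  next
    case False
    then have Rp: "R > 0" using R0 rR less.prems(4) by (auto simp: p_def less_le)
    have R2: "sum (vfield S v) {c..<q} - vfield S v c = R" using rR less.prems(3) by simp
    have cq: "Suc c < q"
    proof (rule ccontr)
      assume "\<not> Suc c < q"
      then have "R = 0" unfolding R_def by simp
      then show False using Rp by simp
    qed
    let ?s2 = "nwrite 8 0 (Suc c) (rwrite 3 0 R ?s0)"
    have "W n (draw_loop # K, ?s0) \<le> \<kappa> + W n (Seq (RAssign 3 (NConst 0) (RSub (RArr 3 (NConst 0)) (Field cur spin)))
     (Seq (NAssign 8 (NConst 0) (NAdd spin (NConst 1))) ?F) # draw_loop # K, ?s0)"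
      unfolding draw_loop_def by (rule order_trans[OF W_While_le]) simp
    also have "\<dots> \<le> \<kappa> + (\<kappa> + W n (RAssign 3 (NConst 0) (RSub (RArr 3 (NConst 0)) (Field cur spin)) #
       Seq (NAssign 8 (NConst 0) (NAdd spin (NConst 1))) ?F # draw_loop # K, ?s0))"
      by (intro add_left_mono W_Seq)
    also have "\<dots> \<le> \<kappa> + (\<kappa> + (\<kappa> + W n (Seq (NAssign 8 (NConst 0) (NAdd spin (NConst 1))) ?F # draw_loop # K,
        rwrite 3 0 R ?s0)))"
      using W_RAssign[of n 3 "NConst 0" "RSub (RArr 3 (NConst 0)) (Field cur spin)" _ ?s0]
      by (intro add_left_mono) (simp add: less.prems R2)
    also have "\<dots> \<le> \<kappa> + (\<kappa> + (\<kappa> + (\<kappa> + W n (NAssign 8 (NConst 0) (NAdd spin (NConst 1)) # ?F # draw_loop # K,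
        rwrite 3 0 R ?s0))))"
      by (intro add_left_mono W_Seq)
    also have "\<dots> \<le> \<kappa> + (\<kappa> + (\<kappa> + (\<kappa> + (\<kappa> + W n (?F # draw_loop # K, ?s2)))))"
      using W_NAssign[of n 8 "NConst 0" "NAdd spin (NConst 1)" _ "rwrite 3 0 R ?s0"]
      by (intro add_left_mono) (simp add: less.prems)
    also have "W n (?F # draw_loop # K, ?s2) \<le> \<kappa> * real (7 * (q - Suc c)) +
        (\<Sum>j=Suc c..<q. vfield S v j / rmem ?s2 3 0 * g j)"
    proof (rule less.hyps)
      show "W n (K, s') \<le> g a" if "a < q" "vfield S v a > 0" "nmem s' 8 0 = a"
        "\<And>x. x \<noteq> 8 \<Longrightarrow> x \<noteq> 9 \<Longrightarrow> nmem s' x = nmem ?s2 x"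
        "\<And>x. x \<noteq> 3 \<Longrightarrow> rmem s' x = rmem ?s2 x" for a s'
        using that by (intro less.prems(5)) auto
    qed (use cq Rp less.prems in \<open>auto simp: R_def\<close>)
    also have "rmem ?s2 3 0 = R" by simp
    finally have "W n (draw_loop # K, ?s0) \<le> \<kappa> * real (5 + 7 * (q - Suc c)) +
      (\<Sum>j=Suc c..<q. vfield S v j / R * g j)" by (simp add: algebra_simps)
    then have "(1 - p) * W n (draw_loop # K, ?s0) \<le> (1 - p) * (\<kappa> * real (5 + 7 * (q - Suc c)) +
      (\<Sum>j=Suc c..<q. vfield S v j / R * g j))"
      using p by (intro mult_left_mono) auto
    also have "\<dots> = (1 - p) * (\<kappa> * real (5 + 7 * (q - Suc c))) +
      (\<Sum>j=Suc c..<q. (1 - p) * (vfield S v j / R * g j))"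
      by (simp add: distrib_left sum_distrib_left)
    also have "(\<Sum>j=Suc c..<q. (1 - p) * (vfield S v j / R * g j)) =
        (\<Sum>j=Suc c..<q. vfield S v j / rmem s 3 0 * g j)"
    proof (rule sum.cong)
      have "1 - p = R / rmem s 3 0" using rR less.prems(4) by (simp add: p_def field_simps)
      then show "(1 - p) * (vfield S v j / R * g j) = vfield S v j / rmem s 3 0 * g j" for j
        using Rp by simp
    qed simp
    finally show ?thesis .
  qed
  have "W n (?F # draw_loop # K, s) \<le> \<kappa> + (p * W n (draw_loop # K, ?s1) + (1 - p) * W n (draw_loop # K, ?s0))"
    using W_Flip[of s "RDiv (Field cur spin) (RArr 3 (NConst 0))" n 9 "NConst 0" "draw_loop # K"] p
    by (simp add: p_def less.prems)
  also have "\<dots> \<le> \<kappa> + (p * (\<kappa> + g c) + ((1 - p) * (\<kappa> * real (5 + 7 * (q - Suc c))) +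
      (\<Sum>j=Suc c..<q. vfield S v j / rmem s 3 0 * g j)))"
    using one zero by (intro add_mono) auto
  also have "\<dots> = \<kappa> + p * \<kappa> + (1 - p) * (\<kappa> * real (5 + 7 * (q - Suc c))) +
      (\<Sum>j=c..<q. vfield S v j / rmem s 3 0 * g j)"
    using sum.atLeast_Suc_lessThan[OF less.prems(2), of "\<lambda>j. vfield S v j / rmem s 3 0 * g j"]
    by (simp add: p_def algebra_simps add_divide_distrib)
  also have "\<kappa> + p * \<kappa> + (1 - p) * (\<kappa> * real (5 + 7 * (q - Suc c))) \<le> \<kappa> * real (7 * (q - c))"
  proof -
    have "p * \<kappa> \<le> 1 * \<kappa>" using p \<kappa>_nonneg by (intro mult_right_mono) auto
    moreover have "(1 - p) * (\<kappa> * real (5 + 7 * (q - Suc c))) \<le> 1 * (\<kappa> * real (5 + 7 * (q - Suc c)))"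
      using p \<kappa>_nonneg by (intro mult_right_mono) auto
    moreover have "real (7 * (q - c)) = 7 + real (7 * (q - Suc c))"
      using less.prems(2) by (simp add: of_nat_diff)
    ultimately show ?thesis by (simp add: algebra_simps)
  qed
  finally show ?case by simp
qed

lemma W_draw:
  assumes v: "nmem s 7 0 = v" "v \<in> V"
    and g: "\<And>a s'. a < q \<Longrightarrow> vfield S v a > 0 \<Longrightarrow> nmem s' 8 0 = a \<Longrightarrow>
      (\<And>x. x \<noteq> 8 \<Longrightarrow> x \<noteq> 9 \<Longrightarrow> nmem s' x = nmem s x) \<Longrightarrow> (\<And>x. x \<noteq> 3 \<Longrightarrow> rmem s' x = rmem s x) \<Longrightarrow>
      W n (K, s') \<le> g a"
  shows "W n (draw # K, s) \<le> \<kappa> * real (7 * q + 5) + (\<Sum>a<q. vfield S v a * g a)"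
proof -
  let ?F = "Flip 9 (NConst 0) (RDiv (Field cur spin) (RArr 3 (NConst 0)))"
  let ?s1 = "nwrite 8 0 0 s"
  let ?s2 = "rwrite 3 0 1 ?s1"
  have "W n (draw # K, s) \<le> \<kappa> + W n (NAssign 8 (NConst 0) (NConst 0) #
     Seq (RAssign 3 (NConst 0) (RofN (NConst 1))) (Seq ?F draw_loop) # K, s)"
    unfolding draw_def by (rule W_Seq)
  also have "\<dots> \<le> \<kappa> + (\<kappa> + W n (Seq (RAssign 3 (NConst 0) (RofN (NConst 1))) (Seq ?F draw_loop) # K, ?s1))"
    using W_NAssign[of n 8 "NConst 0" "NConst 0"] by (intro add_left_mono) simp
  also have "\<dots> \<le> \<kappa> + (\<kappa> + (\<kappa> + W n (RAssign 3 (NConst 0) (RofN (NConst 1)) # Seq ?F draw_loop # K, ?s1)))"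
    by (intro add_left_mono W_Seq)
  also have "\<dots> \<le> \<kappa> + (\<kappa> + (\<kappa> + (\<kappa> + W n (Seq ?F draw_loop # K, ?s2))))"
    using W_RAssign[of n 3 "NConst 0" "RofN (NConst 1)" _ ?s1] by (intro add_left_mono) simp
  also have "\<dots> \<le> \<kappa> + (\<kappa> + (\<kappa> + (\<kappa> + (\<kappa> + W n (?F # draw_loop # K, ?s2)))))"
    by (intro add_left_mono W_Seq)
  also have "W n (?F # draw_loop # K, ?s2) \<le> \<kappa> * real (7 * (q - 0)) +
     (\<Sum>j=0..<q. vfield S v j / rmem ?s2 3 0 * g j)"
  proof (rule W_draw_loop)
    show "W n (K, s') \<le> g a" if "a < q" "vfield S v a > 0" "nmem s' 8 0 = a"
      "\<And>x. x \<noteq> 8 \<Longrightarrow> x \<noteq> 9 \<Longrightarrow> nmem s' x = nmem ?s2 x"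
      "\<And>x. x \<noteq> 3 \<Longrightarrow> rmem s' x = rmem ?s2 x" for a s'
      using that by (intro g) auto
  qed (use v vfield_sum[OF v(2)] q_ge_2 in \<open>auto simp: atLeast0LessThan\<close>)
  finally show ?thesis by (simp add: atLeast0LessThan algebra_simps)
qed

section \<open>Revealing neighbours by recursive calls\<close>

lemma W_Seq_NAssign:
  "W n (Seq (NAssign a i e) d # K, s) \<le> 2 * \<kappa> + W n (d # K, nwrite a (neval adj s i) (neval adj s e) s)"
  using W_Seq[of n "NAssign a i e" d K s] W_NAssign[of n a i e "d # K" s] by simp

text \<open>Pins are held on behalf of vertices being sampled, so a free vertex holds none.\<close>

definition owned :: "(nat \<Rightarrow> nat) \<Rightarrow> bool" where
  "owned st \<longleftrightarrow> (\<forall>w u. st w = u + 3 \<longrightarrow> st u = 1)"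

text \<open>The memory that sampling the spin of \<open>v\<close> leaves unchanged: everything about vertices that
  are not free, except for the position of \<open>v\<close> in its own list of neighbours.\<close>

definition frame :: "nat \<Rightarrow> mem \<Rightarrow> mem \<Rightarrow> bool" where
  "frame v s s' \<longleftrightarrow> nmem s' 7 0 = nmem s 7 0 \<and>
     (\<forall>a\<in>{0, 1, 2, 11}. nmem s' a = nmem s a) \<and> (\<forall>a\<in>{0, 1}. rmem s' a = rmem s a) \<and>
     (\<forall>w. w \<notin> free (nmem s 3) \<longrightarrow> nmem s' 4 w = nmem s 4 w \<and> nmem s' 5 w = nmem s 5 w \<and>
        (w \<noteq> v \<longrightarrow> nmem s' 6 w = nmem s 6 w))"

lemma frame_refl: "frame v s s"
  by (simp add: frame_def)

lemma frame_trans: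
  assumes "frame v s s'" "frame v s' s''" "free (nmem s' 3) \<subseteq> free (nmem s 3)"
  shows "frame v s s''"
  using assms unfolding frame_def by auto

text \<open>The procedure returns the spin in the first cell of array 8 and takes expected time at most \<open>t\<close>.\<close>

definition resolves :: "nat \<Rightarrow> mem \<Rightarrow> real \<Rightarrow> bool" where
  "resolves v s t \<longleftrightarrow> (\<forall>n K g.
     (\<forall>a s'. a < q \<longrightarrow> marg ((nmem s 3)(v := 0)) (nmem s 4) v a > 0 \<longrightarrow> nmem s' 8 0 = a \<longrightarrow>
        nmem s' 3 = nmem s 3 \<longrightarrow> frame v s s' \<longrightarrow> W n (K, s') \<le> g a) \<longrightarrow>
     W n (Call 1 # K, s) \<le> \<kappa> * t + (\<Sum>a<q. marg ((nmem s 3)(v := 0)) (nmem s 4) v a * g a))"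

text \<open>At the call \<open>v\<close> already has status 1; resetting it to 0 gives the graph in
  which its marginal is wanted.\<close>

definition resolvable :: "nat \<Rightarrow> mem \<Rightarrow> bool" where
  "resolvable v s \<longleftrightarrow> nmem s 7 0 = v \<and> active v (nmem s 3) \<and> owned (nmem s 3) \<and>
     valid ((nmem s 3)(v := 0)) (nmem s 4)"

lemma W_reveal_neighbor:
  assumes v: "nmem s 7 0 = v" "v \<in> V" "nmem s 3 v = 1" "owned (nmem s 3)" "valid (nmem s 3) (nmem s 4)"
    and i: "nmem s 6 v = i" "i < length (adj v)"
    and u: "adj v ! i = u" "nmem s 3 u = 0"
    and R: "\<And>u s'. resolvable u s' \<Longrightarrow> free (nmem s' 3) \<subset> free (nmem s 3) \<Longrightarrow> resolves u s' t"
    and g: "\<And>a s'. a < q \<Longrightarrow> marg (nmem s 3) (nmem s 4) u a > 0 \<Longrightarrow>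
       nmem s' 3 = (nmem s 3)(u := v + 3) \<Longrightarrow> nmem s' 6 v = i \<Longrightarrow> nmem s' 4 u = a \<Longrightarrow>
       frame v s s' \<Longrightarrow> W n (K, s') \<le> g a"
  shows "W n (reveal_neighbor # K, s) \<le> \<kappa> * (t + 12) + (\<Sum>a<q. marg (nmem s 3) (nmem s 4) u a * g a)"
proof -
  let ?st = "nmem s 3" and ?y = "nmem s 4"
  have uv: "u \<noteq> v" using u v by auto
  have uV: "u \<in> V" using u(1) i(2) set_adj[OF v(2)] neighbors_V nth_mem by blast
  let ?s1 = "nwrite 5 u v s"
  let ?s2 = "nwrite 7 0 u ?s1"
  let ?s3 = "nwrite 3 u 1 ?s2"
  have st3: "(nmem ?s3 3)(u := 0) = ?st" using u by auto
  have fr3: "free (nmem ?s3 3) = free ?st - {u}" using free_upd[of 1 ?st u] by simp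
  \<comment> \<open>By \<open>owned\<close> a free vertex holds no pin, which is what
    \<open>active\<close> demands of \<open>u\<close> at its call.\<close>
  have ou: "?st w \<noteq> u + 3" for w using v(4) u(2) unfolding owned_def by fastforce
  have "owned (nmem ?s3 3)" using v(4) unfolding owned_def by auto
  then have "resolvable u ?s3"
    unfolding resolvable_def st3 using v(5) uV ou by (simp add: active_def)
  moreover have "free (nmem ?s3 3) \<subset> free ?st" unfolding fr3 using u(2) uV by (auto simp: free_def)
  ultimately have res: "resolves u ?s3 t" by (rule R)
  define K1 where "K1 = Seq (NAssign 4 cur spin)
      (Seq (NAssign 3 cur (NAdd (NArr 5 cur) (NConst 3))) (NAssign 7 (NConst 0) (NArr 5 cur)))"
  have after: "W n (K1 # K, s') \<le> \<kappa> * 5 + g a"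
    if a: "a < q" "marg ?st ?y u a > 0" "nmem s' 8 0 = a" "nmem s' 3 = nmem ?s3 3" "frame u ?s3 s'" for a s'
  proof -
    have c: "nmem s' 7 0 = u" using a(5) by (simp add: frame_def)
    \<comment> \<open>\<open>u\<close> left the free set before the call, so \<open>frame\<close>
      protects its return address.\<close>
    have "u \<notin> free (nmem ?s3 3)" unfolding fr3 by simp
    then have par: "nmem s' 5 u = v" using a(5) unfolding frame_def by auto
    let ?t1 = "nwrite 4 u a s'"
    let ?t2 = "nwrite 3 u (v + 3) ?t1"
    let ?t3 = "nwrite 7 0 v ?t2"
    have "W n (K1 # K, s') \<le> 2 * \<kappa> + W n (Seq (NAssign 3 cur (NAdd (NArr 5 cur) (NConst 3))) (NAssign 7 (NConst 0) (NArr 5 cur)) # K, ?t1)"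
      unfolding K1_def by (rule order_trans[OF W_Seq_NAssign]) (simp add: c a)
    also have "\<dots> \<le> 2 * \<kappa> + (2 * \<kappa> + W n (NAssign 7 (NConst 0) (NArr 5 cur) # K, ?t2))"
      by (intro add_left_mono, rule order_trans[OF W_Seq_NAssign]) (simp add: c par)
    also have "\<dots> \<le> 2 * \<kappa> + (2 * \<kappa> + (\<kappa> + W n (K, ?t3)))"
      by (intro add_left_mono, rule order_trans[OF W_NAssign]) (simp add: c par)
    also have "W n (K, ?t3) \<le> g a"
    proof (rule g[OF a(1,2)])
      show "nmem ?t3 3 = ?st(u := v + 3)" using a(4) by simp
      have "v \<notin> free (nmem ?s3 3)" using v(3) uv by (simp add: free_def)
      then have "nmem s' 6 v = nmem ?s3 6 v" using a(5) uv unfolding frame_def by blast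
      then show "nmem ?t3 6 v = i" using i(1) by simp
      show "nmem ?t3 4 u = a" by simp
      show "frame v s ?t3"
      proof -
        have "w \<notin> free ?st \<Longrightarrow> w \<noteq> u \<and> w \<notin> free (nmem ?s3 3)" for w
          unfolding fr3 using u uV by (auto simp: free_def)
        then show ?thesis using a(5) v(1) unfolding frame_def by auto
      qed
    qed
    finally show ?thesis by simp
  qed
  have "W n (reveal_neighbor # K, s) \<le> 2 * \<kappa> + W n (Seq (NAssign 7 (NConst 0) (Neighbor cur (NArr 6 cur)))
      (Seq (NAssign 3 cur (NConst 1)) (Seq (Call 1) K1)) # K, ?s1)"
    unfolding reveal_neighbor_def K1_def Let_def
    by (rule order_trans[OF W_Seq_NAssign]) (simp add: v i u)
  also have "\<dots> \<le> 2 * \<kappa> + (2 * \<kappa> + W n (Seq (NAssign 3 cur (NConst 1)) (Seq (Call 1) K1) # K, ?s2))"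
    by (intro add_left_mono, rule order_trans[OF W_Seq_NAssign]) (simp add: v i u)
  also have "\<dots> \<le> 2 * \<kappa> + (2 * \<kappa> + (2 * \<kappa> + W n (Seq (Call 1) K1 # K, ?s3)))"
    by (intro add_left_mono, rule order_trans[OF W_Seq_NAssign]) simp
  also have "\<dots> \<le> 2 * \<kappa> + (2 * \<kappa> + (2 * \<kappa> + (\<kappa> + W n (Call 1 # K1 # K, ?s3))))"
    by (intro add_left_mono W_Seq)
  also have "W n (Call 1 # K1 # K, ?s3) \<le> \<kappa> * t + (\<Sum>a<q. marg ?st ?y u a * (\<kappa> * 5 + g a))"
    using res after unfolding resolves_def st3 by simp
  also have "(\<Sum>a<q. marg ?st ?y u a * (\<kappa> * 5 + g a)) = \<kappa> * 5 + (\<Sum>a<q. marg ?st ?y u a * g a)"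
    using sum_marg[OF v(5) u(2) uV] by (simp add: distrib_left sum.distrib sum_distrib_right[symmetric])
  finally show ?thesis by (simp add: algebra_simps)
qed

text \<open>One list position costs at most 20 steps of its own plus p * t for a possible call. The
  pinning \<open>y\<close> is carried separately from array 4, since recursive calls may overwrite
  that array at vertices that are free again afterwards.\<close>

lemma W_reveal_loop:
  assumes v: "nmem s 7 0 = v" "v \<in> V" "nmem s 3 v = 1" "owned (nmem s 3)" "valid (nmem s 3) y"
    and y: "\<And>w. w \<notin> free (nmem s 3) \<Longrightarrow> nmem s 4 w = y w"
    and i: "nmem s 6 v = i" "i \<le> length (adj v)"
    and t: "t \<ge> 0"
    and R: "\<And>u s'. resolvable u s' \<Longrightarrow> free (nmem s' 3) \<subset> free (nmem s 3) \<Longrightarrow> resolves u s' t"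
    and g: "\<And>y' s'. valid (nmem s' 3) y' \<Longrightarrow> (\<And>w. w \<notin> free (nmem s' 3) \<Longrightarrow> nmem s' 4 w = y' w) \<Longrightarrow>
       (\<And>u. nmem s' 3 u = nmem s 3 u \<or> (nmem s 3 u = 0 \<and> u \<in> set (adj v) \<and> nmem s' 3 u = v + 3)) \<Longrightarrow>
       frame v s s' \<Longrightarrow> W n (K, s') \<le> \<phi> (nmem s' 3) y'"
  shows "W n (reveal_loop # K, s) \<le>
    \<kappa> * (real (length (adj v) - i) * (20 + t / (2 * real (length (adj v)))) + 1) +
    revE v (drop i (adj v)) (nmem s 3) y \<phi>"
  using i(2) v y i(1) R g
proof (induction i arbitrary: s y rule: inc_induct)
  case base
  have "W n (reveal_loop # K, s) \<le> \<kappa> + W n (K, s)"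
    unfolding reveal_loop_def by (rule order_trans[OF W_While_le]) (simp add: base.prems)
  also have "W n (K, s) \<le> \<phi> (nmem s 3) y"
    by (rule base.prems(9)) (auto simp: base.prems frame_refl)
  finally show ?case by simp
next
  case (step i)
  let ?st = "nmem s 3" and ?d = "length (adj v)"
  define u where "u = adj v ! i"
  have uV: "u \<in> V" "u \<in> set (adj v)"
    using step.hyps(2) set_adj[OF step.prems(2)] neighbors_V nth_mem unfolding u_def by blast+
  have uv: "u \<noteq> v"
  proof
    assume "u = v"
    then have "v \<in> neighbors S v" using uV set_adj[OF step.prems(2)] by auto
    then show False unfolding neighbors_def using edges_irrefl by auto
  qed
  have dr: "drop i (adj v) = u # drop (Suc i) (adj v)"
    unfolding u_def using step.hyps(2) by (rule Cons_nth_drop_Suc[symmetric])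
  define p where "p = 1 / (2 * real ?d)"
  have p: "0 \<le> p" "p \<le> 1" unfolding p_def using half_inverse_le_1 by auto
  define \<tau> where "\<tau> = real (?d - Suc i) * (20 + t / (2 * real ?d)) + 1"
  have \<tau>: "real (?d - i) * (20 + t / (2 * real ?d)) + 1 = \<tau> + 20 + p * t"
  proof -
    have "real (?d - i) = 1 + real (?d - Suc i)" using step.hyps(2) by simp
    then have "real (?d - i) * x = x + real (?d - Suc i) * x" for x
      by (simp only: distrib_right mult_1)
    then show ?thesis unfolding \<tau>_def p_def by simp
  qed
  define nx where "nx = NAssign 6 cur (NAdd (NArr 6 cur) (NConst 1))"
  have cont: "W n (nx # reveal_loop # K, s') \<le> \<kappa> + (\<kappa> * \<tau> + revE v (drop (Suc i) (adj v)) (nmem s' 3) y' \<phi>)"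
    if c: "nmem s' 6 v = i" "valid (nmem s' 3) y'" "\<And>w. w \<notin> free (nmem s' 3) \<Longrightarrow> nmem s' 4 w = y' w"
      "nmem s' 3 = nmem s 3 \<or> (?st u = 0 \<and> nmem s' 3 = ?st(u := v + 3))" "frame v s s'" for s' y'
  proof -
    let ?t = "nwrite 6 v (Suc i) s'"
    have c7: "nmem s' 7 0 = v" using c(5) step.prems(1) by (simp add: frame_def)
    have sub: "free (nmem s' 3) \<subseteq> free ?st" using c(4) by (auto simp: free_def split: if_splits)
    have "W n (nx # reveal_loop # K, s') \<le> \<kappa> + W n (reveal_loop # K, ?t)"
      unfolding nx_def by (rule order_trans[OF W_NAssign]) (simp add: c7 c)
    also have "W n (reveal_loop # K, ?t) \<le> \<kappa> * \<tau> + revE v (drop (Suc i) (adj v)) (nmem ?t 3) y' \<phi>"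
      unfolding \<tau>_def
    proof (rule step.IH)
      show "owned (nmem ?t 3)"
      proof (cases "nmem s' 3 = ?st")
        case False
        have "owned (?st(u := v + 3))" if "?st u = 0"
          unfolding owned_def
        proof (intro allI impI)
          fix w x assume "(?st(u := v + 3)) w = x + 3"
          then have "?st x = 1"
            using step.prems(3,4) unfolding owned_def by (cases "w = u") auto
          then show "(?st(u := v + 3)) x = 1" using that by auto
        qed
        then show ?thesis using c(4) False by auto
      qed (use step.prems(4) in simp)
      show "nmem ?t 3 v = 1" using c(4) uv step.prems(3) by auto
      fix u' s'' assume "resolvable u' s''" "free (nmem s'' 3) \<subset> free (nmem ?t 3)"
      then show "resolves u' s'' t" using sub by (intro step.prems(8)) auto
    next
      fix y'' s''
      assume a: "valid (nmem s'' 3) y''" "\<And>w. w \<notin> free (nmem s'' 3) \<Longrightarrow> nmem s'' 4 w = y'' w"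
       "\<And>u. nmem s'' 3 u = nmem ?t 3 u \<or> (nmem ?t 3 u = 0 \<and> u \<in> set (adj v) \<and> nmem s'' 3 u = v + 3)"
       "frame v ?t s''"
      have "frame v s' ?t" by (simp add: frame_def c7)
      then have "frame v s ?t" using c(5) sub by (intro frame_trans[of v s s' ?t])
      then have f: "frame v s s''" using a(4) sub by (intro frame_trans[of v s ?t s'']) auto
      show "W n (K, s'') \<le> \<phi> (nmem s'' 3) y''"
      proof (rule step.prems(9)[OF a(1,2) _ f])
        fix w
        show "nmem s'' 3 w = ?st w \<or> (?st w = 0 \<and> w \<in> set (adj v) \<and> nmem s'' 3 w = v + 3)"
          using a(3)[of w] c(4) uV by (auto split: if_splits)
      qed
    qed (use c c7 step.prems in auto)
    finally show ?thesis by simp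
  qed
  define body where "body = If (NEq (NArr 3 (Neighbor cur (NArr 6 cur))) (NConst 0))
        (Seq (Flip 9 (NConst 0) (RDiv (RofN (NConst 1)) (RMul (RofN (NConst 2)) (RofN (Degree cur)))))
          (If (NEq bit (NConst 1)) reveal_neighbor Skip))
        Skip"
  have "W n (reveal_loop # K, s) \<le> \<kappa> + W n (Seq body nx # reveal_loop # K, s)"
    unfolding reveal_loop_def body_def nx_def
    by (rule order_trans[OF W_While_le]) (use step in simp)
  also have "\<dots> \<le> \<kappa> + (\<kappa> + W n (body # nx # reveal_loop # K, s))"
    by (intro add_left_mono W_Seq)
  finally have 1: "W n (reveal_loop # K, s) \<le> 2 * \<kappa> + W n (body # nx # reveal_loop # K, s)" by simp
  let ?K = "nx # reveal_loop # K"
  let ?E = "revE v (drop (Suc i) (adj v)) ?st y \<phi>"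
  show ?case
  proof (cases "?st u = 0")
    case False
    have "W n (body # ?K, s) \<le> \<kappa> + W n (Skip # ?K, s)"
      unfolding body_def by (rule order_trans[OF W_If]) (use step False in \<open>simp add: u_def\<close>)
    also have "\<dots> \<le> \<kappa> + (\<kappa> + W n (?K, s))" by (intro add_left_mono W_Skip)
    also have "W n (?K, s) \<le> \<kappa> + (\<kappa> * \<tau> + ?E)"
      by (rule cont) (use step.prems in \<open>auto simp: frame_refl\<close>)
    finally have "W n (reveal_loop # K, s) \<le> \<kappa> * (\<tau> + 5) + ?E" using 1 by (simp add: algebra_simps)
    also have "\<dots> \<le> \<kappa> * (\<tau> + 20 + p * t) + ?E"
      using \<kappa>_nonneg p t by (intro add_right_mono mult_left_mono) auto
    finally show ?thesis using False unfolding \<tau> dr by simp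
  next
    case True
    let ?s1 = "nwrite 9 0 1 s" and ?s0 = "nwrite 9 0 0 s"
    let ?If = "If (NEq bit (NConst 1)) reveal_neighbor Skip"
    let ?F = "Flip 9 (NConst 0) (RDiv (RofN (NConst 1)) (RMul (RofN (NConst 2)) (RofN (Degree cur))))"
    have fl: "reval S adj s (RDiv (RofN (NConst 1)) (RMul (RofN (NConst 2)) (RofN (Degree cur)))) = p"
      by (simp add: p_def step.prems)
    have f9: "frame v s (nwrite 9 0 x s)" for x by (simp add: frame_def)
    have mg: "marg ?st (nmem s 4) u a = marg ?st y u a" for a
      using step.prems(6) by (rule marg_cong)
    have val4: "valid ?st (nmem s 4)" using step.prems(5) valid_cong[of ?st "nmem s 4" y] step.prems(6) by blast
    have zero: "W n (?If # ?K, ?s0) \<le> \<kappa> * (\<tau> + 3) + ?E"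
    proof -
      have "W n (?If # ?K, ?s0) \<le> \<kappa> + W n (Skip # ?K, ?s0)"
        by (rule order_trans[OF W_If]) simp
      also have "\<dots> \<le> \<kappa> + (\<kappa> + W n (?K, ?s0))" by (intro add_left_mono W_Skip)
      also have "W n (?K, ?s0) \<le> \<kappa> + (\<kappa> * \<tau> + revE v (drop (Suc i) (adj v)) (nmem ?s0 3) y \<phi>)"
        by (rule cont) (use step.prems f9 in auto)
      finally show ?thesis by (simp add: algebra_simps)
    qed
    let ?E1 = "\<lambda>a. revE v (drop (Suc i) (adj v)) (?st(u := v + 3)) (y(u := a)) \<phi>"
    have one: "W n (?If # ?K, ?s1) \<le> \<kappa> * (\<tau> + t + 14) + (\<Sum>a<q. marg ?st y u a * ?E1 a)"
    proof -
      have "W n (?If # ?K, ?s1) \<le> \<kappa> + W n (reveal_neighbor # ?K, ?s1)"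
        by (rule order_trans[OF W_If]) simp
      also have "W n (reveal_neighbor # ?K, ?s1) \<le> \<kappa> * (t + 12) +
         (\<Sum>a<q. marg (nmem ?s1 3) (nmem ?s1 4) u a * (\<kappa> + (\<kappa> * \<tau> + ?E1 a)))"
      proof (rule W_reveal_neighbor[where v = v and i = i])
        fix a s'
        assume a: "a < q" "marg (nmem ?s1 3) (nmem ?s1 4) u a > 0"
          "nmem s' 3 = (nmem ?s1 3)(u := v + 3)" "nmem s' 6 v = i" "nmem s' 4 u = a" "frame v ?s1 s'"
        have f: "frame v s s'" by (rule frame_trans[OF f9 a(6)]) simp
        have st': "nmem s' 3 = ?st(u := v + 3)" using a(3) by simp
        have "W n (?K, s') \<le> \<kappa> + (\<kappa> * \<tau> + revE v (drop (Suc i) (adj v)) (nmem s' 3) (y(u := a)) \<phi>)"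
        proof (rule cont[OF a(4)])
          show "valid (nmem s' 3) (y(u := a))"
            unfolding st' using a(2) mg by (intro valid_pin[OF step.prems(5) _ True a(1)]) auto
          show "nmem s' 4 w = (y(u := a)) w" if "w \<notin> free (nmem s' 3)" for w
          proof (cases "w = u")
            case False
            then have "w \<notin> free ?st" using that unfolding st' by (auto simp: free_def)
            then show ?thesis using False f step.prems(6)[of w] by (simp add: frame_def)
          qed (simp add: a)
        qed (use st' True f in auto)
        then show "W n (?K, s') \<le> \<kappa> + (\<kappa> * \<tau> + ?E1 a)" unfolding st' .
      next
        fix u' s' assume "resolvable u' s'" "free (nmem s' 3) \<subset> free (nmem ?s1 3)"
        then show "resolves u' s' t" by (intro step.prems(8)) auto
      qed (use step.prems step.hyps True val4 u_def in auto)
      also have "(\<Sum>a<q. marg (nmem ?s1 3) (nmem ?s1 4) u a * (\<kappa> + (\<kappa> * \<tau> + ?E1 a))) =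
          (\<kappa> + \<kappa> * \<tau>) + (\<Sum>a<q. marg ?st y u a * ?E1 a)"
      proof -
        have "(\<Sum>a<q. marg (nmem ?s1 3) (nmem ?s1 4) u a * (\<kappa> + (\<kappa> * \<tau> + ?E1 a))) =
          (\<Sum>a<q. marg ?st y u a * (\<kappa> + \<kappa> * \<tau>) + marg ?st y u a * ?E1 a)"
          by (simp add: mg algebra_simps)
        then show ?thesis
          using sum_marg[OF step.prems(5) True uV(1)] by (simp add: sum.distrib sum_distrib_right[symmetric])
      qed
      finally show ?thesis by (simp add: algebra_simps)
    qed
    have "W n (body # ?K, s) \<le> \<kappa> + W n (Seq ?F ?If # ?K, s)"
      unfolding body_def by (rule order_trans[OF W_If]) (use step True in \<open>simp add: u_def\<close>)
    also have "\<dots> \<le> \<kappa> + (\<kappa> + W n (?F # ?If # ?K, s))" by (intro add_left_mono W_Seq)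
    also have "W n (?F # ?If # ?K, s) \<le> \<kappa> + (p * W n (?If # ?K, ?s1) + (1 - p) * W n (?If # ?K, ?s0))"
      using W_Flip[of s "RDiv (RofN (NConst 1)) (RMul (RofN (NConst 2)) (RofN (Degree cur)))" n 9 "NConst 0" "?If # ?K"]
        p unfolding fl by simp
    also have "\<dots> \<le> \<kappa> + (p * (\<kappa> * (\<tau> + t + 14) + (\<Sum>a<q. marg ?st y u a * ?E1 a)) +
        (1 - p) * (\<kappa> * (\<tau> + 3) + ?E))"
      using one zero p by (intro add_left_mono add_mono mult_left_mono) auto
    finally have "W n (reveal_loop # K, s) \<le> \<kappa> * (5 + \<tau> + p * t + p * 14 + (1 - p) * 3) +
        ((1 - p) * ?E + p * (\<Sum>a<q. marg ?st y u a * ?E1 a))"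
      using 1 by (simp add: algebra_simps)
    also have "\<dots> \<le> \<kappa> * (\<tau> + 20 + p * t) + ((1 - p) * ?E + p * (\<Sum>a<q. marg ?st y u a * ?E1 a))"
      using \<kappa>_nonneg p by (intro add_right_mono mult_left_mono) auto
    finally show ?thesis using True unfolding \<tau> dr by (simp add: p_def)
  qed
qed

lemma W_reveal:
  assumes v: "nmem s 7 0 = v" "v \<in> V" "nmem s 3 v = 1" "owned (nmem s 3)" "valid (nmem s 3) y"
    and y: "\<And>w. w \<notin> free (nmem s 3) \<Longrightarrow> nmem s 4 w = y w"
    and t: "t \<ge> 0"
    and R: "\<And>u s'. resolvable u s' \<Longrightarrow> free (nmem s' 3) \<subset> free (nmem s 3) \<Longrightarrow> resolves u s' t"
    and g: "\<And>y' s'. valid (nmem s' 3) y' \<Longrightarrow> (\<And>w. w \<notin> free (nmem s' 3) \<Longrightarrow> nmem s' 4 w = y' w) \<Longrightarrow>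
       (\<And>u. nmem s' 3 u = nmem s 3 u \<or> (nmem s 3 u = 0 \<and> u \<in> set (adj v) \<and> nmem s' 3 u = v + 3)) \<Longrightarrow>
       frame v s s' \<Longrightarrow> W n (K, s') \<le> \<phi> (nmem s' 3) y'"
  shows "W n (reveal # K, s) \<le> \<kappa> * (20 * real (length (adj v)) + t / 2 + 3) +
    revE v (adj v) (nmem s 3) y \<phi>"
proof -
  let ?s = "nwrite 6 v 0 s" and ?d = "real (length (adj v))"
  have "W n (reveal # K, s) \<le> 2 * \<kappa> + W n (reveal_loop # K, ?s)"
    unfolding reveal_def by (rule order_trans[OF W_Seq_NAssign]) (simp add: v)
  also have "W n (reveal_loop # K, ?s) \<le>
    \<kappa> * (real (length (adj v) - 0) * (20 + t / (2 * ?d)) + 1) + revE v (drop 0 (adj v)) (nmem ?s 3) y \<phi>"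
  proof (rule W_reveal_loop[where v = v and t = t])
    fix y' s'
    assume a: "valid (nmem s' 3) y'" "\<And>w. w \<notin> free (nmem s' 3) \<Longrightarrow> nmem s' 4 w = y' w"
       "\<And>u. nmem s' 3 u = nmem ?s 3 u \<or> (nmem ?s 3 u = 0 \<and> u \<in> set (adj v) \<and> nmem s' 3 u = v + 3)"
       "frame v ?s s'"
    have "frame v s ?s" by (simp add: frame_def)
    then have "frame v s s'" using a(4) by (rule frame_trans) simp
    then show "W n (K, s') \<le> \<phi> (nmem s' 3) y'" using a by (intro g) auto
  next
    fix u s' assume "resolvable u s'" "free (nmem s' 3) \<subset> free (nmem ?s 3)"
    then show "resolves u s' t" by (intro R) auto
  qed (use v y t in auto)
  \<comment> \<open>Summed over the list, the calls cost \<open>t / 2\<close>, or 0 if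
    \<open>v\<close> has no neighbours; hence only an inequality.\<close>
  also have "\<kappa> * (real (length (adj v) - 0) * (20 + t / (2 * ?d)) + 1) \<le> \<kappa> * (20 * ?d + t / 2 + 1)"
    using \<kappa>_nonneg t by (intro mult_left_mono) (auto simp: field_simps)
  finally show ?thesis by (simp add: algebra_simps)
qed

section \<open>The rejection loop\<close>

lemma acc_cong:
  assumes "\<And>w. w \<notin> free st \<Longrightarrow> y w = y' w"
  shows "acc v c st y = acc v c st y'"
  unfolding acc_def factor_def using assms by (intro prod.cong) (auto simp: free_def)

definition loop_time :: real where
  "loop_time = 200 * (real \<Delta> + real q + 1) / \<eta>"

lemma loop_time_nonneg: "loop_time \<ge> 0"
  unfolding loop_time_def using eta by simp

text \<open>Nested calls take about half of the budget, and starting again after a rejection takes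
  the fraction 1 - \<alpha> \<le> (1 - \<eta>) / 2. The remaining \<eta> / 2 must pay for the local
  work, which is linear in \<Delta> + q; this dictates the form of \<open>loop_time\<close>.\<close>

lemma loop_time_ge:
  assumes "d \<le> \<Delta>" "\<alpha> \<ge> (1 + \<eta>) / 2"
  shows "(20 * real d + (loop_time + 5) / 2 + 3) + real (7 * q + 5) + real (7 * d + 5) +
    real (6 * d + 3) + 12 + (1 - \<alpha>) * loop_time \<le> loop_time"
proof -
  have "real d \<le> real \<Delta>" using assms by simp
  then have "33 * real d + 7 * real q + 40 \<le> 100 * (real \<Delta> + real q + 1)" by simp
  also have "\<dots> = \<eta> / 2 * loop_time" unfolding loop_time_def using eta by simp
  also have "\<dots> \<le> (\<alpha> - 1 / 2) * loop_time"
    using assms loop_time_nonneg by (intro mult_right_mono) auto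
  finally have 1: "66 * real d + 14 * real q + 80 + loop_time \<le> 2 * (\<alpha> * loop_time)"
    by (simp add: left_diff_distrib)
  have 2: "(1 - \<alpha>) * loop_time = loop_time - \<alpha> * loop_time" by (simp add: left_diff_distrib)
  define h where "h = (loop_time + 5) / 2"
  have "2 * h = loop_time + 5" by (simp add: h_def)
  then show ?thesis unfolding 2 h_def[symmetric] using 1 by simp
qed

text \<open>Revealing only turns status 0 into \<open>v + 3\<close>, and no vertex had that status
  before; so releasing the pins of \<open>v\<close> undoes it exactly.\<close>

lemma unpin_restores:
  assumes "\<And>u. st' u = st u \<or> (st u = 0 \<and> u \<in> N \<and> st' u = v + 3)" "\<And>u. st u \<noteq> v + 3"
  shows "(\<lambda>u. if u \<in> N \<and> st' u = v + 3 then 0 else st' u) = st"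
proof
  fix u show "(if u \<in> N \<and> st' u = v + 3 then 0 else st' u) = st u"
    using assms(1)[of u] assms(2)[of u] by auto
qed

text \<open>A rejected round returns to the loop under the same bound with a smaller budget, so the
  induction is on \<open>m\<close>. The continuation keeps the fixed budget \<open>n\<close>, with
  which \<open>W m\<close> is compared by monotonicity; \<open>s\<close> stays the entry state,
  while \<open>s'\<close> may differ from it in whatever \<open>frame\<close> leaves open.\<close>

lemma W_resolve_loop:
  assumes s: "resolvable v s"
    and R: "\<And>u s'. resolvable u s' \<Longrightarrow> free (nmem s' 3) \<subset> free (nmem s 3) \<Longrightarrow> resolves u s' (loop_time + 5)"
    and g: "\<And>a s'. a < q \<Longrightarrow> marg ((nmem s 3)(v := 0)) (nmem s 4) v a > 0 \<Longrightarrow> nmem s' 8 0 = a \<Longrightarrow>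
        nmem s' 3 = nmem s 3 \<Longrightarrow> frame v s s' \<Longrightarrow> W n (K, s') \<le> g a"
    and m: "m \<le> n"
    and s': "nmem s' 3 = nmem s 3" "frame v s s'" "nmem s' 9 0 = 0"
  shows "W m (resolve_loop # K, s') \<le>
    \<kappa> * loop_time + (\<Sum>a<q. marg ((nmem s 3)(v := 0)) (nmem s 4) v a * g a)"
  using m s'
proof (induction m arbitrary: s')
  have v: "nmem s 7 0 = v" "active v (nmem s 3)" "owned (nmem s 3)" "valid ((nmem s 3)(v := 0)) (nmem s 4)"
    using s by (auto simp: resolvable_def)
  have vV: "v \<in> V" "nmem s 3 v = 1" and no: "\<And>u. nmem s 3 u \<noteq> v + 3" using v(2) by (auto simp: active_def)
  let ?st = "nmem s 3" and ?y = "nmem s 4" and ?d = "length (adj v)"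
  have val: "valid ?st ?y" using valid_active[OF v(4,2)] .
  define mg where "mg = marg (?st(v := 0)) ?y v"
  define G where "G = (\<Sum>a<q. mg a * g a)"
  define \<alpha> where "\<alpha> = (\<Sum>a<q. vfield S v a * acc_mean v ?st ?y a)"
  have lam: "vfield S v a \<ge> 0" if "a < q" for a using vfield_nonneg[OF vV(1) that] .
  have \<alpha>: "\<alpha> \<ge> (1 + \<eta>) / 2" "\<alpha> \<le> 1"
  proof -
    have "(1 + \<eta>) / 2 = (\<Sum>a<q. vfield S v a * ((1 + \<eta>) / 2))"
      using vfield_sum[OF vV(1)] by (simp only: sum_distrib_right[symmetric] mult_1)
    also have "\<dots> \<le> \<alpha>" unfolding \<alpha>_def
      using lam acc_mean_bounds[OF val v(2)] by (intro sum_mono mult_left_mono) auto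
    finally show "\<alpha> \<ge> (1 + \<eta>) / 2" .
    have "\<alpha> \<le> (\<Sum>a<q. vfield S v a * 1)" unfolding \<alpha>_def
      using lam acc_mean_bounds[OF val v(2)] by (intro sum_mono mult_left_mono) auto
    then show "\<alpha> \<le> 1" using vfield_sum[OF vV(1)] by simp
  qed
  have mg: "mg a * \<alpha> = vfield S v a * acc_mean v ?st ?y a" for a
    unfolding mg_def \<alpha>_def by (rule marg_active[OF v(4,2)])
  have \<alpha>0: "\<alpha> > 0" by (rule less_le_trans[OF _ \<alpha>(1)]) (use eta in simp)
  have mg_nonneg: "mg a \<ge> 0" if "a < q" for a
    unfolding mg_def using marg_nonneg[OF v(4) _ that] by simp
  {
    case 0
    \<comment> \<open>With budget 0 the value is 0, so only the sign of the bound matters; an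
      explicit memory satisfying the postcondition shows that \<open>g a\<close> is
      nonnegative.\<close>
    have "mg a * g a \<ge> 0" if "a < q" for a
    proof (cases "mg a > 0")
      case True
      have "W n (K, nwrite 8 0 a s) \<le> g a"
        by (rule g) (use True that in \<open>auto simp: mg_def frame_def\<close>)
      then have "g a \<ge> 0" using W_nonneg[of n "(K, nwrite 8 0 a s)"] by linarith
      then show ?thesis using True by simp
    next
      case False
      then show ?thesis using mg_nonneg[OF that] by simp
    qed
    then have "G \<ge> 0" unfolding G_def by (intro sum_nonneg) auto
    then have "W 0 (resolve_loop # K, s') \<le> \<kappa> * loop_time + G"
      using \<kappa>_nonneg loop_time_nonneg by simp
    then show ?case unfolding G_def mg_def .
  next
    case (Suc m)
    have le: "W m cf \<le> W n cf" for cf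
      by (rule lift_Suc_mono_le[where f = "\<lambda>k. W k cf"], rule W_Suc) (use Suc.prems(1) in simp)
    have c': "nmem s' 7 0 = v" using Suc.prems v(1) by (simp add: frame_def)
    let ?body = "Seq reveal (Seq draw (Seq mult_factors (Seq (Flip 9 (NConst 0) (RArr 2 (NConst 0))) unpin)))"
    let ?L = "resolve_loop # K"
    let ?F = "Flip 9 (NConst 0) (RArr 2 (NConst 0))"
    define T where "T = \<kappa> * loop_time + G"
    have y_eq: "nmem s' 4 w = ?y w" if "w \<notin> free ?st" for w
      using Suc.prems(3) that by (simp add: frame_def)
    define tl where "tl = 8 + real (7 * ?d + 5) + real (6 * ?d + 3)"
    have after_unpin: "W m (?L, s2) \<le> (if b = 1 then \<kappa> + g a else T)"
      if "a < q" "vfield S v a > 0" "nmem s2 8 0 = a" "nmem s2 3 = ?st" "frame v s s2"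
        "nmem s2 9 0 = b" "b = 0 \<or> b = 1" for a b s2
    proof (cases "b = 1")
      case True
      have "W m (?L, s2) \<le> \<kappa> + W m (K, s2)"
        unfolding resolve_loop_def by (rule order_trans[OF W_While_le]) (simp add: that True)
      also have "W m (K, s2) \<le> W n (K, s2)" by (rule le)
      also have "\<dots> \<le> g a"
      proof (rule g)
        have "acc_mean v ?st ?y a > 0" by (rule less_le_trans[OF _ acc_mean_bounds(1)[OF val v(2) that(1)]]) (use eta in simp)
        then have "mg a * \<alpha> > 0" unfolding mg using that by simp
        then show "marg (?st(v := 0)) ?y v a > 0" using \<alpha>0 unfolding mg_def by (simp add: zero_less_mult_iff)
      qed (use that in auto)
      finally show ?thesis using True by simp
    next
      case False
      then have "W m (?L, s2) \<le> T" using that Suc.prems(1)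
        unfolding T_def G_def mg_def by (intro Suc.IH) auto
      then show ?thesis using False by simp
    qed
    have after_draw: "W m (Seq mult_factors (Seq ?F unpin) # ?L, s2) \<le>
        \<kappa> * tl + (acc v a (nmem s1 3) y' * (\<kappa> + g a) + (1 - acc v a (nmem s1 3) y') * T)"
      if a: "a < q" "vfield S v a > 0" "nmem s2 8 0 = a"
        "\<And>x. x \<noteq> 8 \<Longrightarrow> x \<noteq> 9 \<Longrightarrow> nmem s2 x = nmem s1 x" "\<And>x. x \<noteq> 3 \<Longrightarrow> rmem s2 x = rmem s1 x"
       and s1: "valid (nmem s1 3) y'" "\<And>w. w \<notin> free (nmem s1 3) \<Longrightarrow> nmem s1 4 w = y' w"
         "\<And>u. nmem s1 3 u = ?st u \<or> (?st u = 0 \<and> u \<in> set (adj v) \<and> nmem s1 3 u = v + 3)"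
         "frame v s s1" for a s2 s1 y'
    proof -
      let ?X = "acc v a (nmem s1 3) y'"
      have X: "0 \<le> ?X" "?X \<le> 1"
        using acc_bounds[OF vV(1) a(1)] s1(1) unfolding valid_def by auto
      have c1: "nmem s2 7 0 = v" using a s1(4) v(1) by (simp add: frame_def)
      have fl: "W m (Seq ?F unpin # ?L, s3) \<le>
          \<kappa> * real (6 * ?d + 5) + (?X * (\<kappa> + g a) + (1 - ?X) * T)"
        if s3: "rmem s3 2 0 = acc v (nmem s2 8 0) (nmem s2 3) (nmem s2 4)"
          "\<forall>x. x \<noteq> 10 \<longrightarrow> nmem s3 x = nmem s2 x" "\<forall>x. x \<noteq> 2 \<longrightarrow> rmem s3 x = rmem s2 x" for s3
      proof -
        have x: "rmem s3 2 0 = ?X" unfolding s3(1) using a acc_cong[OF s1(2)] by simp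
        have un: "W m (unpin # ?L, nwrite 9 0 b s3) \<le>
            \<kappa> * real (6 * ?d + 3) + (if b = 1 then \<kappa> + g a else T)" if b: "b = 0 \<or> b = 1" for b
        proof (rule detD[OF det_unpin[OF _ vV(1)]])
          show "nmem (nwrite 9 0 b s3) 7 0 = v" using s3(2) c1 by simp
          fix s4 :: mem
          assume s4: "nmem s4 3 = (\<lambda>u. if u \<in> set (adj v) \<and> nmem (nwrite 9 0 b s3) 3 u = v + 3 then 0 else nmem (nwrite 9 0 b s3) 3 u) \<and>
            (\<forall>x. x \<noteq> 10 \<longrightarrow> x \<noteq> 3 \<longrightarrow> nmem s4 x = nmem (nwrite 9 0 b s3) x) \<and> rmem s4 = rmem (nwrite 9 0 b s3)"
          have st3: "nmem (nwrite 9 0 b s3) 3 = nmem s1 3" using s3(2) a(4) by simp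
          have "nmem s4 3 = (\<lambda>u. if u \<in> set (adj v) \<and> nmem s1 3 u = v + 3 then 0 else nmem s1 3 u)"
            using conjunct1[OF s4] unfolding st3 .
          then have st4: "nmem s4 3 = ?st" using unpin_restores[OF s1(3) no] by simp
          show "W m (?L, s4) \<le> (if b = 1 then \<kappa> + g a else T)"
          proof (rule after_unpin[OF a(1,2) _ st4 _ _ b])
            show "nmem s4 8 0 = a" "nmem s4 9 0 = b" using s4 s3(2) a by simp_all
            have "nmem s4 x = nmem s1 x" if "x \<notin> {3, 8, 9, 10}" for x
              using that s4 s3(2) a(4) by simp
            moreover have "rmem s4 x = rmem s1 x" if "x \<notin> {2, 3}" for x
              using that s4 s3(3) a(5) by simp
            ultimately show "frame v s s4" using s1(4) by (simp add: frame_def)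
          qed
        qed
        have "W m (Seq ?F unpin # ?L, s3) \<le> \<kappa> + W m (?F # unpin # ?L, s3)" by (rule W_Seq)
        also have "W m (?F # unpin # ?L, s3) \<le> \<kappa> + (?X * W m (unpin # ?L, nwrite 9 0 1 s3) +
            (1 - ?X) * W m (unpin # ?L, nwrite 9 0 0 s3))"
          using W_Flip[of s3 "RArr 2 (NConst 0)" m 9 "NConst 0" "unpin # ?L"] X by (simp add: x)
        also have "\<dots> \<le> \<kappa> + (?X * (\<kappa> * real (6 * ?d + 3) + (\<kappa> + g a)) +
            (1 - ?X) * (\<kappa> * real (6 * ?d + 3) + T))"
          using un[of 1] un[of 0] X by (intro add_left_mono add_mono mult_left_mono) auto
        finally show ?thesis by (simp add: algebra_simps)
      qed
      have "W m (Seq mult_factors (Seq ?F unpin) # ?L, s2) \<le> \<kappa> + W m (mult_factors # Seq ?F unpin # ?L, s2)"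
        by (rule W_Seq)
      also have "W m (mult_factors # Seq ?F unpin # ?L, s2) \<le> \<kappa> * real (7 * ?d + 5) +
          (\<kappa> * real (6 * ?d + 5) + (?X * (\<kappa> + g a) + (1 - ?X) * T))"
        by (rule detD[OF det_mult_factors[OF c1 vV(1)]]) (use fl in blast)
      finally have "W m (Seq mult_factors (Seq ?F unpin) # ?L, s2) \<le> \<kappa> * (1 + real (7 * ?d + 5) + real (6 * ?d + 5)) +
          (?X * (\<kappa> + g a) + (1 - ?X) * T)" by (simp add: algebra_simps)
      also have "\<dots> \<le> \<kappa> * tl + (?X * (\<kappa> + g a) + (1 - ?X) * T)"
        using \<kappa>_nonneg unfolding tl_def by (intro add_right_mono mult_left_mono) auto
      finally show ?thesis .
    qed
    \<comment> \<open>The value after revealing is affine in the acceptance probabilities, so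
      averaging over the revealed set needs only their means.\<close>
    define \<phi> where "\<phi> = (\<lambda>st' y'. (\<kappa> * (real (7 * q + 5) + 1 + tl) + T) +
        (\<Sum>a<q. vfield S v a * (\<kappa> + g a - T) * acc v a st' y'))"
    have after_reveal: "W m (Seq draw (Seq mult_factors (Seq ?F unpin)) # ?L, s1) \<le> \<phi> (nmem s1 3) y'"
      if s1: "valid (nmem s1 3) y'" "\<And>w. w \<notin> free (nmem s1 3) \<Longrightarrow> nmem s1 4 w = y' w"
         "\<And>u. nmem s1 3 u = ?st u \<or> (?st u = 0 \<and> u \<in> set (adj v) \<and> nmem s1 3 u = v + 3)"
         "frame v s s1" for s1 y'
    proof -
      let ?X = "\<lambda>a. acc v a (nmem s1 3) y'"
      have c1: "nmem s1 7 0 = v" using s1(4) v(1) by (simp add: frame_def)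
      have "W m (Seq draw (Seq mult_factors (Seq ?F unpin)) # ?L, s1) \<le>
          \<kappa> + W m (draw # Seq mult_factors (Seq ?F unpin) # ?L, s1)" by (rule W_Seq)
      also have "W m (draw # Seq mult_factors (Seq ?F unpin) # ?L, s1) \<le> \<kappa> * real (7 * q + 5) +
          (\<Sum>a<q. vfield S v a * (\<kappa> * tl + (?X a * (\<kappa> + g a) + (1 - ?X a) * T)))"
        by (rule W_draw[OF c1 vV(1)]) (rule after_draw[OF _ _ _ _ _ s1]; assumption)
      also have "(\<Sum>a<q. vfield S v a * (\<kappa> * tl + (?X a * (\<kappa> + g a) + (1 - ?X a) * T))) =
          (\<Sum>a<q. vfield S v a * (\<kappa> * tl + T) + vfield S v a * (\<kappa> + g a - T) * ?X a)"
        by (intro sum.cong) (auto simp: algebra_simps)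
      also have "\<dots> = (\<kappa> * tl + T) + (\<Sum>a<q. vfield S v a * (\<kappa> + g a - T) * ?X a)"
        using vfield_sum[OF vV(1)] by (simp add: sum.distrib sum_distrib_right[symmetric])
      finally show ?thesis unfolding \<phi>_def by (simp add: algebra_simps)
    qed
    \<comment> \<open>An accepted proposal \<open>a\<close> has probability field times mean
      acceptance, which is \<alpha> times the marginal: acceptance contributes \<alpha> * G and
      rejection (1 - \<alpha>) * T.\<close>
    have rv: "revE v (adj v) ?st ?y \<phi> = \<kappa> * (real (7 * q + 5) + 1 + tl + \<alpha>) + (1 - \<alpha>) * T + \<alpha> * G"
    proof -
      have sub: "set (adj v) \<subseteq> V" using set_adj[OF vV(1)] neighbors_V by auto
      have "revE v (adj v) ?st ?y \<phi> = (\<kappa> * (real (7 * q + 5) + 1 + tl) + T) +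
          (\<Sum>a<q. vfield S v a * (\<kappa> + g a - T) * acc_mean v ?st ?y a)"
        unfolding \<phi>_def acc_mean_def
        by (simp only: revE_add revE_const[OF val sub distinct_adj[OF vV(1)]] revE_sum[OF finite_lessThan] revE_cmult)
      also have "(\<Sum>a<q. vfield S v a * (\<kappa> + g a - T) * acc_mean v ?st ?y a) =
          (\<Sum>a<q. (\<kappa> - T) * (vfield S v a * acc_mean v ?st ?y a) + \<alpha> * (mg a * g a))"
      proof (rule sum.cong)
        fix a
        have "vfield S v a * (\<kappa> + g a - T) * acc_mean v ?st ?y a =
          (\<kappa> - T) * (vfield S v a * acc_mean v ?st ?y a) + (vfield S v a * acc_mean v ?st ?y a) * g a"
          by (simp add: algebra_simps)
        then show "vfield S v a * (\<kappa> + g a - T) * acc_mean v ?st ?y a =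
          (\<kappa> - T) * (vfield S v a * acc_mean v ?st ?y a) + \<alpha> * (mg a * g a)"
          unfolding mg[symmetric] by (simp add: algebra_simps)
      qed simp
      also have "\<dots> = (\<kappa> - T) * \<alpha> + \<alpha> * G"
        unfolding \<alpha>_def[symmetric] G_def
        by (simp add: sum.distrib sum_distrib_left[symmetric] \<alpha>_def[symmetric])
      finally show ?thesis by (simp add: algebra_simps)
    qed
    have "W (Suc m) (resolve_loop # K, s') = \<kappa> + W m (?body # ?L, s')"
      unfolding resolve_loop_def W_While using Suc.prems(4) by simp
    also have "W m (?body # ?L, s') \<le> \<kappa> + W m (reveal # Seq draw (Seq mult_factors (Seq ?F unpin)) # ?L, s')"
      by (rule W_Seq)
    also have "W m (reveal # Seq draw (Seq mult_factors (Seq ?F unpin)) # ?L, s') \<le>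
        \<kappa> * (20 * real ?d + (loop_time + 5) / 2 + 3) + revE v (adj v) (nmem s' 3) ?y \<phi>"
    proof (rule W_reveal)
      fix y' and s1 :: mem
      assume s1: "valid (nmem s1 3) y'" "\<And>w. w \<notin> free (nmem s1 3) \<Longrightarrow> nmem s1 4 w = y' w"
         "\<And>u. nmem s1 3 u = nmem s' 3 u \<or> (nmem s' 3 u = 0 \<and> u \<in> set (adj v) \<and> nmem s1 3 u = v + 3)"
         "frame v s' s1"
      have "frame v s s1" using Suc.prems(2,3) s1(4) by (intro frame_trans[of v s s' s1]) auto
      then show "W m (Seq draw (Seq mult_factors (Seq ?F unpin)) # ?L, s1) \<le> \<phi> (nmem s1 3) y'"
        using s1 Suc.prems(2) by (intro after_reveal) auto
    next
      fix u s1 assume "resolvable u s1" "free (nmem s1 3) \<subset> free (nmem s' 3)"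
      then show "resolves u s1 (loop_time + 5)" using Suc.prems(2) by (intro R) auto
    qed (use Suc.prems(2) c' vV v(3) val y_eq loop_time_nonneg in auto)
    also have "revE v (adj v) (nmem s' 3) ?y \<phi> = \<kappa> * (real (7 * q + 5) + 1 + tl + \<alpha>) + (1 - \<alpha>) * T + \<alpha> * G"
      using rv Suc.prems(2) by simp
    finally have "W (Suc m) (resolve_loop # K, s') \<le> \<kappa> * (2 + (20 * real ?d + (loop_time + 5) / 2 + 3) +
        (real (7 * q + 5) + 1 + tl + \<alpha>) + (1 - \<alpha>) * loop_time) + G"
      by (simp add: T_def algebra_simps)
    also have "\<dots> \<le> \<kappa> * loop_time + G"
    proof (intro add_right_mono mult_left_mono \<kappa>_nonneg)
      show "2 + (20 * real ?d + (loop_time + 5) / 2 + 3) +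
        (real (7 * q + 5) + 1 + tl + \<alpha>) + (1 - \<alpha>) * loop_time \<le> loop_time"
        using loop_time_ge[OF length_adj_le[OF vV(1)] \<alpha>(1)] \<alpha>(2) unfolding tl_def by simp
    qed
    finally show ?case unfolding G_def mg_def .
  }
qed

text \<open>The called vertex is deleted, so nested calls see fewer free vertices, while the time
  bound is the same at all levels. The 5 covers the steps of \<open>Call\<close> and of entering the
  loop.\<close>

lemma resolves_resolvable: "resolvable v s \<Longrightarrow> resolves v s (loop_time + 5)"
proof (induction "card (free (nmem s 3))" arbitrary: v s rule: less_induct)
  case less
  have R: "resolves u s' (loop_time + 5)"
    if "resolvable u s'" "free (nmem s' 3) \<subset> free (nmem s 3)" for u s'
    using that by (intro less.hyps psubset_card_mono finite_free)
  show ?case unfolding resolves_def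
  proof (intro allI impI)
    fix n K g
    assume g: "\<forall>a s'. a < q \<longrightarrow> marg ((nmem s 3)(v := 0)) (nmem s 4) v a > 0 \<longrightarrow> nmem s' 8 0 = a \<longrightarrow>
        nmem s' 3 = nmem s 3 \<longrightarrow> frame v s s' \<longrightarrow> W n (K, s') \<le> g a"
    let ?s = "nwrite 9 0 0 s"
    have "W n (Call 1 # K, s) \<le> \<kappa> + W n (resolve # K, s)"
      using W_Call[of 1 n K s] by simp
    also have "W n (resolve # K, s) \<le> 2 * \<kappa> + W n (resolve_loop # K, ?s)"
      using W_Seq_NAssign[of n 9 "NConst 0" "NConst 0" resolve_loop K s] by (simp flip: resolve_def)
    also have "W n (resolve_loop # K, ?s) \<le>
      \<kappa> * loop_time + (\<Sum>a<q. marg ((nmem s 3)(v := 0)) (nmem s 4) v a * g a)"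
      by (rule W_resolve_loop[OF less.prems R _ order_refl]) (use g in \<open>auto simp: frame_def\<close>)
    finally have "W n (Call 1 # K, s) \<le> \<kappa> * (loop_time + 3) + (\<Sum>a<q. marg ((nmem s 3)(v := 0)) (nmem s 4) v a * g a)"
      by (simp add: algebra_simps)
    also have "\<dots> \<le> \<kappa> * (loop_time + 5) + (\<Sum>a<q. marg ((nmem s 3)(v := 0)) (nmem s 4) v a * g a)"
      using \<kappa>_nonneg by (intro add_right_mono mult_left_mono) auto
    finally show "W n (Call 1 # K, s) \<le> \<kappa> * (loop_time + 5) + (\<Sum>a<q. marg ((nmem s 3)(v := 0)) (nmem s 4) v a * g a)" .
  qed
qed

section \<open>The estimator\<close>

lemma det_read_pinning:
  assumes L: "nmem s 0 2 = length L" "\<And>i. i < length L \<Longrightarrow> nmem s 1 i = L ! i"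
    "\<And>i. i < length L \<Longrightarrow> nmem s 2 i = \<sigma> (L ! i)"
  shows "det read_pinning s (6 * length L + 3)
    (\<lambda>s'. nmem s' 3 = (\<lambda>u. if u \<in> set L then 2 else nmem s 3 u) \<and>
       nmem s' 4 = (\<lambda>u. if u \<in> set L then \<sigma> u else nmem s 4 u) \<and>
       (\<forall>a. a \<noteq> 3 \<longrightarrow> a \<noteq> 4 \<longrightarrow> a \<noteq> 11 \<longrightarrow> nmem s' a = nmem s a) \<and> rmem s' = rmem s)"
proof -
  define I :: "nat \<Rightarrow> mem \<Rightarrow> bool" where "I = (\<lambda>i s'. nmem s' 11 0 = i \<and>
     nmem s' 3 = (\<lambda>u. if u \<in> set (take i L) then 2 else nmem s 3 u) \<and>
     nmem s' 4 = (\<lambda>u. if u \<in> set (take i L) then \<sigma> u else nmem s 4 u) \<and>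
     (\<forall>a. a \<noteq> 3 \<longrightarrow> a \<noteq> 4 \<longrightarrow> a \<noteq> 11 \<longrightarrow> nmem s' a = nmem s a) \<and> rmem s' = rmem s)"
  have I: "I i s' \<Longrightarrow> nmem s' 11 0 = i"
    "I i s' \<Longrightarrow> nmem s' 3 = (\<lambda>u. if u \<in> set (take i L) then 2 else nmem s 3 u)"
    "I i s' \<Longrightarrow> nmem s' 4 = (\<lambda>u. if u \<in> set (take i L) then \<sigma> u else nmem s 4 u)"
    "I i s' \<Longrightarrow> a \<noteq> 3 \<Longrightarrow> a \<noteq> 4 \<Longrightarrow> a \<noteq> 11 \<Longrightarrow> nmem s' a = nmem s a"
    "I i s' \<Longrightarrow> rmem s' = rmem s" for i s' a
    by (auto simp: I_def)
  show ?thesis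
    unfolding read_pinning_def
  proof (rule det_le, rule det_Seq_NAssign, rule det_mono[OF det_for[where m = "length L" and I = I and k = 5]])
    fix i s' assume i: "i < length L" "I i s'"
    note s' = I[OF i(2)]
    have tk: "set (take (Suc i) L) = insert (L ! i) (set (take i L))"
      using i by (simp add: take_Suc_conv_app_nth)
    show "beval S adj s' (NLess count (NArr 0 (NConst 2))) \<and> det (Seq (NAssign 3 (NArr 1 count) (NConst 2))
       (Seq (NAssign 4 (NArr 1 count) (NArr 2 count))
         (NAssign 11 (NConst 0) (NAdd count (NConst 1))))) s' 5 (I (Suc i))"
    proof
      show "beval S adj s' (NLess count (NArr 0 (NConst 2)))" using i(1) by (simp add: s' L)
      show "det (Seq (NAssign 3 (NArr 1 count) (NConst 2))
       (Seq (NAssign 4 (NArr 1 count) (NArr 2 count))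
         (NAssign 11 (NConst 0) (NAdd count (NConst 1))))) s' 5 (I (Suc i))"
        by (rule det_le, rule det_Seq_NAssign, rule det_Seq_NAssign, rule det_NAssign)
          (use i(1) in \<open>auto simp: s' L I_def tk fun_eq_iff simp del: One_nat_def\<close>)
    qed
  qed (auto simp: I L, auto simp: I_def)
qed

lemma det_add_factors:
  assumes v: "nmem s 7 0 = v" "v \<in> V" and q: "nmem s 0 0 = q"
  shows "det add_factors s (q * (7 * length (adj v) + 10) + 3)
    (\<lambda>s'. rmem s' 1 = (\<lambda>c. if c < q then rmem s 1 c + acc v c (nmem s 3) (nmem s 4) else rmem s 1 c) \<and>
       (\<forall>a. a \<noteq> 8 \<longrightarrow> a \<noteq> 10 \<longrightarrow> nmem s' a = nmem s a) \<and>
       (\<forall>a. a \<noteq> 1 \<longrightarrow> a \<noteq> 2 \<longrightarrow> rmem s' a = rmem s a))"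
proof -
  define I :: "nat \<Rightarrow> mem \<Rightarrow> bool" where "I = (\<lambda>i s'. nmem s' 8 0 = i \<and>
     rmem s' 1 = (\<lambda>c. if c < i then rmem s 1 c + acc v c (nmem s 3) (nmem s 4) else rmem s 1 c) \<and>
     (\<forall>a. a \<noteq> 8 \<longrightarrow> a \<noteq> 10 \<longrightarrow> nmem s' a = nmem s a) \<and>
     (\<forall>a. a \<noteq> 1 \<longrightarrow> a \<noteq> 2 \<longrightarrow> rmem s' a = rmem s a))"
  have I: "I i s' \<Longrightarrow> nmem s' 8 0 = i"
    "I i s' \<Longrightarrow> rmem s' 1 = (\<lambda>c. if c < i then rmem s 1 c + acc v c (nmem s 3) (nmem s 4) else rmem s 1 c)"
    "I i s' \<Longrightarrow> a \<noteq> 8 \<Longrightarrow> a \<noteq> 10 \<Longrightarrow> nmem s' a = nmem s a"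
    "I i s' \<Longrightarrow> a \<noteq> 1 \<Longrightarrow> a \<noteq> 2 \<Longrightarrow> rmem s' a = rmem s a" for i s' a
    by (auto simp: I_def)
  show ?thesis
    unfolding add_factors_def
  proof (rule det_le, rule det_Seq_NAssign,
      rule det_mono[OF det_for[where m = q and I = I and k = "7 * length (adj v) + 9"]])
    fix i s' assume i: "i < q" "I i s'"
    note s' = I[OF i(2)]
    show "beval S adj s' (NLess spin (NArr 0 (NConst 0))) \<and> det (Seq mult_factors
       (Seq (RAssign 1 spin (RAdd (RArr 1 spin) (RArr 2 (NConst 0))))
         (NAssign 8 (NConst 0) (NAdd spin (NConst 1))))) s' (7 * length (adj v) + 9) (I (Suc i))"
    proof
      show "beval S adj s' (NLess spin (NArr 0 (NConst 0)))" using i(1) by (simp add: s' q)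
      show "det (Seq mult_factors
       (Seq (RAssign 1 spin (RAdd (RArr 1 spin) (RArr 2 (NConst 0))))
         (NAssign 8 (NConst 0) (NAdd spin (NConst 1))))) s' (7 * length (adj v) + 9) (I (Suc i))"
      proof (rule det_le, rule det_Seq, rule det_mult_factors[OF _ v(2)])
        show "nmem s' 7 0 = v" by (simp add: s' v)
        fix t :: mem
        assume t: "rmem t 2 0 = acc v (nmem s' 8 0) (nmem s' 3) (nmem s' 4) \<and>
          (\<forall>a. a \<noteq> 10 \<longrightarrow> nmem t a = nmem s' a) \<and> (\<forall>a. a \<noteq> 2 \<longrightarrow> rmem t a = rmem s' a)"
        show "det (Seq (RAssign 1 spin (RAdd (RArr 1 spin) (RArr 2 (NConst 0))))
         (NAssign 8 (NConst 0) (NAdd spin (NConst 1)))) t (2 + 1) (I (Suc i))"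
          by (rule det_Seq_RAssign, rule det_NAssign) (use t in \<open>auto simp: I_def s' fun_eq_iff less_Suc_eq simp del: One_nat_def\<close>)
      qed simp
    qed
  qed (auto simp: I q, auto simp: I_def)
qed

lemma det_normalize_sums:
  assumes v: "nmem s 7 0 = v" and q: "nmem s 0 0 = q"
  shows "det normalize_sums s (10 * q + 8)
    (\<lambda>s'. \<forall>c<q. rmem s' 1 c = vfield S v c * rmem s 1 c / (\<Sum>j<q. vfield S v j * rmem s 1 j))"
proof -
  define D where "D = (\<lambda>i. \<Sum>j<i. vfield S v j * rmem s 1 j)"
  define I1 :: "nat \<Rightarrow> mem \<Rightarrow> bool" where "I1 = (\<lambda>i s'. nmem s' 8 0 = i \<and> nmem s' 7 0 = v \<and>
     nmem s' 0 0 = q \<and> rmem s' 1 = rmem s 1 \<and> rmem s' 4 0 = D i)"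
  define I2 :: "nat \<Rightarrow> mem \<Rightarrow> bool" where "I2 = (\<lambda>i s'. nmem s' 8 0 = i \<and> nmem s' 7 0 = v \<and>
     nmem s' 0 0 = q \<and> rmem s' 4 0 = D q \<and>
     rmem s' 1 = (\<lambda>c. if c < i then vfield S v c * rmem s 1 c / D q else rmem s 1 c))"
  have 1: "det (While (NLess spin (NArr 0 (NConst 0)))
       (Seq (RAssign 4 (NConst 0) (RAdd (RArr 4 (NConst 0)) (RMul (Field cur spin) (RArr 1 spin))))
         (NAssign 8 (NConst 0) (NAdd spin (NConst 1))))) t (q * (3 + 1) + 1) (I1 q)" if "I1 0 t" for t
  proof (rule det_for)
    fix i s' assume i: "i < q" "I1 i s'"
    have "det (Seq (RAssign 4 (NConst 0) (RAdd (RArr 4 (NConst 0)) (RMul (Field cur spin) (RArr 1 spin))))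
         (NAssign 8 (NConst 0) (NAdd spin (NConst 1)))) s' (2 + 1) (I1 (Suc i))"
      by (rule det_Seq_RAssign, rule det_NAssign) (use i in \<open>simp add: I1_def D_def\<close>)
    then show "beval S adj s' (NLess spin (NArr 0 (NConst 0))) \<and>
       det (Seq (RAssign 4 (NConst 0) (RAdd (RArr 4 (NConst 0)) (RMul (Field cur spin) (RArr 1 spin))))
         (NAssign 8 (NConst 0) (NAdd spin (NConst 1)))) s' 3 (I1 (Suc i))"
      using i by (simp add: I1_def)
  qed (use that in \<open>auto simp: I1_def\<close>)
  have 2: "det (While (NLess spin (NArr 0 (NConst 0)))
       (Seq (RAssign 1 spin (RDiv (RMul (Field cur spin) (RArr 1 spin)) (RArr 4 (NConst 0))))
         (NAssign 8 (NConst 0) (NAdd spin (NConst 1))))) t (q * (3 + 1) + 1) (I2 q)" if "I2 0 t" for t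
  proof (rule det_for)
    fix i s' assume i: "i < q" "I2 i s'"
    have "det (Seq (RAssign 1 spin (RDiv (RMul (Field cur spin) (RArr 1 spin)) (RArr 4 (NConst 0))))
         (NAssign 8 (NConst 0) (NAdd spin (NConst 1)))) s' (2 + 1) (I2 (Suc i))"
      by (rule det_Seq_RAssign, rule det_NAssign) (use i in \<open>auto simp: I2_def fun_eq_iff\<close>)
    then show "beval S adj s' (NLess spin (NArr 0 (NConst 0))) \<and>
       det (Seq (RAssign 1 spin (RDiv (RMul (Field cur spin) (RArr 1 spin)) (RArr 4 (NConst 0))))
         (NAssign 8 (NConst 0) (NAdd spin (NConst 1)))) s' 3 (I2 (Suc i))"
      using i by (simp add: I2_def)
  qed (use that in \<open>auto simp: I2_def\<close>)
  have "det normalize_sums s (2 + (2 + (1 + (q * (3 + 1) + 1) + (2 + (q * (3 + 1) + 1))))) (I2 q)"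
    unfolding normalize_sums_def
  proof (rule det_Seq_RAssign, rule det_Seq_NAssign, rule det_Seq, rule 1)
    fix t assume t: "I1 q t"
    show "det (Seq (NAssign 8 (NConst 0) (NConst 0)) (While (NLess spin (NArr 0 (NConst 0)))
       (Seq (RAssign 1 spin (RDiv (RMul (Field cur spin) (RArr 1 spin)) (RArr 4 (NConst 0))))
         (NAssign 8 (NConst 0) (NAdd spin (NConst 1)))))) t (2 + (q * (3 + 1) + 1)) (I2 q)"
      by (rule det_Seq_NAssign, rule 2) (use t in \<open>simp add: I1_def I2_def\<close>)
  qed (simp add: I1_def D_def v q)
  then show ?thesis
    by (rule det_mono) (use q_ge_2 in \<open>auto simp: I2_def D_def\<close>)
qed

section \<open>The sampling loop with a quadratic potential\<close>

definition sample_time :: "nat \<Rightarrow> real" where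
  "sample_time v = 20 * real (length (adj v)) + (loop_time + 5) / 2 + 3 +
     real (q * (7 * length (adj v) + 10) + 3) + real (6 * length (adj v) + 3) + 5"

text \<open>The potential \<open>(X\<^sub>1 + \<dots> + X\<^sub>k - k m)\<^sup>2 + (N - k)\<close> is a supermartingale, since the
  summands have mean \<open>m\<close> and variance at most 1.\<close>

lemma W_sample_loop:
  fixes \<epsilon> \<delta> :: real
  assumes v: "active v st" "owned st" "valid st y"
    and N: "\<And>k. k < N \<Longrightarrow> real k * (\<epsilon> * \<epsilon> * \<delta>) < 36 * real q" "\<not> real N * (\<epsilon> * \<epsilon> * \<delta>) < 36 * real q"
    and w: "\<And>c. w c \<ge> 0"
    and s: "nmem s 7 0 = v" "nmem s 3 = st" "\<And>u. u \<notin> free st \<Longrightarrow> nmem s 4 u = y u"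
      "nmem s 11 0 = k" "nmem s 0 0 = q" "rmem s 0 0 = \<epsilon>" "rmem s 0 1 = \<delta>"
    and k: "k \<le> N"
    and K: "\<And>s'. nmem s' 7 0 = v \<Longrightarrow> nmem s' 0 0 = q \<Longrightarrow>
       W n (K, s') \<le> B + (\<Sum>c<q. (rmem s' 1 c - real N * acc_mean v st y c)\<^sup>2 * w c)"
  shows "W n (sample_loop # K, s) \<le> B + \<kappa> * (real (N - k) * sample_time v + 1) +
     (\<Sum>c<q. ((rmem s 1 c - real k * acc_mean v st y c)\<^sup>2 + real (N - k)) * w c)"
  using k s
proof (induction k arbitrary: s rule: inc_induct)
  case base
  have "W n (sample_loop # K, s) \<le> \<kappa> + W n (K, s)"
    unfolding sample_loop_def by (rule order_trans[OF W_While_le]) (use base N(2) in simp)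
  also have "W n (K, s) \<le> B + (\<Sum>c<q. (rmem s 1 c - real N * acc_mean v st y c)\<^sup>2 * w c)"
    using base by (intro K) auto
  finally show ?case by simp
next
  case (step k)
  have vV: "v \<in> V" "st v = 1" and no: "\<And>u. st u \<noteq> v + 3" using v(1) by (auto simp: active_def)
  let ?d = "length (adj v)"
  let ?m = "acc_mean v st y"
  define C where "C = B + \<kappa> * (real (N - Suc k) * sample_time v + 1)"
  define tl where "tl = real (q * (7 * ?d + 10) + 3) + real (6 * ?d + 3) + 3"
  define nx where "nx = NAssign 11 (NConst 0) (NAdd count (NConst 1))"
  define \<phi> where "\<phi> = (\<lambda>st' y'. \<kappa> * tl + C +
     (\<Sum>c<q. ((rmem s 1 c + acc v c st' y' - real (Suc k) * ?m c)\<^sup>2 + real (N - Suc k)) * w c))"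
  have after: "W n (Seq add_factors (Seq unpin nx) # sample_loop # K, s1) \<le> \<phi> (nmem s1 3) y'"
    if s1: "valid (nmem s1 3) y'" "\<And>w. w \<notin> free (nmem s1 3) \<Longrightarrow> nmem s1 4 w = y' w"
      "\<And>u. nmem s1 3 u = nmem s 3 u \<or> (nmem s 3 u = 0 \<and> u \<in> set (adj v) \<and> nmem s1 3 u = v + 3)"
      "frame v s s1" for y' s1
  proof -
    define G where "G = C + (\<Sum>c<q. ((rmem s 1 c + acc v c (nmem s1 3) y' - real (Suc k) * ?m c)\<^sup>2 + real (N - Suc k)) * w c)"
    have f1: "nmem s1 7 0 = v" "nmem s1 0 = nmem s 0" "nmem s1 11 = nmem s 11" "rmem s1 0 = rmem s 0"
      "rmem s1 1 = rmem s 1" "\<And>u. u \<notin> free st \<Longrightarrow> nmem s1 4 u = nmem s 4 u"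
      using s1(4) step.prems by (auto simp: frame_def)
    have acc: "acc v c (nmem s1 3) (nmem s1 4) = acc v c (nmem s1 3) y'" for c
      by (rule acc_cong[OF s1(2)])
    have "det (Seq add_factors (Seq unpin nx)) s1 (1 + (q * (7 * ?d + 10) + 3) + (1 + (6 * ?d + 3) + 1))
      (\<lambda>s4. nmem s4 3 = st \<and> nmem s4 11 0 = Suc k \<and> nmem s4 7 0 = v \<and> nmem s4 0 = nmem s 0 \<and> rmem s4 0 = rmem s 0 \<and>
        nmem s4 4 = nmem s1 4 \<and>
        rmem s4 1 = (\<lambda>c. if c < q then rmem s 1 c + acc v c (nmem s1 3) y' else rmem s 1 c))"
    proof (rule det_Seq[OF det_add_factors[OF f1(1) vV(1)]])
      show "nmem s1 0 0 = q" using f1 step.prems by simp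
      fix s2 :: mem
      assume s2: "rmem s2 1 = (\<lambda>c. if c < q then rmem s1 1 c + acc v c (nmem s1 3) (nmem s1 4) else rmem s1 1 c) \<and>
       (\<forall>a. a \<noteq> 8 \<longrightarrow> a \<noteq> 10 \<longrightarrow> nmem s2 a = nmem s1 a) \<and>
       (\<forall>a. a \<noteq> 1 \<longrightarrow> a \<noteq> 2 \<longrightarrow> rmem s2 a = rmem s1 a)"
      have n2: "nmem s2 a = nmem s1 a" if "a \<noteq> 8" "a \<noteq> 10" for a using s2 that by simp
      show "det (Seq unpin nx) s2 (1 + (6 * ?d + 3) + 1) (\<lambda>s4. nmem s4 3 = st \<and> nmem s4 11 0 = Suc k \<and>
        nmem s4 7 0 = v \<and> nmem s4 0 = nmem s 0 \<and> rmem s4 0 = rmem s 0 \<and> nmem s4 4 = nmem s1 4 \<and>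
        rmem s4 1 = (\<lambda>c. if c < q then rmem s 1 c + acc v c (nmem s1 3) y' else rmem s 1 c))"
      proof (rule det_Seq[OF det_unpin[OF _ vV(1)]])
        show "nmem s2 7 0 = v" using n2 f1 by simp
        fix s3 :: mem
        assume s3: "nmem s3 3 = (\<lambda>u. if u \<in> set (adj v) \<and> nmem s2 3 u = v + 3 then 0 else nmem s2 3 u) \<and>
         (\<forall>a. a \<noteq> 10 \<longrightarrow> a \<noteq> 3 \<longrightarrow> nmem s3 a = nmem s2 a) \<and> rmem s3 = rmem s2"
        have "nmem s2 3 = nmem s1 3" using n2 by simp
        then have st3: "nmem s3 3 = st"
          using conjunct1[OF s3] unpin_restores[OF s1(3)] no unfolding step.prems(2) by metis
        have r2: "rmem s2 1 = (\<lambda>c. if c < q then rmem s 1 c + acc v c (nmem s1 3) y' else rmem s 1 c)"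
          using conjunct1[OF s2] unfolding f1(5) acc .
        have n3: "nmem s3 a = nmem s1 a" if "a \<notin> {3, 8, 10}" for a using s3 n2 that by simp
        show "det nx s3 1 (\<lambda>s4. nmem s4 3 = st \<and> nmem s4 11 0 = Suc k \<and>
        nmem s4 7 0 = v \<and> nmem s4 0 = nmem s 0 \<and> rmem s4 0 = rmem s 0 \<and> nmem s4 4 = nmem s1 4 \<and>
        rmem s4 1 = (\<lambda>c. if c < q then rmem s 1 c + acc v c (nmem s1 3) y' else rmem s 1 c))"
          unfolding nx_def
          by (rule det_NAssign) (use s3 s2 in \<open>simp add: st3 n3 f1 step.prems r2 del: One_nat_def\<close>)
      qed
    qed
    then have "W n (Seq add_factors (Seq unpin nx) # sample_loop # K, s1) \<le>
       \<kappa> * real (1 + (q * (7 * ?d + 10) + 3) + (1 + (6 * ?d + 3) + 1)) + G"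
    proof (rule detD)
      fix s4 :: mem
      assume s4: "nmem s4 3 = st \<and> nmem s4 11 0 = Suc k \<and> nmem s4 7 0 = v \<and> nmem s4 0 = nmem s 0 \<and> rmem s4 0 = rmem s 0 \<and>
        nmem s4 4 = nmem s1 4 \<and>
        rmem s4 1 = (\<lambda>c. if c < q then rmem s 1 c + acc v c (nmem s1 3) y' else rmem s 1 c)"
      have "W n (sample_loop # K, s4) \<le> C +
         (\<Sum>c<q. ((rmem s4 1 c - real (Suc k) * ?m c)\<^sup>2 + real (N - Suc k)) * w c)"
        unfolding C_def by (rule step.IH) (use s4 step.prems f1 in auto)
      also have "\<dots> = G" unfolding G_def using s4 by simp
      finally show "W n (sample_loop # K, s4) \<le> G" .
    qed
    then show ?thesis unfolding \<phi>_def G_def tl_def by (simp add: algebra_simps)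
  qed
  have rv: "revE v (adj v) st y \<phi> \<le> \<kappa> * tl + C +
      (\<Sum>c<q. ((rmem s 1 c - real k * ?m c)\<^sup>2 + real (N - k)) * w c)"
  proof -
    have sub: "set (adj v) \<subseteq> V" using set_adj[OF vV(1)] neighbors_V by auto
    let ?D = "\<lambda>c. rmem s 1 c - real k * ?m c"
    have Nk: "real (N - k) = real (N - Suc k) + 1" using step.hyps(2) by simp
    \<comment> \<open>The deviation of \<open>acc\<close> from its mean is at most 1 in absolute
      value, so its square is replaced by 1. The majorant is affine in \<open>acc\<close>, and its
      expectation needs only the mean.\<close>
    have "revE v (adj v) st y \<phi> \<le> revE v (adj v) st y (\<lambda>st' y'. (\<kappa> * tl + C +
        (\<Sum>c<q. ((?D c)\<^sup>2 - 2 * ?D c * ?m c + real (N - k)) * w c)) + (\<Sum>c<q. 2 * ?D c * w c * acc v c st' y'))"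
    proof (rule revE_mono[OF v(3) sub distinct_adj[OF vV(1)]])
      fix st' y' assume val: "valid st' y'"
      have "((rmem s 1 c + acc v c st' y' - real (Suc k) * ?m c)\<^sup>2 + real (N - Suc k)) * w c \<le>
        ((?D c)\<^sup>2 - 2 * ?D c * ?m c + real (N - k)) * w c + 2 * ?D c * w c * acc v c st' y'"
        if c: "c < q" for c
      proof -
        have X: "0 \<le> acc v c st' y'" "acc v c st' y' \<le> 1"
          using acc_bounds[OF vV(1) c] val by (auto simp: valid_def)
        have M: "0 \<le> ?m c" "?m c \<le> 1"
          using acc_mean_bounds[OF v(3,1) c] eta by (auto intro: order_trans[rotated])
        have "(acc v c st' y' - ?m c)\<^sup>2 \<le> 1"
          using X M by (simp add: abs_square_le_1 abs_le_iff)
        then have ineq: "(?D c + (acc v c st' y' - ?m c))\<^sup>2 + real (N - Suc k) \<le>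
          (?D c)\<^sup>2 - 2 * ?D c * ?m c + real (N - k) + 2 * ?D c * acc v c st' y'"
          unfolding power2_sum Nk by (simp add: algebra_simps)
        have eq: "rmem s 1 c + acc v c st' y' - real (Suc k) * ?m c = ?D c + (acc v c st' y' - ?m c)"
          by (simp add: algebra_simps)
        have "((rmem s 1 c + acc v c st' y' - real (Suc k) * ?m c)\<^sup>2 + real (N - Suc k)) * w c \<le>
          ((?D c)\<^sup>2 - 2 * ?D c * ?m c + real (N - k) + 2 * ?D c * acc v c st' y') * w c"
          unfolding eq using ineq w by (rule mult_right_mono)
        also have "\<dots> = ((?D c)\<^sup>2 - 2 * ?D c * ?m c + real (N - k)) * w c + 2 * ?D c * w c * acc v c st' y'"
          by (simp only: distrib_right) (simp only: mult_ac)
        finally show ?thesis .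
      qed
      then have "(\<Sum>c<q. ((rmem s 1 c + acc v c st' y' - real (Suc k) * ?m c)\<^sup>2 + real (N - Suc k)) * w c) \<le>
        (\<Sum>c<q. ((?D c)\<^sup>2 - 2 * ?D c * ?m c + real (N - k)) * w c + 2 * ?D c * w c * acc v c st' y')"
        by (intro sum_mono) auto
      then show "\<phi> st' y' \<le> (\<kappa> * tl + C +
        (\<Sum>c<q. ((?D c)\<^sup>2 - 2 * ?D c * ?m c + real (N - k)) * w c)) + (\<Sum>c<q. 2 * ?D c * w c * acc v c st' y')"
        unfolding \<phi>_def by (simp add: sum.distrib)
    qed
    also have "\<dots> = (\<kappa> * tl + C + (\<Sum>c<q. ((?D c)\<^sup>2 - 2 * ?D c * ?m c + real (N - k)) * w c)) +
        (\<Sum>c<q. 2 * ?D c * w c * ?m c)"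
      unfolding acc_mean_def
      by (simp only: revE_add revE_const[OF v(3) sub distinct_adj[OF vV(1)]] revE_sum[OF finite_lessThan] revE_cmult)
    also have "\<dots> = \<kappa> * tl + C + (\<Sum>c<q. ((?D c)\<^sup>2 - 2 * ?D c * ?m c + real (N - k)) * w c + 2 * ?D c * w c * ?m c)"
      by (simp add: sum.distrib)
    also have "(\<Sum>c<q. ((?D c)\<^sup>2 - 2 * ?D c * ?m c + real (N - k)) * w c + 2 * ?D c * w c * ?m c) =
      (\<Sum>c<q. ((?D c)\<^sup>2 + real (N - k)) * w c)"
      by (intro sum.cong refl) (simp add: algebra_simps)
    finally show ?thesis .
  qed
  have "W n (sample_loop # K, s) \<le> \<kappa> + W n (Seq reveal (Seq add_factors (Seq unpin nx)) # sample_loop # K, s)"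
    unfolding sample_loop_def nx_def
    by (rule order_trans[OF W_While_le]) (use step.prems N(1)[OF step.hyps(2)] in simp)
  also have "W n (Seq reveal (Seq add_factors (Seq unpin nx)) # sample_loop # K, s) \<le>
     \<kappa> + W n (reveal # Seq add_factors (Seq unpin nx) # sample_loop # K, s)" by (rule W_Seq)
  also have "W n (reveal # Seq add_factors (Seq unpin nx) # sample_loop # K, s) \<le>
     \<kappa> * (20 * real ?d + (loop_time + 5) / 2 + 3) + revE v (adj v) (nmem s 3) y \<phi>"
  proof (rule W_reveal)
    show "W n (Seq add_factors (Seq unpin nx) # sample_loop # K, s1) \<le> \<phi> (nmem s1 3) y'"
      if "valid (nmem s1 3) y'" "\<And>w. w \<notin> free (nmem s1 3) \<Longrightarrow> nmem s1 4 w = y' w"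
        "\<And>u. nmem s1 3 u = nmem s 3 u \<or> (nmem s 3 u = 0 \<and> u \<in> set (adj v) \<and> nmem s1 3 u = v + 3)"
        "frame v s s1" for y' s1
      using that by (rule after)
    show "nmem s 4 w = y w" if "w \<notin> free (nmem s 3)" for w
      using that step.prems(2,3) by simp
  qed (use step.prems(1,2) vV v loop_time_nonneg resolves_resolvable in auto)
  also have "revE v (adj v) (nmem s 3) y \<phi> \<le> \<kappa> * tl + C +
      (\<Sum>c<q. ((rmem s 1 c - real k * ?m c)\<^sup>2 + real (N - k)) * w c)"
    unfolding step.prems(2) by (rule rv)
  finally have "W n (sample_loop # K, s) \<le> \<kappa> * (sample_time v) + C +
      (\<Sum>c<q. ((rmem s 1 c - real k * ?m c)\<^sup>2 + real (N - k)) * w c)"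
    unfolding sample_time_def tl_def by (simp add: algebra_simps)
  also have "\<kappa> * sample_time v + C = B + \<kappa> * (real (N - k) * sample_time v + 1)"
  proof -
    have "real (N - k) = 1 + real (N - Suc k)" using step.hyps(2) by simp
    then show ?thesis unfolding C_def by (simp only: distrib_left distrib_right)
  qed
  finally show ?case .
qed

end

text \<open>The thirds come from (1 + \<epsilon>/3) / (1 - \<epsilon>/3) \<le> 1 + \<epsilon> and (1
  - \<epsilon>/3) / (1 + \<epsilon>/3) \<ge> 1 - \<epsilon> on the unit interval. The hypotheses
  concern the products \<open>l * S\<close> and \<open>l * m\<close>, so that spins of field 0 are
  included.\<close>

lemma ratio_bounds:
  fixes \<epsilon> l m S D N \<alpha> :: real
  assumes e: "0 < \<epsilon>" "\<epsilon> < 1" and N: "N > 0" and \<alpha>: "\<alpha> > 0" and lm: "l * m \<ge> 0"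
    and S: "(1 - \<epsilon> / 3) * (N * (l * m)) \<le> l * S" "l * S \<le> (1 + \<epsilon> / 3) * (N * (l * m))"
    and D: "(1 - \<epsilon> / 3) * (N * \<alpha>) \<le> D" "D \<le> (1 + \<epsilon> / 3) * (N * \<alpha>)"
  shows "(1 - \<epsilon>) * (l * m / \<alpha>) \<le> l * S / D" "l * S / D \<le> (1 + \<epsilon>) * (l * m / \<alpha>)"
proof -
  have pos: "(1 - \<epsilon> / 3) * (N * \<alpha>) > 0" using e N \<alpha> by simp
  then have D0: "D > 0" using D(1) by linarith
  have Nlm: "N * (l * m) \<ge> 0" using N lm by (intro mult_nonneg_nonneg[OF _ lm]) simp
  have "(1 - \<epsilon>) * (l * m / \<alpha>) * D \<le> (1 - \<epsilon>) * (l * m / \<alpha>) * ((1 + \<epsilon> / 3) * (N * \<alpha>))"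
    using D(2) e lm \<alpha> by (intro mult_left_mono) auto
  also have "\<dots> = (1 - \<epsilon>) * (1 + \<epsilon> / 3) * (N * (l * m))" using \<alpha> by simp
  also have "\<dots> \<le> (1 - \<epsilon> / 3) * (N * (l * m))"
  proof (rule mult_right_mono[OF _ Nlm])
    have "\<epsilon> * \<epsilon> \<ge> 0" by simp
    then show "(1 - \<epsilon>) * (1 + \<epsilon> / 3) \<le> 1 - \<epsilon> / 3" using e by (simp add: field_simps)
  qed
  also have "\<dots> \<le> l * S" by (rule S(1))
  finally show "(1 - \<epsilon>) * (l * m / \<alpha>) \<le> l * S / D" using D0 by (simp add: pos_le_divide_eq)
  have "l * S \<le> (1 + \<epsilon> / 3) * (N * (l * m))" by (rule S(2))
  also have "\<dots> \<le> (1 + \<epsilon>) * (1 - \<epsilon> / 3) * (N * (l * m))"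
  proof (rule mult_right_mono[OF _ Nlm])
    have "\<epsilon> * \<epsilon> \<le> \<epsilon> * 1" using e by (intro mult_left_mono) auto
    then show "1 + \<epsilon> / 3 \<le> (1 + \<epsilon>) * (1 - \<epsilon> / 3)" by (simp add: field_simps)
  qed
  also have "\<dots> = (1 + \<epsilon>) * (l * m / \<alpha>) * ((1 - \<epsilon> / 3) * (N * \<alpha>))" using \<alpha> by simp
  also have "\<dots> \<le> (1 + \<epsilon>) * (l * m / \<alpha>) * D"
    using D(1) e lm \<alpha> by (intro mult_left_mono) auto
  finally show "l * S / D \<le> (1 + \<epsilon>) * (l * m / \<alpha>)" using D0 by (simp add: pos_divide_le_eq)
qed

section \<open>Accuracy and running time of the main procedure\<close>

context sampler
begin

definition main_time :: "nat \<Rightarrow> nat list \<Rightarrow> nat \<Rightarrow> real" where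
  "main_time v L N = real N * sample_time v + real (6 * length L) + real (10 * q) + 30"

text \<open>The payoff is \<nu> times the failure indicator, so one statement covers \<kappa> = 1,
  \<nu> = 0 (time) and \<kappa> = 0, \<nu> = 1 (error probability).\<close>

lemma W_main:
  fixes \<epsilon> \<delta> \<nu> :: real
  assumes \<Lambda>: "\<Lambda> \<subseteq> V" "distinct L" "set L = \<Lambda>" and \<sigma>: "\<sigma> \<in> configs S \<Lambda>"
    and pos: "gibbs_marginal S \<Lambda> \<sigma> > 0" and v: "v \<in> V - \<Lambda>"
    and e: "0 < \<epsilon>" "\<epsilon> < 1" and d: "0 < \<delta>" "\<delta> < 1"
    and N: "\<And>k. k < N \<Longrightarrow> real k * (\<epsilon> * \<epsilon> * \<delta>) < 36 * real q" "\<not> real N * (\<epsilon> * \<epsilon> * \<delta>) < 36 * real q"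
    and Q: "\<And>s. Q s \<longleftrightarrow> (\<forall>c<q. (1 - \<epsilon>) * cond_marginal S \<Lambda> \<sigma> v c \<le> output_estimate s c \<and>
                         output_estimate s c \<le> (1 + \<epsilon>) * cond_marginal S \<Lambda> \<sigma> v c)"
    and f: "\<And>s. f s = \<nu> * of_bool (\<not> Q s)" and \<nu>: "\<nu> \<ge> 0"
  shows "W n ([Call 0], input_mem q v L \<sigma> \<epsilon> \<delta>) \<le> \<kappa> * main_time v L N + \<nu> * \<delta>"
proof -
  let ?s = "input_mem q v L \<sigma> \<epsilon> \<delta>"
  define st0 :: "nat \<Rightarrow> nat" where "st0 = (\<lambda>u. if u \<in> \<Lambda> then 2 else 0)"
  define y :: "nat \<Rightarrow> nat" where "y = (\<lambda>u. if u \<in> \<Lambda> then \<sigma> u else 0)"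
  define st where "st = st0(v := 1)"
  have st0: "st(v := 0) = st0" using v by (auto simp: st_def st0_def)
  have val0: "valid st0 y" and cm: "\<And>c. c < q \<Longrightarrow> cond_marginal S \<Lambda> \<sigma> v c = marg st0 y v c"
    using cond_marginal_eq_marg[OF \<Lambda>(1) \<sigma> pos v, of st0 y] by (auto simp: st0_def y_def)
  have act: "active v st" using v by (auto simp: active_def st_def st0_def)
  have own: "owned st" by (auto simp: owned_def st_def st0_def)
  have val: "valid st y" using valid_active[of st v y] val0 act st0 by simp
  let ?m = "acc_mean v st y"
  have m: "?m c \<ge> 1 / 2" if "c < q" for c
    using acc_mean_bounds(1)[OF val act that] eta(1) by (auto intro: order_trans[rotated])
  have q0: "real q > 0" using q_ge_2 by simp
  have N0: "real N > 0"
  proof (rule ccontr)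
    assume "\<not> real N > 0"
    then show False using N(2) q0 by simp
  qed
  have eed: "\<epsilon> * \<epsilon> * \<delta> > 0" using e d by simp
  \<comment> \<open>Chebyshev weights: the squared deviation times \<open>w c\<close> reaches \<nu>
    as soon as the relative error of the sum for \<open>c\<close> reaches \<epsilon> / 3.\<close>
  define w where "w = (\<lambda>c. \<nu> / (real N * (\<epsilon> / 3) * ?m c)\<^sup>2)"
  have w0: "w c \<ge> 0" for c using \<nu> by (simp add: w_def)
  \<comment> \<open>The potential starts at N * w c for each spin, which is at most \<nu> * \<delta>
    / q because N * \<epsilon>^2 * \<delta> \<ge> 36 q; the union bound is the sum over the
    spins.\<close>
  have sum_w: "(\<Sum>c<q. real N * w c) \<le> \<nu> * \<delta>"
  proof -
    have "real N * w c \<le> \<nu> * \<delta> / real q" if "c < q" for c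
    proof -
      have "(1 / 2)\<^sup>2 \<le> (?m c)\<^sup>2" using m[OF that] by (intro power_mono) auto
      then have "real N * real N * (\<epsilon> * \<epsilon> / 9) * (1 / 4) \<le> real N * real N * (\<epsilon> * \<epsilon> / 9) * (?m c)\<^sup>2"
        by (intro mult_left_mono) (auto simp: power2_eq_square)
      also have "\<dots> = (real N * (\<epsilon> / 3) * ?m c)\<^sup>2" by (simp add: power2_eq_square)
      finally have sq: "real N * real N * (\<epsilon> * \<epsilon> / 9) * (1 / 4) \<le> (real N * (\<epsilon> / 3) * ?m c)\<^sup>2" .
      have "?m c > 0" using m[OF that] by simp
      then have "w c \<le> \<nu> / (real N * real N * (\<epsilon> * \<epsilon> / 9) * (1 / 4))"
        unfolding w_def using N0 e
        by (intro divide_left_mono sq \<nu> mult_pos_pos zero_less_power) auto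
      then have "real N * w c \<le> real N * (\<nu> / (real N * real N * (\<epsilon> * \<epsilon> / 9) * (1 / 4)))"
        by (intro mult_left_mono) auto
      also have "\<dots> = \<nu> * (36 / (real N * (\<epsilon> * \<epsilon>)))" using N0 by simp
      also have "\<dots> \<le> \<nu> * (\<delta> / real q)"
      proof (intro mult_left_mono \<nu>)
        have "36 * real q \<le> \<delta> * (real N * (\<epsilon> * \<epsilon>))" using N(2) by (simp add: algebra_simps)
        then show "36 / (real N * (\<epsilon> * \<epsilon>)) \<le> \<delta> / real q"
          using N0 e q0 by (simp add: divide_le_eq pos_le_divide_eq)
      qed
      finally show ?thesis by simp
    qed
    then have "(\<Sum>c<q. real N * w c) \<le> (\<Sum>c<q. \<nu> * \<delta> / real q)" by (intro sum_mono) auto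
    also have "\<dots> = \<nu> * \<delta>" using q0 by simp
    finally show ?thesis .
  qed
  define \<alpha> where "\<alpha> = (\<Sum>a<q. vfield S v a * ?m a)"
  have lam: "vfield S v a \<ge> 0" if "a < q" for a using vfield_nonneg[of v a] v that by simp
  have \<alpha>: "\<alpha> > 0"
  proof -
    have "1 / 2 = (\<Sum>a<q. vfield S v a * (1 / 2))"
      using vfield_sum[of v] v by (simp only: sum_distrib_right[symmetric]) simp
    also have "\<dots> \<le> \<alpha>" unfolding \<alpha>_def using lam m by (intro sum_mono mult_left_mono) auto
    finally show ?thesis by simp
  qed
  have cm': "cond_marginal S \<Lambda> \<sigma> v c = vfield S v c * ?m c / \<alpha>" if "c < q" for c
  proof -
    have "marg st0 y v c * \<alpha> = vfield S v c * ?m c"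
      unfolding \<alpha>_def using marg_active[of st v y c] val0 act st0 by simp
    then show ?thesis using cm[OF that] \<alpha> by (simp add: field_simps)
  qed
  \<comment> \<open>Pointwise form of Chebyshev's inequality and the union bound: either all sums
    are accurate and the output succeeds, or one spin alone contributes \<nu>.\<close>
  have final: "f s'' \<le> (\<Sum>c<q. (rmem s' 1 c - real N * ?m c)\<^sup>2 * w c)"
    if out: "\<forall>c<q. rmem s'' 1 c = vfield S v c * rmem s' 1 c / (\<Sum>j<q. vfield S v j * rmem s' 1 j)"
    for s' s'' :: mem
  proof (cases "\<forall>c<q. \<bar>rmem s' 1 c - real N * ?m c\<bar> \<le> real N * (\<epsilon> / 3) * ?m c")
    case True
    have b: "(1 - \<epsilon> / 3) * (real N * (vfield S v c * ?m c)) \<le> vfield S v c * rmem s' 1 c"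
      "vfield S v c * rmem s' 1 c \<le> (1 + \<epsilon> / 3) * (real N * (vfield S v c * ?m c))" if "c < q" for c
    proof -
      have "real N * ?m c - real N * (\<epsilon> / 3) * ?m c \<le> rmem s' 1 c"
        "rmem s' 1 c \<le> real N * ?m c + real N * (\<epsilon> / 3) * ?m c"
        using abs_le_D1[of "rmem s' 1 c - real N * ?m c"] abs_le_D2[of "rmem s' 1 c - real N * ?m c"]
          True[rule_format, OF that] by (simp_all only: diff_le_eq minus_diff_eq)
      from this[THEN mult_left_mono, OF lam[OF that]]
      show "(1 - \<epsilon> / 3) * (real N * (vfield S v c * ?m c)) \<le> vfield S v c * rmem s' 1 c"
        "vfield S v c * rmem s' 1 c \<le> (1 + \<epsilon> / 3) * (real N * (vfield S v c * ?m c))"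
        by (simp_all add: algebra_simps)
    qed
    \<comment> \<open>Relative accuracy passes to the normalizing sum, a nonnegative combination of
      the sums.\<close>
    have D: "(1 - \<epsilon> / 3) * (real N * \<alpha>) \<le> (\<Sum>j<q. vfield S v j * rmem s' 1 j)"
      "(\<Sum>j<q. vfield S v j * rmem s' 1 j) \<le> (1 + \<epsilon> / 3) * (real N * \<alpha>)"
      unfolding \<alpha>_def sum_distrib_left using b by (auto intro!: sum_mono)
    have "Q s''"
      unfolding Q output_estimate_def
    proof (intro allI impI)
      fix c assume c: "c < q"
      have "vfield S v c * ?m c \<ge> 0" using lam[OF c] m[OF c] by simp
      from ratio_bounds[OF e N0 \<alpha> this b[OF c] D]
      show "(1 - \<epsilon>) * cond_marginal S \<Lambda> \<sigma> v c \<le> rmem s'' 1 c \<and>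
            rmem s'' 1 c \<le> (1 + \<epsilon>) * cond_marginal S \<Lambda> \<sigma> v c"
        using out c cm'[OF c] by simp
    qed
    then have "f s'' = 0" by (simp add: f)
    then show ?thesis using w0 by (auto intro!: sum_nonneg)
  next
    case False
    then obtain c where c: "c < q" "\<bar>rmem s' 1 c - real N * ?m c\<bar> > real N * (\<epsilon> / 3) * ?m c" by force
    define x where "x = real N * (\<epsilon> / 3) * ?m c"
    have x: "x > 0" unfolding x_def using N0 e m[OF c(1)] by simp
    then have "x\<^sup>2 \<le> (rmem s' 1 c - real N * ?m c)\<^sup>2"
      using c(2) unfolding x_def[symmetric] by (metis less_imp_le power2_abs power_mono)
    then have "x\<^sup>2 * w c \<le> (rmem s' 1 c - real N * ?m c)\<^sup>2 * w c"
      using w0 by (rule mult_right_mono)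
    moreover have "x\<^sup>2 * w c = \<nu>" using x unfolding w_def x_def[symmetric] by simp
    moreover have "f s'' \<le> \<nu>" unfolding f using \<nu> by simp
    moreover have "(rmem s' 1 c - real N * ?m c)\<^sup>2 * w c \<le> (\<Sum>c<q. (rmem s' 1 c - real N * ?m c)\<^sup>2 * w c)"
      using c(1) w0 by (intro member_le_sum) auto
    ultimately show ?thesis by linarith
  qed
  have after_loop: "W n ([normalize_sums], s') \<le> \<kappa> * real (10 * q + 8) +
      (\<Sum>c<q. (rmem s' 1 c - real N * ?m c)\<^sup>2 * w c)"
    if "nmem s' 7 0 = v" "nmem s' 0 0 = q" for s'
    by (rule detD[OF det_normalize_sums[OF that]]) (use final in simp)
  let ?L = "Seq sample_loop normalize_sums"
  let ?M = "Seq (NAssign 7 (NConst 0) (NArr 0 (NConst 1)))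
     (Seq (NAssign 3 cur (NConst 1)) (Seq (NAssign 11 (NConst 0) (NConst 0)) ?L))"
  have after_read: "W n ([?M], s1) \<le>
      \<kappa> * (8 + real (10 * q + 8) + real N * sample_time v) + \<nu> * \<delta>"
    if s1: "nmem s1 3 = st0" "nmem s1 4 = y" "nmem s1 0 = nmem ?s 0" "rmem s1 = rmem ?s" for s1
  proof -
    let ?s2 = "nwrite 7 0 v s1"
    let ?s3 = "nwrite 3 v 1 ?s2"
    let ?s4 = "nwrite 11 0 0 ?s3"
    have "W n ([?M], s1) \<le> 2 * \<kappa> + W n ([Seq (NAssign 3 cur (NConst 1)) (Seq (NAssign 11 (NConst 0) (NConst 0)) ?L)], ?s2)"
      by (rule order_trans[OF W_Seq_NAssign]) (simp add: s1 input_mem_def)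
    also have "\<dots> \<le> 2 * \<kappa> + (2 * \<kappa> + W n ([Seq (NAssign 11 (NConst 0) (NConst 0)) ?L], ?s3))"
      by (intro add_left_mono, rule order_trans[OF W_Seq_NAssign]) simp
    also have "\<dots> \<le> 2 * \<kappa> + (2 * \<kappa> + (2 * \<kappa> + W n ([?L], ?s4)))"
      by (intro add_left_mono, rule order_trans[OF W_Seq_NAssign]) simp
    also have "\<dots> \<le> 2 * \<kappa> + (2 * \<kappa> + (2 * \<kappa> + (\<kappa> + W n ([sample_loop, normalize_sums], ?s4))))"
      by (intro add_left_mono W_Seq)
    also have "W n ([sample_loop, normalize_sums], ?s4) \<le> \<kappa> * real (10 * q + 8) + \<kappa> * (real (N - 0) * sample_time v + 1) +
       (\<Sum>c<q. ((rmem ?s4 1 c - real 0 * ?m c)\<^sup>2 + real (N - 0)) * w c)"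
    proof (rule W_sample_loop[OF act own val N w0])
      show "W n ([normalize_sums], s') \<le> \<kappa> * real (10 * q + 8) +
        (\<Sum>c<q. (rmem s' 1 c - real N * ?m c)\<^sup>2 * w c)"
        if "nmem s' 7 0 = v" "nmem s' 0 0 = q" for s' using that by (rule after_loop)
    qed (simp_all add: s1 input_mem_def st_def)
    also have "(\<Sum>c<q. ((rmem ?s4 1 c - real 0 * ?m c)\<^sup>2 + real (N - 0)) * w c) = (\<Sum>c<q. real N * w c)"
      by (simp add: s1 input_mem_def)
    also have "\<dots> \<le> \<nu> * \<delta>" by (rule sum_w)
    finally show ?thesis by (simp add: algebra_simps)
  qed
  have "W n ([Call 0], ?s) \<le> \<kappa> + W n ([main], ?s)"
    using W_Call[of 0 n "[]" ?s] by simp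
  also have "W n ([main], ?s) \<le> \<kappa> + W n ([read_pinning, ?M], ?s)"
    using W_Seq[of n read_pinning ?M "[]" ?s, folded main_def] .
  also have "W n ([read_pinning, ?M], ?s) \<le> \<kappa> * real (6 * length L + 3) +
     (\<kappa> * (8 + real (10 * q + 8) + real N * sample_time v) + \<nu> * \<delta>)"
  proof (rule detD[OF det_read_pinning[where L = L and \<sigma> = \<sigma>]])
    fix s1 :: mem
    assume "nmem s1 3 = (\<lambda>u. if u \<in> set L then 2 else nmem ?s 3 u) \<and>
       nmem s1 4 = (\<lambda>u. if u \<in> set L then \<sigma> u else nmem ?s 4 u) \<and>
       (\<forall>a. a \<noteq> 3 \<longrightarrow> a \<noteq> 4 \<longrightarrow> a \<noteq> 11 \<longrightarrow> nmem s1 a = nmem ?s a) \<and> rmem s1 = rmem ?s"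
    then show "W n ([?M], s1) \<le> \<kappa> * (8 + real (10 * q + 8) + real N * sample_time v) + \<nu> * \<delta>"
      by (intro after_read) (auto simp: input_mem_def st0_def y_def \<Lambda>(3))
  qed (simp_all add: input_mem_def)
  finally have "W n ([Call 0], ?s) \<le> \<kappa> * (2 + real (6 * length L + 3) + (8 + real (10 * q + 8) + real N * sample_time v)) + \<nu> * \<delta>"
    by (simp add: algebra_simps)
  also have "\<dots> \<le> \<kappa> * main_time v L N + \<nu> * \<delta>"
    unfolding main_time_def by (intro add_right_mono mult_left_mono \<kappa>_nonneg) simp
  finally show ?thesis .
qed

text \<open>One round costs O(q \<Delta> / \<eta>) and there are at most 37 q / (\<epsilon>^2
  \<delta>) rounds, so every term is compared with one product \<open>Y\<close>. The logarithm
  enters at the end through ln q \<ge> ln 2, whence ln 2 in the constant; the maximum with 1 covers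
  an empty \<Lambda>.\<close>

lemma main_time_le:
  fixes \<epsilon> \<delta> :: real
  assumes v: "v \<in> V" and e: "0 < \<epsilon>" "\<epsilon> < 1" and d: "0 < \<delta>" "\<delta> < 1"
    and N: "real N \<le> 36 * real q / (\<epsilon> * \<epsilon> * \<delta>) + 1"
  shows "main_time v L N \<le> 15000 / (\<eta> * ln 2) * (1 / \<epsilon>\<^sup>2) * (1 / \<delta>) * real \<Delta> * (real q)\<^sup>2 *
    ln (real q) * real (max 1 (length L))"
proof -
  define x where "x = real q / (\<epsilon> * \<epsilon> * \<delta>)"
  define X where "X = real q * real \<Delta>"
  define M where "M = real (max 1 (length L))"
  define d' where "d' = real (length (adj v))"
  have q2: "real q \<ge> 2" using q_ge_2 by simp
  have D1: "real \<Delta> \<ge> 1" using deg by simp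
  have eed: "\<epsilon> * \<epsilon> * \<delta> > 0" using e d by simp
  have "\<epsilon> * \<epsilon> * \<delta> \<le> 1 * 1 * 1" using e d by (intro mult_mono) auto
  then have "real q * (\<epsilon> * \<epsilon> * \<delta>) \<le> real q * 1" by (intro mult_left_mono) auto
  then have x: "x \<ge> real q" unfolding x_def using eed by (simp add: pos_le_divide_eq)
  have Xq: "X \<ge> real q" unfolding X_def using D1 q2 by (simp add: mult_le_cancel_left1)
  have XD: "X \<ge> real \<Delta>" unfolding X_def using D1 q2 by (simp add: mult_le_cancel_right1)
  have M1: "M \<ge> 1" "M \<ge> real (length L)" unfolding M_def by auto
  have dX: "d' \<le> X" using length_adj_le[OF v] XD unfolding d'_def by simp
  have qd: "real q * d' \<le> X"
    unfolding X_def d'_def using length_adj_le[OF v] by (intro mult_left_mono) auto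
  have X_eta: "X \<le> X / \<eta>" using eta Xq q2 by (simp add: pos_le_divide_eq mult_left_le)
  have lt: "loop_time \<le> 600 * (X / \<eta>)"
  proof -
    have "200 * (real \<Delta> + real q + 1) / \<eta> \<le> 600 * X / \<eta>"
      using Xq XD q2 eta by (intro divide_right_mono) auto
    then show ?thesis unfolding loop_time_def by simp
  qed
  have st: "sample_time v \<le> 360 * (X / \<eta>)"
  proof -
    have "sample_time v = 20 * d' + loop_time / 2 + 11 / 2 + (7 * (real q * d') + 10 * real q + 3) + (6 * d' + 3) + 5"
      unfolding sample_time_def d'_def by (simp add: algebra_simps add_divide_distrib)
    then show ?thesis using dX qd lt Xq q2 X_eta by linarith
  qed
  have "36 * real q / (\<epsilon> * \<epsilon> * \<delta>) = 36 * x" by (simp add: x_def)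
  then have "real N \<le> 36 * x + 1" using N by simp
  then have N': "real N \<le> 37 * x" using x q2 by linarith
  define Y where "Y = x * (X / \<eta>) * M"
  have Xp: "X / \<eta> > 0" using Xq q2 eta by simp
  have "x * (X / \<eta>) \<ge> 1 * (X / \<eta>)" using x q2 Xp by (intro mult_right_mono) auto
  then have xX: "x * (X / \<eta>) \<ge> X / \<eta>" by simp
  then have xX1: "x * (X / \<eta>) \<ge> 1" using X_eta Xq q2 by linarith
  have "x * (X / \<eta>) * 1 \<le> Y" unfolding Y_def using M1(1) xX1 by (intro mult_left_mono) auto
  then have YX: "Y \<ge> x * (X / \<eta>)" by (simp only: mult_1_right)
  have "1 * M \<le> Y" unfolding Y_def using M1(1) xX1 by (intro mult_right_mono) auto
  then have YM: "Y \<ge> M" by (simp only: mult_1_left)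
  have "real N * sample_time v \<le> 37 * x * (360 * (X / \<eta>))"
  proof (rule order_trans[OF mult_left_mono[OF st]])
    show "real N * (360 * (X / \<eta>)) \<le> 37 * x * (360 * (X / \<eta>))"
      using N' Xp by (intro mult_right_mono) auto
  qed simp
  also have "\<dots> = 13320 * (x * (X / \<eta>))" by simp
  also have "\<dots> \<le> 13320 * Y" by (rule mult_left_mono[OF YX]) simp
  finally have NY: "real N * sample_time v \<le> 13320 * Y" .
  have qY: "real q \<le> Y" by (rule order_trans[OF Xq order_trans[OF X_eta order_trans[OF xX YX]]])
  have "main_time v L N \<le> 13320 * Y + 6 * Y + 10 * Y + 30 * Y"
    using NY qY YM M1 unfolding main_time_def of_nat_mult of_nat_numeral by linarith
  also have "\<dots> \<le> 15000 * Y" using YM M1 by simp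
  also have "\<dots> \<le> 15000 * Y * (ln (real q) / ln 2)"
  proof -
    have "ln (real q) / ln 2 \<ge> 1" using q2 by simp
    then have "15000 * Y * 1 \<le> 15000 * Y * (ln (real q) / ln 2)"
      using YM M1 by (intro mult_left_mono) auto
    then show ?thesis by simp
  qed
  also have "\<dots> = 15000 / (\<eta> * ln 2) * (1 / \<epsilon>\<^sup>2) * (1 / \<delta>) * real \<Delta> * (real q)\<^sup>2 *
    ln (real q) * real (max 1 (length L))"
    unfolding Y_def x_def X_def M_def by (simp add: power2_eq_square mult_ac)
  finally show ?thesis .
qed

end

text \<open>\<open>N\<close> exists only in the proof, as the value of \<open>count\<close> at which
  the guard of \<open>sample_loop\<close> first fails; rounding up costs the 1.\<close>

lemma least_iterations:
  fixes a b :: real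
  assumes "a > 0" "b > 0"
  obtains N :: nat where "\<And>k. k < N \<Longrightarrow> real k * a < b" "\<not> real N * a < b" "real N \<le> b / a + 1"
proof -
  define N where "N = (LEAST k. \<not> real k * a < b)"
  obtain k :: nat where "b / a < real k" using reals_Archimedean2 by blast
  then have k: "\<not> real k * a < b" using assms by (simp add: pos_divide_less_eq)
  have less: "real k * a < b" if "k < N" for k
    using not_less_Least[OF that[unfolded N_def]] by blast
  have "\<not> real N * a < b" unfolding N_def using k by (rule LeastI)
  moreover have "real N \<le> b / a + 1"
  proof (cases N)
    case (Suc m)
    then have "real m * a < b" using less by simp
    then show ?thesis using Suc assms by (simp add: pos_le_divide_eq less_imp_le)
  qed (use assms in simp)
  ultimately show ?thesis using less that by blast
qed

theorem theorem1p6: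
  fixes \<eta> :: real
  assumes "\<eta> > 0"
  shows "\<exists>(P :: com list) (C :: real).
    \<forall>(S :: spin_system) (adj :: nat \<Rightarrow> nat list) (\<Lambda> :: nat set) (L :: nat list)
      (\<sigma> :: nat \<Rightarrow> nat) (v :: nat) (\<epsilon> :: real) (\<delta> :: real).
      wf_spin_system S \<longrightarrow> adjacency_lists S adj \<longrightarrow> max_degree S \<ge> 1 \<longrightarrow>
      normalized S \<longrightarrow> soft_constraints \<eta> S \<longrightarrow>
      \<Lambda> \<subseteq> verts S \<longrightarrow> distinct L \<longrightarrow> set L = \<Lambda> \<longrightarrow>
      \<sigma> \<in> configs S \<Lambda> \<longrightarrow> gibbs_marginal S \<Lambda> \<sigma> > 0 \<longrightarrow> v \<in> verts S - \<Lambda> \<longrightarrow>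
      0 < \<epsilon> \<longrightarrow> \<epsilon> < 1 \<longrightarrow> 0 < \<delta> \<longrightarrow> \<delta> < 1 \<longrightarrow>
      prob_halts_with P S adj (input_mem (spins S) v L \<sigma> \<epsilon> \<delta>)
        (\<lambda>s. \<forall>c<spins S. (1 - \<epsilon>) * cond_marginal S \<Lambda> \<sigma> v c \<le> output_estimate s c \<and>
                         output_estimate s c \<le> (1 + \<epsilon>) * cond_marginal S \<Lambda> \<sigma> v c) \<ge> 1 - \<delta> \<and>
      expected_time P S adj (input_mem (spins S) v L \<sigma> \<epsilon> \<delta>) \<le>
        ennreal (C * (1 / \<epsilon>\<^sup>2) * (1 / \<delta>) * real (max_degree S) * (real (spins S))\<^sup>2 *
                 ln (real (spins S)) * real (max 1 (card \<Lambda>)))"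
proof -
  \<comment> \<open>The analysis wants \<eta> \<le> 1, as for the sign of (1 - \<eta>) / (2
    \<Delta>); lowering \<eta> only weakens the soft constraints.\<close>
  define \<theta> where "\<theta> = min \<eta> 1"
  show ?thesis
  proof (intro exI[of _ "[main, resolve]"] exI[of _ "15000 / (\<theta> * ln 2)"] allI impI)
    fix S adj \<Lambda> L \<sigma> v and \<epsilon> \<delta> :: real
    assume S: "wf_spin_system S" "adjacency_lists S adj" "max_degree S \<ge> 1" "normalized S"
      "soft_constraints \<eta> S"
      and \<Lambda>: "\<Lambda> \<subseteq> verts S" "distinct L" "set L = \<Lambda>" and \<sigma>: "\<sigma> \<in> configs S \<Lambda>"
      and pos: "gibbs_marginal S \<Lambda> \<sigma> > 0" and v: "v \<in> verts S - \<Lambda>"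
      and e: "0 < \<epsilon>" "\<epsilon> < 1" and d: "0 < \<delta>" "\<delta> < 1"
    define Q where "Q = (\<lambda>s. \<forall>c<spins S. (1 - \<epsilon>) * cond_marginal S \<Lambda> \<sigma> v c \<le> output_estimate s c \<and>
                         output_estimate s c \<le> (1 + \<epsilon>) * cond_marginal S \<Lambda> \<sigma> v c)"
    have "soft_constraints \<theta> S"
    proof -
      have "(1 - \<eta>) / (2 * real (max_degree S)) \<le> (1 - \<theta>) / (2 * real (max_degree S))"
        by (intro divide_right_mono) (auto simp: \<theta>_def)
      then show ?thesis using S(5) unfolding soft_constraints_def by fastforce
    qed
    then interpret soft_spin_system S adj \<theta>
      using S assms by unfold_locales (auto simp: \<theta>_def)
    \<comment> \<open>The same program under two rewards: steps without payoff, and the failure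
      indicator without a price on steps.\<close>
    interpret T: sampler S adj \<theta> 1 "\<lambda>_. 0" by unfold_locales auto
    interpret F: sampler S adj \<theta> 0 "\<lambda>s. of_bool (\<not> Q s)" by unfold_locales auto
    have "\<epsilon> * \<epsilon> * \<delta> > 0" "36 * real q > 0" using e d q_ge_2 by auto
    then obtain N where N: "\<And>k. k < N \<Longrightarrow> real k * (\<epsilon> * \<epsilon> * \<delta>) < 36 * real q"
      "\<not> real N * (\<epsilon> * \<epsilon> * \<delta>) < 36 * real q" "real N \<le> 36 * real q / (\<epsilon> * \<epsilon> * \<delta>) + 1"
      using least_iterations by metis
    have vV: "v \<in> verts S" using v by simp
    have 1: "T.W n ([Call 0], input_mem q v L \<sigma> \<epsilon> \<delta>) \<le> T.main_time v L N" for n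
      using T.W_main[OF \<Lambda> \<sigma> pos v e d N(1,2), of Q 0] by (simp add: Q_def)
    have 2: "F.W n ([Call 0], input_mem q v L \<sigma> \<epsilon> \<delta>) \<le> \<delta>" for n
      using F.W_main[OF \<Lambda> \<sigma> pos v e d N(1,2), of Q 1] by (simp add: Q_def)
    have time: "T.main_time v L N \<le> 15000 / (\<theta> * ln 2) * (1 / \<epsilon>\<^sup>2) * (1 / \<delta>) * real \<Delta> * (real q)\<^sup>2 *
       ln (real q) * real (max 1 (card \<Lambda>))"
      using T.main_time_le[OF vV e d N(3), of L] distinct_card[OF \<Lambda>(2)] \<Lambda>(3) by simp
    show "prob_halts_with [main, resolve] S adj (input_mem q v L \<sigma> \<epsilon> \<delta>)
        (\<lambda>s. \<forall>c<q. (1 - \<epsilon>) * cond_marginal S \<Lambda> \<sigma> v c \<le> output_estimate s c \<and>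
                         output_estimate s c \<le> (1 + \<epsilon>) * cond_marginal S \<Lambda> \<sigma> v c) \<ge> 1 - \<delta> \<and>
      expected_time [main, resolve] S adj (input_mem q v L \<sigma> \<epsilon> \<delta>) \<le>
        ennreal (15000 / (\<theta> * ln 2) * (1 / \<epsilon>\<^sup>2) * (1 / \<delta>) * real \<Delta> * (real q)\<^sup>2 *
                 ln (real q) * real (max 1 (card \<Lambda>)))"
      using halting_bounds[OF 1 2] ennreal_leI[OF time] unfolding Q_def by (auto intro: order_trans)
  qed
qed
end
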